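(* Let $f\in S_{k,m}(\mathrm{GL}_2(A))$ be a simultaneous eigenform for all Hecke operators $\mathbb{T}_\mathfrak{p}$, and suppose $f$ has an $A$-expansion with $A$-exponent $n$. Then \[ f=c_1(f)\sum_{a\in A_+}a^{k-n}G_n(t_a). \] Consequently, up to a multiplicative constant, $f$ is uniquely determined by its weight $k$ and its eigenvalues, which are $\lambda_\mathfrak{p}=\wp^n$ for all $\mathfrak{p}=(\wp)$.
   Context: Let $p$ be a prime, $q=p^e$, $A=\mathbb{F}_q[T]$, and $A_+$ the monic elements of $A$. Let $\mathbb{C}_\infty$ be the completion of an algebraic closure of $K_\infty=\mathbb{F}_q((1/T))$, and let $\Omega=\mathbb{C}_\infty\setminus K_\infty$. Fix a Carlitz period $\widetilde{\pi}$ with Carlitz exponential $e_{\widetilde{\pi}A}(z)=z\prod_{0\neq\lambda\in\widetilde{\pi}A}(1-z/\lambda)$. Put $t(z)=1/e_{\widetilde{\pi}A}(\widetilde{\pi}z)$ and $t_a(z)=t(az)$. $G_n(X)$ is the $n$-th Goss polynomial of $\widetilde{\pi}A$: $G_n(t(z))=\sum_{b\in A}(\widetilde{\pi}z+\widetilde{\pi}b)^{-n}$. $M_{k,m}(\mathrm{GL}_2(A))$ is the space of Drinfeld modular forms of weight $k$ and type $m\in\mathbb{Z}/(q-1)$. These are rigid analytic $f:\Omega\to\mathbb{C}_\infty$ with $f(\gamma z)=(\det\gamma)^{-m}(cz+d)^kf(z)$ for $\gamma=\begin{pmatrix}a&b\\c&d\end{pmatrix}\in\mathrm{GL}_2(A)$,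 having a $t$-expansion $\sum_{i\ge0}a_it^i$ near infinity. $S_{k,m}(\mathrm{GL}_2(A))$ is the subspace with $a_0=0$. $f$ has an $A$-expansion with $A$-exponent $n$ (a positive integer) if there are $c_0(f),c_a(f)\in\mathbb{C}_\infty$ ($a\in A_+$) with $f=c_0(f)+\sum_{a\in A_+}c_a(f)G_n(t_a)$ as formal power series in $t$. Such coefficients are unique given $n$. For each nonzero prime $\mathfrak{p}=(\wp)$, $\wp$ monic, the Hecke operator is $\mathbb{T}_\mathfrak{p}f(z)=\wp^kf(\wp z)+\sum_{\beta\in A,\ \deg\beta<\deg\wp}f((z+\beta)/\wp)$. A simultaneous eigenform is a nonzero $f$ with $\mathbb{T}_\mathfrak{p}f=\lambda_\mathfrak{p}f$ for every nonzero prime $\mathfrak{p}$. *)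

theory Defs
  imports
    "HOL-Analysis.Analysis"
    "HOL-Computational_Algebra.Computational_Algebra"
begin

text \<open>
  The finite field is a type \<open>'q\<close> of class \<open>{field, finite}\<close>, so \<open>q = CARD('q)\<close>, and
  \<open>A = 'q poly\<close>. The field \<open>'q fls\<close> of formal Laurent series is read as the field of Laurent
  series in \<open>1/T\<close>: its indeterminate \<open>fls_X\<close> is \<open>1/T\<close>, and \<open>T\<close> is \<open>fls_X_inv\<close>.
\<close>

definition absv :: "'c::{zero,metric_space} \<Rightarrow> real" where
  "absv x = dist x 0"

text \<open>
  \<open>'c\<close>, with the embedding \<open>\<iota>\<close>, is a completion of an algebraic closure of \<open>'q fls\<close>. The
  algebraic closure in question is the set of elements of \<open>'c\<close> that are algebraic over the image
  of \<open>\<iota>\<close>; completeness is part of the class \<open>complete_space\<close>. The absolute value is normalised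
  by \<open>\<bar>T\<bar> = q\<close>. These properties determine \<open>('c, \<iota>)\<close> up to isometric isomorphism.
\<close>

definition alg_elements :: "('k::field \<Rightarrow> 'c::field) \<Rightarrow> 'c set" where
  "alg_elements \<iota> = {x. \<exists>p. p \<noteq> 0 \<and> poly (map_poly \<iota> p) x = 0}"

locale C_infty =
  fixes \<iota> :: "'q::{field,finite} fls \<Rightarrow> 'c::{field,complete_space}"
  assumes dist_absv: "dist x y = absv (x - y :: 'c)"
    and absv_mult: "absv (x * y :: 'c) = absv x * absv y"
    and absv_add: "absv (x + y :: 'c) \<le> max (absv x) (absv y)"
    and embed_one: "\<iota> 1 = 1"
    and embed_add: "\<iota> (u + v) = \<iota> u + \<iota> v"
    and embed_mult: "\<iota> (u * v) = \<iota> u * \<iota> v"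
    and embed_absv: "u \<noteq> 0 \<Longrightarrow> absv (\<iota> u) = real CARD('q) powi (- fls_subdegree u)"
    and alg_closed: "\<lbrakk>degree p > 0; \<And>i. coeff p i \<in> alg_elements \<iota>\<rbrakk>
                       \<Longrightarrow> \<exists>x \<in> alg_elements \<iota>. poly p x = 0"
    and dense: "closure (alg_elements \<iota>) = UNIV"

text \<open>The image of \<open>a \<in> A\<close>, i.e. the value \<open>a(T)\<close>.\<close>

definition A_emb :: "('q::field fls \<Rightarrow> 'c) \<Rightarrow> 'q poly \<Rightarrow> 'c" where
  "A_emb \<iota> a = \<iota> (poly (map_poly fls_const a) fls_X_inv)"

definition A_plus :: "'q::field poly set" where
  "A_plus = {a. lead_coeff a = 1}"

definition monic_primes :: "'q::field poly set" where
  "monic_primes = {\<pp>. prime_elem \<pp> \<and> lead_coeff \<pp> = 1}"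

definition Omega :: "('q::field fls \<Rightarrow> 'c) \<Rightarrow> 'c set" where
  "Omega \<iota> = - range \<iota>"

text \<open>
  The affinoids of the standard admissible covering of \<open>\<Omega>\<close>, with
  \<open>infdist z (range \<iota>)\<close> the "imaginary part" of \<open>z\<close>. A function is rigid analytic on \<open>\<Omega>\<close> if on
  each of them it is a uniform limit of rational functions without poles there.
\<close>

definition Omega_affinoid ::
    "('q::{field,finite} fls \<Rightarrow> 'c::{zero,metric_space}) \<Rightarrow> nat \<Rightarrow> 'c set" where
  "Omega_affinoid \<iota> j =
     {z. absv z \<le> real CARD('q) ^ j \<and> infdist z (range \<iota>) \<ge> 1 / real CARD('q) ^ j}"

definition rigid_analytic ::
    "('q::{field,finite} fls \<Rightarrow> 'c::{field,metric_space}) \<Rightarrow> ('c \<Rightarrow> 'c) \<Rightarrow> bool" where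
  "rigid_analytic \<iota> f \<longleftrightarrow>
     (\<forall>j. \<exists>P Q :: nat \<Rightarrow> 'c poly.
        (\<forall>i. \<forall>z \<in> Omega_affinoid \<iota> j. poly (Q i) z \<noteq> 0) \<and>
        uniform_limit (Omega_affinoid \<iota> j) (\<lambda>i z. poly (P i) z / poly (Q i) z) f sequentially)"

definition lattice_exp :: "'c set \<Rightarrow> 'c \<Rightarrow> 'c::{field,t2_space}" where
  "lattice_exp \<Lambda> z =
     z * Lim (finite_subsets_at_top (\<Lambda> - {0})) (\<lambda>F. \<Prod>l\<in>F. 1 - z / l)"

definition carlitz_exp ::
    "('q::field fls \<Rightarrow> 'c) \<Rightarrow> 'c \<Rightarrow> 'c \<Rightarrow> 'c::{field,t2_space}" where
  "carlitz_exp \<iota> \<pi> = lattice_exp (range (\<lambda>a. \<pi> * A_emb \<iota> a))"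

text \<open>
  \<open>\<pi>\<close> is a Carlitz period if the rank one Drinfeld module uniformised by the lattice \<open>\<pi>A\<close> is
  the Carlitz module \<open>T \<mapsto> TX + X\<^sup>q\<close>.
\<close>

definition carlitz_period ::
    "('q::{field,finite} fls \<Rightarrow> 'c::{field,t2_space}) \<Rightarrow> 'c \<Rightarrow> bool" where
  "carlitz_period \<iota> \<pi> \<longleftrightarrow> \<pi> \<noteq> 0 \<and>
     (\<forall>z. carlitz_exp \<iota> \<pi> (\<iota> fls_X_inv * z) =
            \<iota> fls_X_inv * carlitz_exp \<iota> \<pi> z + carlitz_exp \<iota> \<pi> z ^ CARD('q))"

definition t_param ::
    "('q::field fls \<Rightarrow> 'c) \<Rightarrow> 'c \<Rightarrow> 'c \<Rightarrow> 'c::{field,t2_space}" where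
  "t_param \<iota> \<pi> z = 1 / carlitz_exp \<iota> \<pi> (\<pi> * z)"

definition goss_poly ::
    "('q::field fls \<Rightarrow> 'c) \<Rightarrow> 'c \<Rightarrow> nat \<Rightarrow> 'c::{field,t2_space} poly" where
  "goss_poly \<iota> \<pi> n = (THE G. \<forall>z \<in> Omega \<iota>.
     ((\<lambda>b. 1 / (\<pi> * z + \<pi> * A_emb \<iota> b) ^ n) has_sum poly G (t_param \<iota> \<pi> z)) UNIV)"

definition has_t_expansion ::
    "('q::field fls \<Rightarrow> 'c) \<Rightarrow> 'c \<Rightarrow> ('c \<Rightarrow> 'c) \<Rightarrow> 'c::{field,metric_space} fps \<Rightarrow> bool" where
  "has_t_expansion \<iota> \<pi> f F \<longleftrightarrow>
     (\<exists>r>0. \<forall>z. infdist z (range \<iota>) \<ge> r \<longrightarrow> (\<lambda>i. fps_nth F i * t_param \<iota> \<pi> z ^ i) sums f z)"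

definition t_expansion ::
    "('q::field fls \<Rightarrow> 'c) \<Rightarrow> 'c \<Rightarrow> ('c \<Rightarrow> 'c) \<Rightarrow> 'c::{field,metric_space} fps" where
  "t_expansion \<iota> \<pi> f = (THE F. has_t_expansion \<iota> \<pi> f F)"

text \<open>\<open>G\<^sub>n(t\<^sub>a)\<close> as a formal power series in \<open>t\<close>.\<close>

definition goss_t ::
    "('q::field fls \<Rightarrow> 'c) \<Rightarrow> 'c \<Rightarrow> nat \<Rightarrow> 'q poly \<Rightarrow> 'c::{field,metric_space} fps" where
  "goss_t \<iota> \<pi> n a =
     poly (map_poly fps_const (goss_poly \<iota> \<pi> n))
          (t_expansion \<iota> \<pi> (\<lambda>z. t_param \<iota> \<pi> (A_emb \<iota> a * z)))"

text \<open>
  The group \<open>GL\<^sub>2(A)\<close> consists of the \<open>2 \<times> 2\<close> matrices invertible over the ring \<open>'q poly\<close>. The type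
  \<open>m\<close> is an integer representing a class modulo \<open>q - 1\<close>.
\<close>

definition modular_forms ::
    "('q::{field,finite} fls \<Rightarrow> 'c::{field,metric_space}) \<Rightarrow> 'c \<Rightarrow> int \<Rightarrow> int \<Rightarrow> ('c \<Rightarrow> 'c) set" where
  "modular_forms \<iota> \<pi> k m = {f.
     rigid_analytic \<iota> f \<and>
     (\<forall>\<gamma> :: 'q poly^2^2. invertible \<gamma> \<longrightarrow> (\<forall>z \<in> Omega \<iota>.
        f ((A_emb \<iota> (\<gamma>$1$1) * z + A_emb \<iota> (\<gamma>$1$2)) / (A_emb \<iota> (\<gamma>$2$1) * z + A_emb \<iota> (\<gamma>$2$2))) =
          A_emb \<iota> (det \<gamma>) powi (- m) * (A_emb \<iota> (\<gamma>$2$1) * z + A_emb \<iota> (\<gamma>$2$2)) powi k * f z)) \<and>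
     (\<exists>F. has_t_expansion \<iota> \<pi> f F)}"

definition cusp_forms ::
    "('q::{field,finite} fls \<Rightarrow> 'c::{field,metric_space}) \<Rightarrow> 'c \<Rightarrow> int \<Rightarrow> int \<Rightarrow> ('c \<Rightarrow> 'c) set" where
  "cusp_forms \<iota> \<pi> k m = {f \<in> modular_forms \<iota> \<pi> k m. fps_nth (t_expansion \<iota> \<pi> f) 0 = 0}"

definition hecke ::
    "('q::field fls \<Rightarrow> 'c::field) \<Rightarrow> int \<Rightarrow> 'q poly \<Rightarrow> ('c \<Rightarrow> 'c) \<Rightarrow> 'c \<Rightarrow> 'c" where
  "hecke \<iota> k \<pp> f z =
     A_emb \<iota> \<pp> powi k * f (A_emb \<iota> \<pp> * z) +
     (\<Sum>\<beta> | degree \<beta> < degree \<pp>. f ((z + A_emb \<iota> \<beta>) / A_emb \<iota> \<pp>))"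

text \<open>Simultaneous eigenform of weight \<open>k\<close> with eigenvalues \<open>ev \<pp>\<close>.\<close>

definition hecke_eigenform ::
    "('q::field fls \<Rightarrow> 'c::field) \<Rightarrow> int \<Rightarrow> ('q poly \<Rightarrow> 'c) \<Rightarrow> ('c \<Rightarrow> 'c) \<Rightarrow> bool" where
  "hecke_eigenform \<iota> k ev f \<longleftrightarrow>
     (\<exists>z \<in> Omega \<iota>. f z \<noteq> 0) \<and>
     (\<forall>\<pp> \<in> monic_primes. \<forall>z \<in> Omega \<iota>. hecke \<iota> k \<pp> f z = ev \<pp> * f z)"

text \<open>
  \<open>f = c0 + (\<Sum>a \<in> A\<^sub>+. c a * G\<^sub>n(t\<^sub>a))\<close> as formal power series in \<open>t\<close>: the sum is taken with respect to
  the \<open>t\<close>-adic topology, which is the one carried by the type \<open>fps\<close>.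
\<close>

definition has_A_expansion ::
    "('q::field fls \<Rightarrow> 'c) \<Rightarrow> 'c \<Rightarrow> nat \<Rightarrow> 'c \<Rightarrow> ('q poly \<Rightarrow> 'c) \<Rightarrow>
     ('c \<Rightarrow> 'c::{field,metric_space}) \<Rightarrow> bool" where
  "has_A_expansion \<iota> \<pi> n c0 c f \<longleftrightarrow>
     ((\<lambda>a. fps_const (c a) * goss_t \<iota> \<pi> n a) has_sum (t_expansion \<iota> \<pi> f - fps_const c0)) A_plus"

end

theory Submission
  imports Defs
begin

text \<open>
  Reading \<open>G\<^sub>n(t\<^sub>a)\<close> as the lattice sum of \<open>(\<pi>az + \<pi>b)\<^sup>-\<^sup>n\<close> over \<open>b \<in> A\<close>, one sees that
  \<open>\<phi> \<mapsto> (\<Sum>\<beta>. \<phi>((z + \<beta>)/\<pp>))\<close> multiplies it by \<open>\<pp>\<^sup>n\<close> if \<open>\<pp>\<close> does not divide \<open>a\<close>, and kills it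
  otherwise, because then every term occurs a multiple of \<open>q\<close> times. Applying these operators for
  all primes of degree at most \<open>E\<close> sieves a vanishing \<open>A\<close>-expansion down to the terms with \<open>a = 1\<close>
  and \<open>deg a > E\<close>; as the latter have high order in \<open>t\<close>, the coefficient at \<open>1\<close> vanishes, and the
  others follow by dividing by primes. Since formal expansions are compared only modulo powers of
  \<open>t\<close>, everything can be done with growth estimates near infinity.

  By this uniqueness, an eigenform with coefficients \<open>c\<close> satisfies \<open>\<lambda>\<^sub>\<pp> c\<^sub>a = \<pp>\<^sup>n c\<^sub>a\<close> if \<open>\<pp>\<close> does not
  divide \<open>a\<close>, and \<open>\<lambda>\<^sub>\<pp> c\<^sub>\<pp>\<^sub>a = \<pp>\<^sup>k c\<^sub>a\<close>. No \<open>\<lambda>\<^sub>\<pp>\<close> can vanish, so \<open>c\<^sub>1 \<noteq> 0\<close>, \<open>\<lambda>\<^sub>\<pp> = \<pp>\<^sup>n\<close> and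
  \<open>c\<^sub>a = a\<^sup>k\<^sup>-\<^sup>n c\<^sub>1\<close>. The eigenvalues determine \<open>n\<close>, hence two eigenforms with the same eigenvalues
  have proportional \<open>t\<close>-expansions. To pass from a neighbourhood of infinity to \<open>\<Omega>\<close>, one walks down
  the tree: on annuli a zero propagates by the logarithmic convexity of Gauss norms, at the vertices
  by their continuity.
\<close>

subsection \<open>Finite fields and ultrametric limits\<close>

text \<open>The type \<open>'c\<close> is only a field with a complete metric, and the locale
  provides roots only for polynomials with algebraic coefficients. Hence limit laws come from the
  strong triangle inequality, and \<open>'c\<close> itself has to be shown algebraically closed,
  since the identity theorem factors rational approximants into linear factors.
  \<open>goss_poly\<close> and \<open>t_expansion\<close> are definite descriptions, so existence
  and uniqueness come before any use; the Goss polynomials are built from the exponentials of the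
  finite lattices \<pi> A_{<d}, where power sums are a partial fraction identity. The sieve needs
  orders of functions such as \<phi>((z + \<beta>)/\<pp>), for which no t-series is at hand;
  estimates suffice, because |t(az)| = |t(z)|^(q^deg a) near infinity, so such substitutions change
  orders by a factor q^deg a only. In the descent, Gauss norms are compared on points y with |y| =
  \<open>im y\<close>: approximants have no poles there, and infinitely many residue classes leave
  room to avoid any finite set of zeros.\<close>

lemma finite_field_power_card [simp]: "(x :: 'q::{field,finite}) ^ CARD('q) = x"
proof (cases "x = 0")
  case False
  have "bij_betw (\<lambda>y. x * y) (UNIV - {0}) (UNIV - {0})"
    by (rule bij_betwI[where g = "\<lambda>y. y / x"]) (use False in auto)
  then have "(\<Prod>y\<in>UNIV - {0}. x * y) = (\<Prod>y\<in>UNIV - {0 :: 'q}. y)"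
    by (rule prod.reindex_bij_betw)
  then have "x ^ card (UNIV - {0 :: 'q}) = 1"
    by (simp add: prod.distrib)
  moreover have "CARD('q) = Suc (card (UNIV - {0 :: 'q}))"
    using card_Suc_Diff1[of "UNIV :: 'q set" 0] by simp
  ultimately show ?thesis by (simp only: power_Suc mult_1_right)
qed (simp add: card_gt_0_iff)

lemma card_field_ge_2: "CARD('q::{field,finite}) \<ge> 2"
  using card_mono[of "UNIV :: 'q set" "{0, 1}"] by simp

text \<open>An additive subgroup of maximal p-power order is everything: an element outside it would
  contribute p distinct cosets. This makes x -> x^q a power of the Frobenius, hence additive on
  \<open>'c\<close>.\<close>

lemma card_eq_CHAR_power:
  obtains k where "CARD('q::{field,finite}) = CHAR('q) ^ k"
proof -
  let ?p = "CHAR('q)"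
  have p: "prime ?p"
    by (simp add: finite_imp_CHAR_pos prime_CHAR_semidom)
  define S where "S = {H :: 'q set. 0 \<in> H \<and> (\<forall>x\<in>H. \<forall>y\<in>H. x + y \<in> H) \<and> (\<forall>x\<in>H. - x \<in> H) \<and> (\<exists>k. card H = ?p ^ k)}"
  have "{0} \<in> S" by (auto simp: S_def intro: exI[of _ 0])
  moreover have "finite S" by (rule finite_subset[of _ UNIV]) auto
  ultimately obtain H where H: "H \<in> S" and max: "\<And>H'. H' \<in> S \<Longrightarrow> card H' \<le> card H"
    using Max_in[of "card ` S"] Max_ge[of "card ` S"]
    by (metis (no_types, lifting) finite_imageI image_iff image_is_empty empty_iff imageI)
  obtain k where k: "card H = ?p ^ k" using H by (auto simp: S_def)
  have H0: "0 \<in> H" and Hadd: "\<And>x y. x \<in> H \<Longrightarrow> y \<in> H \<Longrightarrow> x + y \<in> H" and Hneg: "\<And>x. x \<in> H \<Longrightarrow> - x \<in> H"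
    using H by (auto simp: S_def)
  have Hmul: "of_nat i * x \<in> H" if "x \<in> H" for i x
    by (induction i) (auto simp: H0 distrib_right intro: Hadd that)
  have "H = UNIV"
  proof (rule ccontr)
    assume "H \<noteq> UNIV"
    then obtain x where x: "x \<notin> H" by auto
    define g where "g = (\<lambda>(h, i::nat). h + of_nat i * x)"
    have ne: "of_nat i * x \<notin> H" if i: "0 < i" "i < ?p" for i
    proof
      assume a: "of_nat i * x \<in> H"
      have "\<not> ?p dvd i" using i by (auto dest: dvd_imp_le)
      then have c: "(of_nat i :: 'q) \<noteq> 0" by (simp add: of_nat_eq_0_iff_char_dvd)
      \<comment> \<open>By x^q = x, the power i^(q - 2) inverts i in the field, and being a natural
        number it acts on \<open>H\<close> by repeated addition.\<close>
      define j where "j = i ^ (CARD('q) - 2)"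
      have "Suc (Suc (CARD('q) - 2)) = CARD('q)" using card_field_ge_2[where 'q='q] by simp
      then have "(of_nat i :: 'q) * (of_nat i * of_nat i ^ (CARD('q) - 2)) = of_nat i"
        by (metis finite_field_power_card power_Suc)
      then have "of_nat (j * i) = (1::'q)" using c by (simp add: j_def mult.commute)
      then have "x = of_nat j * (of_nat i * x)" by (simp flip: mult.assoc)
      then show False using Hmul[OF a, of j] x by metis
    qed
    have inj: "inj_on g (H \<times> {..<?p})"
    proof (rule inj_onI, clarsimp simp: g_def)
      have *: "i = j" if "h \<in> H" "h' \<in> H" "i \<le> j" "j < ?p" "h + of_nat i * x = h' + of_nat j * x" for h h' i j
      proof (rule ccontr)
        assume "i \<noteq> j"
        have "of_nat (j - i) * x = h + - h'" using that by (simp add: of_nat_diff algebra_simps)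
        moreover have "h + - h' \<in> H" using that Hadd Hneg by blast
        ultimately show False using ne[of "j - i"] that \<open>i \<noteq> j\<close> by (simp add: less_imp_diff_less)
      qed
      fix h i h' j assume a: "h \<in> H" "i < ?p" "h' \<in> H" "j < ?p" "h + of_nat i * x = h' + of_nat j * x"
      have "i = j" using *[of h h' i j] *[of h' h j i] a by (cases "i \<le> j") auto
      then show "h = h' \<and> i = j" using a by simp
    qed
    have fin: "finite H" by simp
    let ?H = "g ` (H \<times> {..<?p})"
    have card: "card ?H = ?p ^ Suc k"
      using inj by (simp add: card_image card_cartesian_product k)
    have mem: "h + of_nat i * x \<in> ?H" if "h \<in> H" for h i
    proof -
      have "of_nat i = (of_nat (i mod ?p) :: 'q)" proof -
        have "of_nat i = (of_nat (i div ?p * ?p + i mod ?p) :: 'q)" by simp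
        then show ?thesis by (simp only: of_nat_add of_nat_mult of_nat_CHAR mult_zero_right add_0_left)
      qed
      moreover have "i mod ?p < ?p" using p prime_gt_0_nat by simp
      ultimately show ?thesis using that by (force simp: g_def image_iff)
    qed
    have "?H \<in> S" unfolding S_def
    proof (intro CollectI conjI ballI)
      show "0 \<in> ?H" using mem[OF H0, of 0] by simp
      show "\<exists>k. card ?H = ?p ^ k" using card by blast
      fix a assume "a \<in> ?H"
      then obtain h i where a: "h \<in> H" "i < ?p" "a = h + of_nat i * x" by (auto simp: g_def)
      have "- (of_nat i :: 'q) = of_nat (?p - i)" using a by (simp add: of_nat_diff)
      then have "- a = - h + of_nat (?p - i) * x" using a by (simp add: algebra_simps)
      then show "- a \<in> ?H" using mem Hneg a by metis
      fix b assume "b \<in> ?H"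
      then obtain h' j where b: "h' \<in> H" "b = h' + of_nat j * x" by (auto simp: g_def)
      have "a + b = (h + h') + of_nat (i + j) * x" using a b by (simp add: algebra_simps)
      then show "a + b \<in> ?H" using mem Hadd a b by metis
    qed
    then have "?p ^ Suc k \<le> ?p ^ k" using max card k by metis
    then show False using prime_gt_1_nat[OF p] by (simp add: prime_gt_0_nat[OF p])
  qed
  then show ?thesis using k that by simp
qed

context C_infty
begin

lemma absv_0 [simp]: "absv (0::'c) = 0" and absv_eq_0_iff [simp]: "absv (x::'c) = 0 \<longleftrightarrow> x = 0"
  and absv_nonneg [simp]: "absv (x::'c) \<ge> 0" and absv_pos_iff [simp]: "absv (x::'c) > 0 \<longleftrightarrow> x \<noteq> 0"
  by (auto simp: absv_def)

lemma absv_1 [simp]: "absv (1::'c) = 1"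
  using absv_mult[of 1 1] by (metis absv_eq_0_iff mult_cancel_left1 mult_1_left zero_neq_one mult_cancel_right2)

lemma absv_minus_commute: "absv (x - y :: 'c) = absv (y - x)"
  by (metis dist_absv dist_commute)

lemma absv_uminus [simp]: "absv (- x :: 'c) = absv x"
  using absv_minus_commute[of 0 x] by simp

lemma absv_diff_le: "absv (x - y :: 'c) \<le> max (absv x) (absv y)"
  using absv_add[of x "- y"] by simp

lemma absv_add_eq: "absv y < absv x \<Longrightarrow> absv (x + y :: 'c) = absv x"
  using absv_add[of x y] absv_diff_le[of "x + y" y] by auto

lemma absv_add_eq': "absv x < absv y \<Longrightarrow> absv (x + y :: 'c) = absv y"
  using absv_add_eq[of x y] by (simp add: add.commute)

lemma absv_diff_eq: "absv y < absv x \<Longrightarrow> absv (x - y :: 'c) = absv x"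
  using absv_add_eq[of "- y" x] by simp

lemma absv_power: "absv (x ^ n :: 'c) = absv x ^ n"
  by (induction n) (auto simp: absv_mult)

lemma absv_inverse: "absv (inverse x :: 'c) = inverse (absv x)"
proof (cases "x = 0")
  case False
  then have "absv (inverse x) * absv x = 1" by (simp flip: absv_mult)
  then show ?thesis using False by (metis inverse_unique mult.commute)
qed simp

lemma absv_divide: "absv (x / y :: 'c) = absv x / absv y"
  by (simp add: divide_inverse absv_mult absv_inverse)

lemma absv_prod: "absv (\<Prod>i\<in>S. g i :: 'c) = (\<Prod>i\<in>S. absv (g i))"
  by (induction S rule: infinite_finite_induct) (auto simp: absv_mult)

lemma absv_sum_le: "0 \<le> B \<Longrightarrow> (\<And>i. i \<in> S \<Longrightarrow> absv (g i :: 'c) \<le> B) \<Longrightarrow> absv (\<Sum>i\<in>S. g i) \<le> B"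
proof (induction S rule: infinite_finite_induct)
  case (insert x F)
  then show ?case using absv_add[of "g x" "sum g F"] by (smt (verit) insertCI max_def sum.insert)
qed auto

lemma absv_powi: "absv (x powi n :: 'c) = absv x powi n"
  by (simp add: power_int_def absv_power absv_inverse)

section \<open>Limits with respect to the ultrametric absolute value\<close>

lemma tendsto_absv_iff: "(g \<longlongrightarrow> (l::'c)) F \<longleftrightarrow> (\<forall>\<epsilon>>0. \<forall>\<^sub>F x in F. absv (g x - l) < \<epsilon>)"
  by (simp add: tendsto_iff dist_absv)

lemma lim_cong_absv: "((\<lambda>x. absv (g x - l)) \<longlongrightarrow> 0) F \<longleftrightarrow> (g \<longlongrightarrow> (l::'c)) F"
  by (simp add: tendsto_absv_iff tendsto_iff)

lemma lim_add:
  assumes "(g \<longlongrightarrow> (l::'c)) F" "(h \<longlongrightarrow> m) F" shows "((\<lambda>x. g x + h x) \<longlongrightarrow> l + m) F"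
  unfolding tendsto_absv_iff
proof (intro allI impI)
  fix \<epsilon> :: real assume "\<epsilon> > 0"
  then have "\<forall>\<^sub>F x in F. absv (g x - l) < \<epsilon>" "\<forall>\<^sub>F x in F. absv (h x - m) < \<epsilon>"
    using assms by (auto simp: tendsto_absv_iff)
  then show "\<forall>\<^sub>F x in F. absv (g x + h x - (l + m)) < \<epsilon>"
  proof eventually_elim
    case (elim x)
    have e: "g x + h x - (l + m) = (g x - l) + (h x - m)" by simp
    show ?case unfolding e using elim absv_add[of "g x - l" "h x - m"] by linarith
  qed
qed

lemma lim_mult:
  assumes "(g \<longlongrightarrow> (l::'c)) F" "(h \<longlongrightarrow> m) F" shows "((\<lambda>x. g x * h x) \<longlongrightarrow> l * m) F"
  unfolding tendsto_absv_iff
proof (intro allI impI)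
  fix \<epsilon> :: real assume \<epsilon>: "\<epsilon> > 0"
  define B where "B = max 1 (max (absv l) (absv m))"
  have B: "B \<ge> 1" "absv l \<le> B" "absv m \<le> B" by (auto simp: B_def)
  have "min 1 (\<epsilon> / B) > 0" using \<epsilon> B by simp
  then have "\<forall>\<^sub>F x in F. absv (g x - l) < min 1 (\<epsilon> / B)" "\<forall>\<^sub>F x in F. absv (h x - m) < min 1 (\<epsilon> / B)"
    using assms unfolding tendsto_absv_iff by blast+
  then show "\<forall>\<^sub>F x in F. absv (g x * h x - l * m) < \<epsilon>"
  proof eventually_elim
    case (elim x)
    have e: "g x * h x - l * m = g x * (h x - m) + (g x - l) * m" by (simp add: algebra_simps)
    have "absv (g x) \<le> B" using absv_add[of "g x - l" l] elim B by auto
    then have "absv (g x * (h x - m)) \<le> B * absv (h x - m)"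
      by (simp add: absv_mult mult_right_mono)
    also have "\<dots> < \<epsilon>" using elim B by (simp add: field_simps)
    finally have 1: "absv (g x * (h x - m)) < \<epsilon>" .
    have "absv ((g x - l) * m) \<le> absv (g x - l) * B"
      using B by (simp add: absv_mult mult_left_mono)
    also have "\<dots> < \<epsilon>" using elim B by (simp add: field_simps)
    finally show ?case unfolding e using 1 absv_add[of "g x * (h x - m)" "(g x - l) * m"] by linarith
  qed
qed

lemma lim_cmult: "(g \<longlongrightarrow> (l::'c)) F \<Longrightarrow> ((\<lambda>x. c * g x) \<longlongrightarrow> c * l) F"
  by (intro lim_mult tendsto_const)

lemma lim_diff: "(g \<longlongrightarrow> (l::'c)) F \<Longrightarrow> (h \<longlongrightarrow> m) F \<Longrightarrow> ((\<lambda>x. g x - h x) \<longlongrightarrow> l - m) F"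
  using lim_add[of g l F "\<lambda>x. (-1) * h x" "(-1) * m"] lim_cmult[of h m F "-1"] by simp

lemma lim_power: "(g \<longlongrightarrow> (l::'c)) F \<Longrightarrow> ((\<lambda>x. g x ^ n) \<longlongrightarrow> l ^ n) F"
  by (induction n) (auto intro: lim_mult)

lemma lim_sum: "(\<And>i. i \<in> S \<Longrightarrow> (g i \<longlongrightarrow> (l i::'c)) F) \<Longrightarrow> ((\<lambda>x. \<Sum>i\<in>S. g i x) \<longlongrightarrow> (\<Sum>i\<in>S. l i)) F"
  by (induction S rule: infinite_finite_induct) (auto intro: lim_add)

lemma lim_poly: "(g \<longlongrightarrow> (l::'c)) F \<Longrightarrow> ((\<lambda>x. poly p (g x)) \<longlongrightarrow> poly p l) F"
  by (induction p) (auto intro!: lim_add lim_mult)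

lemma lim_absv:
  assumes "(g \<longlongrightarrow> (l::'c)) F" shows "((\<lambda>x. absv (g x)) \<longlongrightarrow> absv l) F"
  unfolding absv_def by (intro tendsto_dist assms tendsto_const)

text \<open>An ultrametric absolute value is locally constant away from 0: eventually g x differs
  from l by less than |l|.\<close>

lemma lim_eventually_absv_eq:
  assumes "(g \<longlongrightarrow> (l::'c)) F" "l \<noteq> 0" shows "\<forall>\<^sub>F x in F. absv (g x) = absv l"
proof -
  have "\<forall>\<^sub>F x in F. absv (g x - l) < absv l" using assms by (simp add: tendsto_absv_iff)
  then show ?thesis
    by eventually_elim (metis absv_add_eq diff_add_cancel add.commute)
qed

lemma lim_inverse:
  assumes "(g \<longlongrightarrow> (l::'c)) F" "l \<noteq> 0" shows "((\<lambda>x. inverse (g x)) \<longlongrightarrow> inverse l) F"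
  unfolding tendsto_absv_iff
proof (intro allI impI)
  fix \<epsilon> :: real assume "\<epsilon> > 0"
  then have "\<forall>\<^sub>F x in F. absv (g x - l) < \<epsilon> * absv l ^ 2"
    using assms by (simp add: tendsto_absv_iff)
  with lim_eventually_absv_eq[OF assms] show "\<forall>\<^sub>F x in F. absv (inverse (g x) - inverse l) < \<epsilon>"
  proof eventually_elim
    case (elim x)
    then have nz: "g x \<noteq> 0" using assms(2) by (metis absv_eq_0_iff)
    have "inverse (g x) - inverse l = (l - g x) / (g x * l)" using nz assms(2) by (simp add: field_simps)
    then have "absv (inverse (g x) - inverse l) = absv (g x - l) / absv l ^ 2"
      using elim by (simp add: absv_divide absv_mult absv_minus_commute[of l] power2_eq_square)
    then show ?case using elim assms(2) by (simp add: pos_divide_less_eq)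
  qed
qed

lemma lim_divide: "(g \<longlongrightarrow> (l::'c)) F \<Longrightarrow> (h \<longlongrightarrow> m) F \<Longrightarrow> m \<noteq> 0 \<Longrightarrow> ((\<lambda>x. g x / h x) \<longlongrightarrow> l / m) F"
  by (simp add: divide_inverse lim_mult lim_inverse)

text \<open>By the strong triangle inequality, small consecutive differences already make a Cauchy
  sequence.\<close>

lemma convergent_absvI:
  assumes "\<And>\<epsilon>. \<epsilon> > 0 \<Longrightarrow> \<exists>N. \<forall>n\<ge>N. absv (g (Suc n) - g n :: 'c) < \<epsilon>"
  shows "convergent g"
proof -
  have "Cauchy g"
  proof (rule metric_CauchyI)
    fix \<epsilon> :: real assume "\<epsilon> > 0"
    then obtain N where N: "\<forall>n\<ge>N. absv (g (Suc n) - g n :: 'c) < \<epsilon>" using assms by blast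
    have *: "absv (g n - g N) < \<epsilon>" if "n \<ge> N" for n using that
    proof (induction n rule: nat_induct_at_least)
      case (Suc n)
      then show ?case using N absv_add[of "g (Suc n) - g n" "g n - g N"] by auto
    qed (use \<open>\<epsilon> > 0\<close> in simp)
    show "\<exists>M. \<forall>m\<ge>M. \<forall>n\<ge>M. dist (g m) (g n) < \<epsilon>"
    proof (intro exI[of _ N] allI impI)
      fix m n assume "m \<ge> N" "n \<ge> N"
      then have "absv (g m - g N) < \<epsilon>" "absv (g n - g N) < \<epsilon>" using * by auto
      moreover have e: "g m - g n = (g m - g N) - (g n - g N)" by simp
      ultimately show "dist (g m) (g n) < \<epsilon>"
        unfolding dist_absv e using absv_diff_le[of "g m - g N" "g n - g N"] by linarith
    qed
  qed
  then show ?thesis by (simp add: Cauchy_convergent_iff)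
qed

lemma has_sum_absv_iff:
  "(g has_sum (s::'c)) S \<longleftrightarrow> (\<forall>\<epsilon>>0. \<exists>X. finite X \<and> X \<subseteq> S \<and> (\<forall>Y. finite Y \<and> X \<subseteq> Y \<and> Y \<subseteq> S \<longrightarrow> absv (sum g Y - s) < \<epsilon>))"
  by (simp add: has_sum_def tendsto_absv_iff eventually_finite_subsets_at_top)

lemma absv_le_lim:
  assumes "(g \<longlongrightarrow> (l::'c)) F" "F \<noteq> bot" "\<forall>\<^sub>F x in F. absv (g x) \<le> B" shows "absv l \<le> B"
  using tendsto_upperbound[OF lim_absv[OF assms(1)] assms(3,2)] .

end

subsection \<open>The ring of polynomials in the completed field\<close>

lemma power_int_strict_increasing_iff:
  "1 < (a::real) \<Longrightarrow> a powi m < a powi n \<longleftrightarrow> m < n"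
  using power_int_strict_increasing[of m n a] power_int_increasing[of n m a] by force

context C_infty
begin

abbreviation im :: "'c \<Rightarrow> real" where "im z \<equiv> infdist z (range \<iota>)"
abbreviation emb :: "'q poly \<Rightarrow> 'c" where "emb \<equiv> A_emb \<iota>"
abbreviation const_emb :: "'q \<Rightarrow> 'c" where "const_emb u \<equiv> \<iota> (fls_const u)"
abbreviation \<theta> :: 'c where "\<theta> \<equiv> \<iota> fls_X_inv"

lemma embed_0 [simp]: "\<iota> 0 = 0"
  using embed_add[of 0 0] by (metis add_0 add_cancel_left_left)

lemma embed_uminus: "\<iota> (- u) = - \<iota> u"
  using embed_add[of u "- u"] by (simp add: eq_neg_iff_add_eq_0 add.commute)

lemma embed_diff: "\<iota> (u - v) = \<iota> u - \<iota> v"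
  using embed_add[of u "- v"] by (simp add: embed_uminus)

lemma embed_power: "\<iota> (u ^ n) = \<iota> u ^ n"
  by (induction n) (auto simp: embed_one embed_mult)

lemma embed_eq_0_iff [simp]: "\<iota> u = 0 \<longleftrightarrow> u = 0"
  using embed_absv[of u] by (cases "u = 0") (auto simp: power_int_eq_0_iff)

lemma embed_eq_iff [simp]: "\<iota> u = \<iota> v \<longleftrightarrow> u = v"
  using embed_eq_0_iff[of "u - v"] by (simp add: embed_diff)

lemma embed_inverse: "\<iota> (inverse u) = inverse (\<iota> u)"
proof (cases "u = 0")
  case False
  then have "\<iota> u * \<iota> (inverse u) = 1" by (metis embed_mult embed_one right_inverse)
  then show ?thesis by (metis inverse_unique)
qed simp

lemma embed_divide: "\<iota> (u / v) = \<iota> u / \<iota> v"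
  by (metis divide_inverse embed_inverse embed_mult)

lemma embed_of_nat: "\<iota> (of_nat n) = of_nat n"
  by (induction n) (auto simp: embed_add embed_one)

lemma CHAR_C: "CHAR('c) = CHAR('q)"
proof (rule CHAR_eqI)
  have *: "of_nat n = (0::'c) \<longleftrightarrow> of_nat n = (0::'q)" for n
  proof -
    have "(of_nat n :: 'c) = \<iota> (fls_const (of_nat n))" by (simp flip: embed_of_nat add: fls_of_nat)
    then show ?thesis by simp
  qed
  show "of_nat (CHAR('q)) = (0::'c)" by (simp add: *)
  show "CHAR('q) dvd n" if "of_nat n = (0::'c)" for n
    using that by (simp add: * of_nat_eq_0_iff_char_dvd)
qed

lemma prime_CHAR_C: "prime (CHAR('c))"
  unfolding CHAR_C by (simp add: finite_imp_CHAR_pos prime_CHAR_semidom)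

lemma frobenius_power_add: "(x + y :: 'c) ^ (CARD('q) ^ n) = x ^ (CARD('q) ^ n) + y ^ (CARD('q) ^ n)"
proof -
  obtain k where "CARD('q) = CHAR('q) ^ k" using card_eq_CHAR_power[where 'q='q] .
  then have "CARD('q) ^ n = CHAR('c) ^ (k * n)" by (simp add: CHAR_C power_mult)
  then show ?thesis by (rule freshmans_dream'[OF prime_CHAR_C])
qed

lemma frobenius_add: "(x + y :: 'c) ^ CARD('q) = x ^ CARD('q) + y ^ CARD('q)"
  using frobenius_power_add[of x y 1] by simp

lemma frobenius_power_diff: "(x - y :: 'c) ^ (CARD('q) ^ n) = x ^ (CARD('q) ^ n) - y ^ (CARD('q) ^ n)"
  using frobenius_power_add[of "x - y" y n] by simp

lemma of_nat_card_eq_0 [simp]: "of_nat (CARD('q)) = (0::'c)"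
proof -
  obtain k where k: "CARD('q) = CHAR('q) ^ k" using card_eq_CHAR_power[where 'q='q] .
  then have "k \<noteq> 0" using card_field_ge_2[where 'q='q] by (intro notI) simp
  then show ?thesis unfolding of_nat_eq_0_iff_char_dvd CHAR_C k by simp
qed

lemma card_gt_1: "1 < real (CARD('q))"
  using card_field_ge_2[where 'q='q] by simp

lemma const_emb_power [simp]: "const_emb u ^ CARD('q) = const_emb u"
  by (simp flip: embed_power fls_const_power)

lemma absv_const_emb: "u \<noteq> 0 \<Longrightarrow> absv (const_emb u) = 1"
  by (simp add: embed_absv)

lemma absv_const_emb_le: "absv (const_emb u) \<le> 1"
  by (cases "u = 0") (auto simp: absv_const_emb)

lemma absv_\<theta>: "absv \<theta> = CARD('q)"
  by (subst embed_absv) auto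

lemma absv_\<theta>_power: "absv (\<theta> ^ n) = real (CARD('q)) ^ n"
  by (simp add: absv_power absv_\<theta>)

lemma emb_0 [simp]: "emb 0 = 0"
  by (simp add: A_emb_def)

lemma emb_pCons [simp]: "emb (pCons u a) = const_emb u + \<theta> * emb a"
  by (cases "a = 0"; cases "u = 0")
     (auto simp: A_emb_def embed_add embed_mult map_poly_pCons embed_one)

lemma emb_1 [simp]: "emb 1 = 1"
  by (simp add: one_pCons embed_one)

lemma emb_add: "emb (a + b) = emb a + emb b"
proof (induction a b rule: poly_induct2)
  case (pCons u a v b)
  then show ?case by (simp add: algebra_simps embed_add flip: fls_plus_const)
qed simp

lemma emb_smult: "emb (smult u a) = const_emb u * emb a"
  by (induction a) (auto simp: algebra_simps embed_mult simp flip: fls_const_mult_const)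

lemma emb_uminus: "emb (- a) = - emb a"
  using emb_add[of a "- a"] by (simp add: eq_neg_iff_add_eq_0 add.commute)

lemma emb_diff: "emb (a - b) = emb a - emb b"
  using emb_add[of a "- b"] by (simp add: emb_uminus)

lemma emb_mult: "emb (a * b) = emb a * emb b"
  by (induction a) (auto simp: emb_add emb_smult algebra_simps)

lemma emb_monom: "emb (monom u n) = const_emb u * \<theta> ^ n"
  by (induction n) (auto simp: monom_0 monom_Suc)

lemma absv_emb: "a \<noteq> 0 \<Longrightarrow> absv (emb a) = real (CARD('q)) ^ degree a"
proof (induction a)
  case (pCons u a)
  show ?case
  proof (cases "a = 0")
    case False
    have "absv (const_emb u) < absv (\<theta> * emb a)"
    proof -
      have "1 < real (CARD('q)) ^ Suc (degree a)" using card_gt_1 by (intro one_less_power) auto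
      then show ?thesis using absv_const_emb_le[of u] pCons False by (simp add: absv_mult absv_\<theta>)
    qed
    then show ?thesis using pCons False by (simp add: absv_add_eq' absv_mult absv_\<theta>)
  qed (use pCons in \<open>auto simp: absv_const_emb\<close>)
qed simp

lemma absv_emb_ge_1: "a \<noteq> 0 \<Longrightarrow> 1 \<le> absv (emb a)"
  using card_gt_1 by (simp add: absv_emb)

lemma emb_eq_0_iff [simp]: "emb a = 0 \<longleftrightarrow> a = 0"
  using absv_emb_ge_1[of a] by (cases "a = 0") auto

lemma emb_eq_iff [simp]: "emb a = emb b \<longleftrightarrow> a = b"
  using emb_eq_0_iff[of "a - b"] by (simp add: emb_diff)

lemma emb_in_range: "emb a \<in> range \<iota>"
  by (simp add: A_emb_def)

text \<open>The indeterminate is 1/T, so a small absolute value means a high subdegree; hence the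
  sign in front of n.\<close>

lemma absv_embed_less_iff: "absv (\<iota> u) < real (CARD('q)) powi n \<longleftrightarrow> (\<forall>k \<le> - n. fls_nth u k = 0)"
proof (cases "u = 0")
  case True
  then show ?thesis using card_gt_1 by (simp add: zero_less_power_int)
next
  case False
  have "absv (\<iota> u) < real (CARD('q)) powi n \<longleftrightarrow> - fls_subdegree u < n"
    using False card_gt_1 by (simp add: embed_absv power_int_strict_increasing_iff)
  also have "\<dots> \<longleftrightarrow> (\<forall>k \<le> - n. fls_nth u k = 0)"
  proof
    assume "\<forall>k \<le> - n. fls_nth u k = 0"
    then have "fls_subdegree u > - n" using False by (intro fls_subdegree_greaterI) auto
    then show "- fls_subdegree u < n" by simp
  qed auto
  finally show ?thesis .
qed

text \<open>The polynomial is the part in T of a Laurent series in 1/T; the induction removes its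
  top power of T, a multiple of \<open>fls_X_inv ^ n\<close>.\<close>

lemma approx_by_poly: "\<exists>a. absv (\<iota> u - emb a) < 1"
proof -
  have *: "\<exists>a. absv (\<iota> u - emb a) < 1" if "absv (\<iota> u) < real (CARD('q)) ^ n" for n u
    using that
  proof (induction n arbitrary: u)
    case 0
    then show ?case by (intro exI[of _ 0]) simp
  next
    case (Suc n)
    have u: "\<forall>k \<le> - int (Suc n). fls_nth u k = 0"
      using Suc.prems absv_embed_less_iff[of u "int (Suc n)"] by (simp only: power_int_of_nat)
    define c where "c = fls_nth u (- int n)"
    define u' where "u' = u - fls_const c * fls_X_inv ^ n"
    have "\<forall>k \<le> - int n. fls_nth u' k = 0"
    proof (intro allI impI)
      fix k assume k: "k \<le> - int n"
      show "fls_nth u' k = 0"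
        using u k by (cases "k = - int n") (auto simp: u'_def c_def)
    qed
    then have "absv (\<iota> u') < real (CARD('q)) ^ n"
      using absv_embed_less_iff[of u' "int n"] by simp
    then obtain a where "absv (\<iota> u' - emb a) < 1" using Suc.IH by blast
    moreover have "\<iota> u' - emb a = \<iota> u - emb (a + monom c n)"
      by (simp add: u'_def embed_diff embed_mult embed_power emb_add emb_monom)
    ultimately show ?case by metis
  qed
  obtain n where "absv (\<iota> u) < real (CARD('q)) ^ n"
    using card_gt_1 real_arch_pow by blast
  then show ?thesis by (rule *)
qed

section \<open>The distance from K_infty as imaginary part\<close>

lemma im_le: "im z \<le> absv (z - \<iota> u)"
  using infdist_le[of "\<iota> u" "range \<iota>" z] by (simp add: dist_absv)

lemma im_geI: "(\<And>u. r \<le> absv (z - \<iota> u)) \<Longrightarrow> r \<le> im z"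
  by (auto simp: infdist_def dist_absv intro!: cINF_greatest)

lemma im_lessD: "im z < r \<Longrightarrow> \<exists>u. absv (z - \<iota> u) < r"
  using im_geI[of r z] by (metis not_le)

lemma im_scale: assumes "w \<noteq> 0" shows "im (\<iota> w * z) = absv (\<iota> w) * im z"
proof -
  have *: "absv (\<iota> w) * im z \<le> im (\<iota> w * z)" if "w \<noteq> 0" for w z
  proof (rule im_geI)
    fix u
    have "\<iota> w * z - \<iota> u = \<iota> w * (z - \<iota> (u / w))"
      using that by (simp add: embed_divide field_simps)
    then show "absv (\<iota> w) * im z \<le> absv (\<iota> w * z - \<iota> u)"
      using im_le[of z "u / w"] by (simp add: absv_mult mult_left_mono)
  qed
  have "absv (\<iota> (inverse w)) * im (\<iota> w * z) \<le> im (\<iota> (inverse w) * (\<iota> w * z))"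
    using assms by (intro *) auto
  also have "\<iota> (inverse w) * (\<iota> w * z) = z"
    using assms by (simp add: embed_inverse)
  finally have "im (\<iota> w * z) \<le> absv (\<iota> w) * im z"
    using assms unfolding embed_inverse absv_inverse by (simp add: divide_simps mult.commute)
  then show ?thesis using *[of w z] assms by simp
qed

lemma im_add: "im (z + \<iota> v) = im z"
proof -
  have *: "im z \<le> im (z + \<iota> v)" for z v
  proof (rule im_geI)
    fix u
    show "im z \<le> absv (z + \<iota> v - \<iota> u)"
      using im_le[of z "u - v"] by (simp add: embed_diff algebra_simps)
  qed
  show ?thesis using *[of z v] *[of "z + \<iota> v" "- v"] by (simp add: embed_uminus)
qed

lemma im_emb_add: "im (z + emb a) = im z"
  unfolding A_emb_def by (rule im_add)

lemma im_emb_mult: "a \<noteq> 0 \<Longrightarrow> im (emb a * z) = absv (emb a) * im z"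
  using emb_eq_0_iff[of a] unfolding A_emb_def by (intro im_scale) (metis embed_0)

lemma im_emb_divide: "a \<noteq> 0 \<Longrightarrow> im (z / emb a) = im z / absv (emb a)"
  using im_emb_mult[of a "z / emb a"] absv_emb_ge_1[of a] by (auto simp: field_simps)

text \<open>The value group of K_infty is q^Z, so distinct absolute values differ at least by the
  factor q.\<close>

lemma absv_embed_discrete:
  assumes "absv (\<iota> u) < absv (\<iota> v)" shows "real (CARD('q)) * absv (\<iota> u) \<le> absv (\<iota> v)"
proof (cases "u = 0")
  case False
  then have "v \<noteq> 0" using assms absv_nonneg[of "\<iota> u"] by (intro notI) (simp del: absv_nonneg)
  have "- fls_subdegree u < - fls_subdegree v"
    using assms False \<open>v \<noteq> 0\<close> card_gt_1 by (simp add: embed_absv power_int_strict_increasing_iff)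
  then have "real (CARD('q)) powi (1 + - fls_subdegree u) \<le> real (CARD('q)) powi (- fls_subdegree v)"
    using card_gt_1 by (intro power_int_increasing) auto
  then show ?thesis using False \<open>v \<noteq> 0\<close> card_gt_1
    by (subst (asm) power_int_add) (auto simp: embed_absv)
qed simp

text \<open>Otherwise there are ever better approximations u, v, w, the first within q
  \<open>im z\<close>. The differences v - u and w - v then have distinct absolute values whose
  quotient is less than q, against the discreteness of the value group.\<close>

lemma im_attained: assumes "0 < im z" obtains u where "absv (z - \<iota> u) = im z"
proof -
  have "\<exists>u. absv (z - \<iota> u) = im z"
  proof (rule ccontr)
    assume "\<nexists>u. absv (z - \<iota> u) = im z"
    then have less: "im z < absv (z - \<iota> u)" for u
      using im_le[of z u] by (metis order_le_less)
    have "im z < real (CARD('q)) * im z" using assms card_gt_1 by simp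
    from im_lessD[OF this] obtain u where u: "absv (z - \<iota> u) < real (CARD('q)) * im z" ..
    from im_lessD[OF less[of u]] obtain v where v: "absv (z - \<iota> v) < absv (z - \<iota> u)" ..
    from im_lessD[OF less[of v]] obtain w where w: "absv (z - \<iota> w) < absv (z - \<iota> v)" ..
    have "absv (\<iota> (v - u)) = absv (z - \<iota> u)"
      using absv_diff_eq[OF v] by (simp add: embed_diff)
    moreover have "absv (\<iota> (w - v)) = absv (z - \<iota> v)"
      using absv_diff_eq[OF w] by (simp add: embed_diff)
    ultimately have "real (CARD('q)) * absv (z - \<iota> v) \<le> absv (z - \<iota> u)"
      using absv_embed_discrete[of "w - v" "v - u"] v by simp
    moreover have "real (CARD('q)) * im z < real (CARD('q)) * absv (z - \<iota> v)"
      using less[of v] by simp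
    ultimately show False using u by linarith
  qed
  then show ?thesis using that by blast
qed

text \<open>This is the closedness of K_infty. Laurent series u n within q^(-n) of z agree in all
  coefficients up to n, so they converge to a Laurent series that would be equal to z.\<close>

lemma im_pos:
  assumes "z \<notin> range \<iota>" shows "0 < im z"
proof (rule ccontr)
  assume "\<not> 0 < im z"
  then have im0: "im z = 0" using infdist_nonneg[of z "range \<iota>"] by linarith
  have "\<exists>u. absv (z - \<iota> u) < real (CARD('q)) powi (- int n)" for n
    using im0 card_gt_1 by (intro im_lessD) (simp add: zero_less_power_int)
  then obtain u where u: "\<And>n. absv (z - \<iota> (u n)) < real (CARD('q)) powi (- int n)" by metis
  have uu: "fls_nth (u n) k = fls_nth (u m) k" if "n \<le> m" "k \<le> int n" for n m k
  proof -
    have "real (CARD('q)) powi (- int m) \<le> real (CARD('q)) powi (- int n)"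
      using that card_gt_1 by (intro power_int_increasing) auto
    then have "absv (\<iota> (u n - u m)) < real (CARD('q)) powi (- int n)"
      using u[of n] u[of m] absv_diff_le[of "z - \<iota> (u m)" "z - \<iota> (u n)"] by (simp add: embed_diff)
    then show ?thesis using that by (simp add: absv_embed_less_iff)
  qed
  \<comment> \<open>The coefficient at k >= 0 is taken from \<open>u k\<close>, and the negative
    ones from \<open>u 0\<close>, which already has them right.\<close>
  define v where "v = u 0 + fps_to_fls (Abs_fps (\<lambda>k. fls_nth (u k - u 0) (int k)))"
  have v: "fls_nth v k = fls_nth (u n) k" if "k \<le> int n" for n k
  proof (cases "k < 0")
    case True
    then show ?thesis using uu[of 0 n k] by (simp add: v_def)
  next
    case False
    then show ?thesis using uu[of "nat k" n k] that by (simp add: v_def)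
  qed
  have "absv (z - \<iota> v) < real (CARD('q)) powi (- int n)" for n
  proof -
    have "absv (\<iota> (u n - v)) < real (CARD('q)) powi (- int n)"
      by (simp add: absv_embed_less_iff v)
    then show ?thesis using u[of n] absv_add[of "z - \<iota> (u n)" "\<iota> (u n - v)"]
      by (simp add: embed_diff)
  qed
  moreover have "absv (z - \<iota> v) > 0" using assms by auto
  then obtain n where "(1 / real (CARD('q))) ^ n < absv (z - \<iota> v)"
    using real_arch_pow_inv[of "absv (z - \<iota> v)" "1 / real (CARD('q))"] card_gt_1 by auto
  ultimately show False
    by (metis less_asym power_int_minus power_int_of_nat power_one_over inverse_eq_divide)
qed

lemma Omega_iff: "z \<in> Omega \<iota> \<longleftrightarrow> 0 < im z"
  using im_pos[of z] infdist_zero[of z "range \<iota>"] unfolding Omega_def by force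

text \<open>Replacing a nearest point of K_infty by its polynomial part costs less than 1, which the
  strong triangle inequality absorbs once \<open>im z\<close> is at least 1.\<close>

lemma near_poly:
  assumes "1 \<le> im z" obtains a where "absv (z - emb a) = im z"
proof -
  obtain u where u: "absv (z - \<iota> u) = im z" using assms im_attained[of z] by auto
  obtain a where a: "absv (\<iota> u - emb a) < 1" using approx_by_poly by blast
  have "absv (z - emb a) \<le> im z"
    using absv_add[of "z - \<iota> u" "\<iota> u - emb a"] u a assms by simp
  moreover have "im z \<le> absv (z - emb a)" unfolding A_emb_def by (rule im_le)
  ultimately show ?thesis using that by force
qed

end

subsection \<open>Exponentials of finite lattices\<close>

text \<open>Since \<open>degree 0 = 0\<close>, the condition on the degree alone would make
  \<open>polys_lt 0\<close> empty; with the zero polynomial added, this is the F_q-vector space of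
  dimension d for every d.\<close>

definition polys_lt :: "nat \<Rightarrow> 'q::zero poly set" where
  "polys_lt d = {a. a = 0 \<or> degree a < d}"

lemma polys_lt_0: "polys_lt 0 = {0}"
  by (auto simp: polys_lt_def)

lemma polys_lt_pos: "d > 0 \<Longrightarrow> polys_lt d = {a. degree a < d}"
  by (auto simp: polys_lt_def)

lemma zero_in_polys_lt [simp]: "0 \<in> polys_lt d"
  by (simp add: polys_lt_def)

lemma polys_lt_mono: "d \<le> e \<Longrightarrow> polys_lt d \<subseteq> polys_lt e"
  by (auto simp: polys_lt_def)

text \<open>Splitting off the coefficient of T^d exhibits q disjoint translates of the smaller
  space. Both the cardinality and the product formula for \<open>exp_poly\<close> go by induction
  along this decomposition.\<close>

lemma polys_lt_Suc_bij:
  "bij_betw (\<lambda>(b, u). b + monom u d) (polys_lt d \<times> UNIV) (polys_lt (Suc d) :: 'q::field poly set)"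
proof (rule bij_betwI[where g = "\<lambda>a. (a - monom (coeff a d) d, coeff a d)"])
  have *: "coeff b d = 0" if "b \<in> polys_lt d" for b :: "'q poly"
    using that by (auto simp: polys_lt_def coeff_eq_0)
  show "(\<lambda>(b, u). b + monom u d) \<in> polys_lt d \<times> UNIV \<rightarrow> (polys_lt (Suc d) :: 'q poly set)"
    by (auto simp: polys_lt_def less_Suc_eq_le intro!: degree_add_le degree_monom_le)
  show "(\<lambda>a. (a - monom (coeff a d) d, coeff a d)) \<in> polys_lt (Suc d) \<rightarrow> polys_lt d \<times> (UNIV :: 'q set)"
  proof (clarsimp simp: Pi_def)
    fix a :: "'q poly" assume "a \<in> polys_lt (Suc d)"
    then have "\<forall>i>d. coeff a i = 0" by (auto simp: polys_lt_def coeff_eq_0)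
    then have "\<forall>i\<ge>d. coeff (a - monom (coeff a d) d) i = 0"
      by (auto simp: coeff_monom le_less)
    then show "a - monom (coeff a d) d \<in> polys_lt d"
      unfolding polys_lt_def by (metis (mono_tags, lifting) leading_coeff_0_iff mem_Collect_eq not_le)
  qed
  show "(\<lambda>a. (a - monom (coeff a d) d, coeff a d)) ((\<lambda>(b, u). b + monom u d) x) = x"
    if "x \<in> polys_lt d \<times> (UNIV :: 'q set)" for x
    using that * by (auto simp: coeff_monom)
  show "(\<lambda>(b, u). b + monom u d) ((\<lambda>a. (a - monom (coeff a d) d, coeff a d)) a) = a" for a :: "'q poly"
    by simp
qed

lemma finite_polys_lt [simp]: "finite (polys_lt d :: 'q::{field,finite} poly set)"
proof (induction d)
  case (Suc d)
  then show ?case using bij_betw_finite[OF polys_lt_Suc_bij[of d, where 'q='q]] by simp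
qed (simp add: polys_lt_0)

lemma card_polys_lt: "card (polys_lt d :: 'q::{field,finite} poly set) = CARD('q) ^ d"
proof (induction d)
  case (Suc d)
  then show ?case using bij_betw_same_card[OF polys_lt_Suc_bij[of d, where 'q='q]] by (simp add: mult.commute)
qed (simp add: polys_lt_0)

locale carlitz_setting = C_infty \<iota> for \<iota> :: "'q::{field,finite} fls \<Rightarrow> 'c::{field,complete_space}" +
  fixes \<pi> :: 'c
  assumes period: "carlitz_period \<iota> \<pi>"
begin

lemma \<pi>_nonzero [simp]: "\<pi> \<noteq> 0"
  using period by (simp add: carlitz_period_def)

text \<open>
  Defined by recursion rather than by the product of lemma \<open>exp_poly_prod\<close>, so that
  additivity is inherited from the Frobenius.
\<close>

primrec exp_poly :: "nat \<Rightarrow> 'c poly" where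
  "exp_poly 0 = [:0, 1:]"
| "exp_poly (Suc d) = exp_poly d -
     smult (inverse (poly (exp_poly d) (\<pi> * \<theta> ^ d) ^ (CARD('q) - 1))) (exp_poly d ^ CARD('q))"

lemma poly_exp_poly_Suc:
  "poly (exp_poly (Suc d)) x = poly (exp_poly d) x *
     (1 - (poly (exp_poly d) x / poly (exp_poly d) (\<pi> * \<theta> ^ d)) ^ (CARD('q) - 1))"
proof -
  have "y ^ CARD('q) = y * y ^ (CARD('q) - 1)" for y :: 'c
    using power_Suc[of y "CARD('q) - 1"] by simp
  then show ?thesis by (simp add: right_diff_distrib power_divide field_simps)
qed

lemma exp_poly_add: "poly (exp_poly d) (x + y) = poly (exp_poly d) x + poly (exp_poly d) y"
  by (induction d) (auto simp: frobenius_add algebra_simps)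

lemma exp_poly_const_mult: "poly (exp_poly d) (const_emb u * x) = const_emb u * poly (exp_poly d) x"
  by (induction d) (auto simp: algebra_simps power_mult_distrib)

lemma exp_poly_0 [simp]: "poly (exp_poly d) 0 = 0"
  using exp_poly_add[of d 0 0] by (metis add_0 add_cancel_left_left)

lemma exp_poly_uminus: "poly (exp_poly d) (- x) = - poly (exp_poly d) x"
  using exp_poly_add[of d x "- x"] by (simp add: eq_neg_iff_add_eq_0 add.commute)

lemma exp_poly_diff: "poly (exp_poly d) (x - y) = poly (exp_poly d) x - poly (exp_poly d) y"
  using exp_poly_add[of d x "- y"] by (simp add: exp_poly_uminus)

lemma pderiv_exp_poly: "pderiv (exp_poly d) = 1"
proof (induction d)
  case (Suc d)
  have "pderiv (exp_poly d ^ Suc (CARD('q) - 1)) = 0"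
    unfolding pderiv_power_Suc by (simp del: of_nat_Suc)
  then show ?case using Suc by (simp add: pderiv_diff pderiv_smult)
qed (simp add: pderiv_pCons)

text \<open>Both sides are polynomials in y of degree at most q - 1 that agree at the q constants
  from the finite field.\<close>

lemma prod_const_emb: "(\<Prod>u\<in>UNIV - {0}. 1 - y / const_emb u) = 1 - y ^ (CARD('q) - 1)"
proof -
  define p where "p = (\<Prod>u\<in>UNIV - {0::'q}. [:1, - inverse (const_emb u):]) - (1 - monom 1 (CARD('q) - 1))"
  have pp: "poly p x = (\<Prod>u\<in>UNIV - {0}. 1 - x / const_emb u) - (1 - x ^ (CARD('q) - 1))" for x
    by (simp add: p_def poly_prod poly_monom divide_inverse)
  have "p = 0"
  proof (rule ccontr)
    assume "p \<noteq> 0"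
    have "degree (\<Prod>u\<in>UNIV - {0::'q}. [:1, - inverse (const_emb u):]) \<le> (\<Sum>u\<in>UNIV - {0::'q}. 1)"
      by (intro order.trans[OF degree_prod_sum_le] sum_mono) (auto simp: o_def)
    then have "degree p \<le> CARD('q) - 1"
      unfolding p_def by (intro degree_diff_le) (auto simp: degree_monom_le)
    moreover have "poly p (const_emb u) = 0" for u
    proof (cases "u = 0")
      case True
      then show ?thesis using card_field_ge_2[where 'q='q] by (simp add: pp power_0_left)
    next
      case False
      then have "const_emb u \<noteq> 0" by simp
      moreover have "const_emb u * const_emb u ^ (CARD('q) - 1) = const_emb u"
        using power_Suc[of "const_emb u" "CARD('q) - 1"] by simp
      ultimately have "const_emb u ^ (CARD('q) - 1) = 1" by simp
      moreover have "(\<Prod>v\<in>UNIV - {0}. 1 - const_emb u / const_emb v) = 0"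
        using False by (intro prod_zero) (auto intro!: bexI[of _ u])
      ultimately show ?thesis by (simp add: pp)
    qed
    then have "range const_emb \<subseteq> {x. poly p x = 0}" by auto
    then have "card (range const_emb) \<le> card {x. poly p x = 0}"
      using \<open>p \<noteq> 0\<close> by (intro card_mono poly_roots_finite) auto
    moreover have "card (range const_emb) = CARD('q)"
      by (intro card_image) (auto simp: inj_on_def fls_eq_iff)
    ultimately have "CARD('q) \<le> degree p"
      using card_poly_roots_bound[OF \<open>p \<noteq> 0\<close>] by linarith
    then show False using \<open>degree p \<le> CARD('q) - 1\<close> card_gt_1 by simp
  qed
  then show ?thesis using pp[of y] by simp
qed

lemma polys_lt_uminus: "uminus ` (polys_lt d - {0}) = (polys_lt d - {0} :: 'q poly set)"
proof -
  have "- a \<in> polys_lt d - {0}" if "a \<in> polys_lt d - {0}" for a :: "'q poly"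
    using that by (auto simp: polys_lt_def)
  then show ?thesis by (force intro: image_eqI[where x = "- _"])
qed

text \<open>Up to a constant, the lattice product is the product over the coset y + \<pi> A_{<d};
  the sign is absorbed by the symmetry b -> -b of the lattice.\<close>

lemma prod_shift_lattice_aux:
  "(\<Prod>b\<in>polys_lt d. y + \<pi> * emb b) =
   (\<Prod>b\<in>polys_lt d - {0}. \<pi> * emb b) * (y * (\<Prod>b\<in>polys_lt d - {0}. 1 - y / (\<pi> * emb b)))"
proof -
  have "(\<Prod>b\<in>polys_lt d - {0}. 1 - y / (\<pi> * emb b)) = (\<Prod>b\<in>uminus ` (polys_lt d - {0}). 1 - y / (\<pi> * emb b))"
    by (simp add: polys_lt_uminus)
  also have "\<dots> = (\<Prod>b\<in>polys_lt d - {0}. 1 + y / (\<pi> * emb b))"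
    by (subst prod.reindex) (auto simp: emb_uminus)
  finally have "(\<Prod>b\<in>polys_lt d - {0}. \<pi> * emb b) * (y * (\<Prod>b\<in>polys_lt d - {0}. 1 - y / (\<pi> * emb b))) =
      y * (\<Prod>b\<in>polys_lt d - {0}. (\<pi> * emb b) * (1 + y / (\<pi> * emb b)))"
    unfolding prod.distrib by simp
  also have "\<dots> = y * (\<Prod>b\<in>polys_lt d - {0}. y + \<pi> * emb b)"
    by (intro arg_cong2[where f = "(*)"] prod.cong) (auto simp: field_simps)
  also have "\<dots> = (\<Prod>b\<in>polys_lt d. y + \<pi> * emb b)"
    by (subst (2) prod.remove[of _ 0]) auto
  finally show ?thesis by simp
qed

text \<open>The new lattice points form cosets w + \<pi> b with w = u \<pi> \<theta>^d and u a
  nonzero constant. By additivity each coset contributes e_d(w - x) / e_d(w) = 1 - e_d(x) / (u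
  \<epsilon>), and \<open>prod_const_emb\<close> multiplies these over u to the factor of the
  recursion.\<close>

lemma exp_poly_prod:
  "poly (exp_poly d) x = x * (\<Prod>b\<in>polys_lt d - {0}. 1 - x / (\<pi> * emb b))"
proof (induction d arbitrary: x)
  case (Suc d)
  define K where "K = (\<Prod>b\<in>polys_lt d - {0}. \<pi> * emb b)"
  have K: "K \<noteq> 0" by (simp add: K_def)
  have P: "(\<Prod>b\<in>polys_lt d. y + \<pi> * emb b) = K * poly (exp_poly d) y" for y
    unfolding K_def Suc.IH by (rule prod_shift_lattice_aux)
  define \<epsilon> where "\<epsilon> = poly (exp_poly d) (\<pi> * \<theta> ^ d)"
  have nz: "b + monom u d \<noteq> 0" if "b \<in> polys_lt d" "u \<noteq> 0" for b :: "'q poly" and u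
  proof
    assume "b + monom u d = 0"
    then have "coeff b d + u = 0" by (metis coeff_0 coeff_add coeff_monom)
    then show False using that by (auto simp: polys_lt_def coeff_eq_0)
  qed
  \<comment> \<open>A vanishing product would put \<pi> \<theta>^d into the lattice of lower degree;
    so the recursion never divides by 0.\<close>
  have \<epsilon>: "\<epsilon> \<noteq> 0"
  proof
    assume "\<epsilon> = 0"
    then obtain b where "b \<in> polys_lt d" "\<pi> * \<theta> ^ d + \<pi> * emb b = 0"
      using P[of "\<pi> * \<theta> ^ d"] by (auto simp: \<epsilon>_def prod_zero_iff)
    then have "emb (b + monom 1 d) = 0"
      by (metis add.commute distrib_left embed_one emb_add emb_monom fls_const_1 mult_1 mult_eq_0_iff \<pi>_nonzero)
    then show False using nz[of b 1] \<open>b \<in> polys_lt d\<close> by simp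
  qed
  have step: "(\<Prod>b\<in>polys_lt d. 1 - x / (\<pi> * emb (b + monom u d))) = 1 - poly (exp_poly d) x / \<epsilon> / const_emb u"
    if u: "u \<noteq> 0" for u
  proof -
    define w where "w = const_emb u * (\<pi> * \<theta> ^ d)"
    have w: "poly (exp_poly d) w = const_emb u * \<epsilon>"
      by (simp add: w_def exp_poly_const_mult \<epsilon>_def)
    have "(\<Prod>b\<in>polys_lt d. 1 - x / (\<pi> * emb (b + monom u d))) = (\<Prod>b\<in>polys_lt d. (w - x + \<pi> * emb b) / (w + \<pi> * emb b))"
    proof (rule prod.cong)
      fix b :: "'q poly" assume b: "b \<in> polys_lt d"
      have e: "\<pi> * emb (b + monom u d) = w + \<pi> * emb b" by (simp add: emb_add emb_monom w_def algebra_simps)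
      have "\<pi> * emb (b + monom u d) \<noteq> 0" using nz[OF b u] by simp
      then show "1 - x / (\<pi> * emb (b + monom u d)) = (w - x + \<pi> * emb b) / (w + \<pi> * emb b)"
        unfolding e by (simp add: field_simps)
    qed simp
    also have "\<dots> = (K * poly (exp_poly d) (w - x)) / (K * poly (exp_poly d) w)"
      by (simp add: prod_dividef P)
    also have "\<dots> = 1 - poly (exp_poly d) x / \<epsilon> / const_emb u"
      using K \<epsilon> u by (simp add: exp_poly_diff w field_simps)
    finally show ?thesis .
  qed
  have split: "bij_betw (\<lambda>(u, b). b + monom u d) ((UNIV - {0}) \<times> polys_lt d) (polys_lt (Suc d) - polys_lt d :: 'q poly set)"
  proof -
    have sw: "bij_betw prod.swap (UNIV \<times> polys_lt d) (polys_lt d \<times> UNIV :: ('q poly \<times> 'q) set)"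
      by (rule bij_betwI[where g = prod.swap]) auto
    have "(\<lambda>(b, u). b + monom u d) \<circ> prod.swap = (\<lambda>(u, b). b + monom (u :: 'q) d)"
      by (auto simp: fun_eq_iff)
    then have a: "bij_betw (\<lambda>(u, b). b + monom u d) (UNIV \<times> polys_lt d) (polys_lt (Suc d) :: 'q poly set)"
      using bij_betw_trans[OF sw polys_lt_Suc_bij[of d, where 'q='q]] by simp
    have b: "bij_betw (\<lambda>(u, b). b + monom u d) ({0} \<times> polys_lt d) (polys_lt d :: 'q poly set)"
      by (rule bij_betwI[where g = "\<lambda>b. (0, b)"]) auto
    have "bij_betw (\<lambda>(u, b). b + monom u d) (UNIV \<times> polys_lt d - {0} \<times> polys_lt d) (polys_lt (Suc d) - polys_lt d :: 'q poly set)"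
      by (rule bij_betw_DiffI[OF a b]) (use polys_lt_mono[of d "Suc d", where 'a='q] in auto)
    then show ?thesis by (simp add: Sigma_Diff_distrib1)
  qed
  have "(\<Prod>b\<in>polys_lt (Suc d) - {0}. 1 - x / (\<pi> * emb b)) =
    (\<Prod>b\<in>polys_lt d - {0}. 1 - x / (\<pi> * emb b)) * (\<Prod>b\<in>polys_lt (Suc d) - polys_lt d. 1 - x / (\<pi> * emb b))"
  proof -
    have "polys_lt (Suc d) - {0} = (polys_lt d - {0}) \<union> (polys_lt (Suc d) - polys_lt d :: 'q poly set)"
      using polys_lt_mono[of d "Suc d", where 'a='q] by auto
    then show ?thesis by (simp only:) (rule prod.union_disjoint; auto)
  qed
  also have "(\<Prod>b\<in>polys_lt (Suc d) - polys_lt d. 1 - x / (\<pi> * emb b)) =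
      (\<Prod>(u, b)\<in>(UNIV - {0}) \<times> polys_lt d. 1 - x / (\<pi> * emb (b + monom u d)))"
    by (subst prod.reindex_bij_betw[OF split, symmetric]) (simp add: case_prod_beta)
  also have "\<dots> = (\<Prod>u\<in>UNIV - {0}. 1 - poly (exp_poly d) x / \<epsilon> / const_emb u)"
    by (subst prod.cartesian_product[symmetric]) (intro prod.cong refl step, simp)
  also have "\<dots> = 1 - (poly (exp_poly d) x / \<epsilon>) ^ (CARD('q) - 1)"
    by (rule prod_const_emb)
  finally show ?case using Suc.IH[of x] unfolding poly_exp_poly_Suc \<epsilon>_def by (simp only: mult.assoc)
qed (simp add: polys_lt_0)

lemma prod_shift_lattice:
  "(\<Prod>b\<in>polys_lt d. y + \<pi> * emb b) = (\<Prod>b\<in>polys_lt d - {0}. \<pi> * emb b) * poly (exp_poly d) y"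
  unfolding exp_poly_prod by (rule prod_shift_lattice_aux)

end

subsection \<open>The Carlitz exponential\<close>

context C_infty
begin

text \<open>The bound does not grow with the number of factors, since products of numbers within
  \<delta> of 1 stay within \<delta> of 1.\<close>

lemma absv_prod_minus_1_le:
  assumes "0 \<le> \<delta>" "\<delta> < 1" "\<And>i. i \<in> S \<Longrightarrow> absv (y i :: 'c) \<le> \<delta>"
  shows "absv ((\<Prod>i\<in>S. 1 - y i) - 1) \<le> \<delta>"
  using assms(3)
proof (induction S rule: infinite_finite_induct)
  case (insert i S)
  have e: "(\<Prod>i\<in>insert i S. 1 - y i) - 1 = (1 - y i) * ((\<Prod>i\<in>S. 1 - y i) - 1) - y i"
    using insert.hyps by (simp add: algebra_simps)
  have "absv (1 - y i) = 1"
    using absv_diff_eq[of "y i" 1] insert.prems[of i] assms by simp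
  then have "absv ((1 - y i) * ((\<Prod>i\<in>S. 1 - y i) - 1)) \<le> \<delta>"
    using insert by (simp add: absv_mult)
  then show ?case unfolding e
    using absv_diff_le[of "(1 - y i) * ((\<Prod>i\<in>S. 1 - y i) - 1)" "y i"] insert.prems[of i] by auto
qed (use assms in auto)

lemma absv_prod_eq_1:
  assumes "\<And>i. i \<in> S \<Longrightarrow> absv (y i :: 'c) < 1"
  shows "absv (\<Prod>i\<in>S. 1 - y i) = 1"
  using assms by (auto simp: absv_prod absv_diff_eq intro!: prod.neutral)

end

context carlitz_setting
begin

abbreviation cexp :: "'c \<Rightarrow> 'c" where "cexp \<equiv> carlitz_exp \<iota> \<pi>"
abbreviation tp :: "'c \<Rightarrow> 'c" where "tp \<equiv> t_param \<iota> \<pi>"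

lemma absv_lattice_ge: "b \<notin> polys_lt d \<Longrightarrow> absv \<pi> * real (CARD('q)) ^ d \<le> absv (\<pi> * emb b)"
  using card_gt_1 by (auto simp: polys_lt_def absv_mult absv_emb intro!: mult_left_mono power_increasing)

lemma absv_div_lattice_le:
  assumes "b \<notin> polys_lt d"
  shows "absv (x / (\<pi> * emb b)) \<le> absv x / (absv \<pi> * real (CARD('q)) ^ d)"
proof -
  have "0 < absv \<pi> * real (CARD('q)) ^ d" using card_gt_1 by simp
  then show ?thesis unfolding absv_divide
    using absv_lattice_ge[OF assms] by (intro frac_le) auto
qed

lemma radius_exists: "0 < \<epsilon> \<Longrightarrow> \<exists>d. \<forall>d'\<ge>d. absv (x::'c) / (absv \<pi> * real (CARD('q)) ^ d') < \<epsilon>"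
proof -
  assume \<epsilon>: "0 < \<epsilon>"
  obtain d where d: "absv x / (absv \<pi> * \<epsilon>) < real (CARD('q)) ^ d"
    using card_gt_1 real_arch_pow by blast
  have "absv x / (absv \<pi> * real (CARD('q)) ^ d') < \<epsilon>" if "d' \<ge> d" for d'
  proof -
    have "real (CARD('q)) ^ d \<le> real (CARD('q)) ^ d'" using that card_gt_1 by (intro power_increasing) auto
    then have "absv x / (absv \<pi> * \<epsilon>) < real (CARD('q)) ^ d'" using d by linarith
    then show ?thesis using \<epsilon> card_gt_1 by (simp add: field_simps)
  qed
  then show ?thesis by blast
qed

lemma exp_poly_prod_split:
  assumes "d \<le> d'"
  shows "poly (exp_poly d') x = poly (exp_poly d) x * (\<Prod>b\<in>polys_lt d' - polys_lt d. 1 - x / (\<pi> * emb b))"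
proof -
  have e: "polys_lt d' - {0} = (polys_lt d - {0}) \<union> (polys_lt d' - polys_lt d :: 'q poly set)"
    using polys_lt_mono[OF assms, where 'a='q] by auto
  have "(\<Prod>b\<in>polys_lt d' - {0}. 1 - x / (\<pi> * emb b)) = (\<Prod>b\<in>polys_lt d - {0}. 1 - x / (\<pi> * emb b)) *
      (\<Prod>b\<in>polys_lt d' - polys_lt d. 1 - x / (\<pi> * emb b))"
    unfolding e by (rule prod.union_disjoint; auto)
  then show ?thesis by (simp add: exp_poly_prod mult.assoc)
qed

text \<open>Once all lattice points outside \<open>polys_lt d\<close> exceed x in absolute value,
  every further factor has absolute value 1.\<close>

lemma absv_exp_poly_eq:
  assumes "d \<le> d'" "absv x / (absv \<pi> * real (CARD('q)) ^ d) < 1"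
  shows "absv (poly (exp_poly d') x) = absv (poly (exp_poly d) x)"
proof -
  have "absv (\<Prod>b\<in>polys_lt d' - polys_lt d. 1 - x / (\<pi> * emb b)) = 1"
    using absv_div_lattice_le[of _ d x] assms(2) by (intro absv_prod_eq_1) (meson DiffE order_le_less_trans)
  then show ?thesis using exp_poly_prod_split[OF assms(1), of x] by (simp add: absv_mult)
qed

lemma exp_poly_convergent: "convergent (\<lambda>d. poly (exp_poly d) x)"
proof (rule convergent_absvI)
  fix \<epsilon> :: real assume \<epsilon>: "\<epsilon> > 0"
  obtain d0 where d0: "\<forall>d\<ge>d0. absv x / (absv \<pi> * real (CARD('q)) ^ d) < 1"
    using radius_exists[of 1 x] by auto
  define B where "B = absv (poly (exp_poly d0) x) + 1"
  have B: "B > 0" by (simp add: B_def add_nonneg_pos)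
  obtain d1 where d1: "\<forall>d\<ge>d1. absv x / (absv \<pi> * real (CARD('q)) ^ d) < \<epsilon> / B"
    using radius_exists[of "\<epsilon> / B" x] \<epsilon> B by auto
  have "absv (poly (exp_poly (Suc d)) x - poly (exp_poly d) x) < \<epsilon>" if "d \<ge> max d0 d1" for d
  proof -
    define P where "P = (\<Prod>b\<in>polys_lt (Suc d) - polys_lt d. 1 - x / (\<pi> * emb b))"
    have "absv (P - 1) \<le> absv x / (absv \<pi> * real (CARD('q)) ^ d)"
      unfolding P_def using that d0 absv_div_lattice_le[of _ d x] card_gt_1
      by (intro absv_prod_minus_1_le) auto
    also have "\<dots> < \<epsilon> / B" using that d1 by simp
    finally have "absv (P - 1) < \<epsilon> / B" .
    moreover have "absv (poly (exp_poly d) x) < B"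
      using absv_exp_poly_eq[of d0 d x] d0 that by (simp add: B_def)
    ultimately have "absv (poly (exp_poly d) x) * absv (P - 1) < B * (\<epsilon> / B)"
      by (intro mult_strict_mono) (use B in auto)
    moreover have "poly (exp_poly (Suc d)) x - poly (exp_poly d) x = poly (exp_poly d) x * (P - 1)"
      using exp_poly_prod_split[of d "Suc d" x] by (simp add: P_def algebra_simps)
    ultimately show ?thesis using B by (simp add: absv_mult)
  qed
  then show "\<exists>N. \<forall>n\<ge>N. absv (poly (exp_poly (Suc n)) x - poly (exp_poly n) x) < \<epsilon>" by blast
qed

text \<open>\<open>lattice_exp\<close> is a limit over all finite subsets, not along degrees. A
  finite set containing the points of degree below d adds only factors whose product is close to 1,
  so both limits agree.\<close>

lemma exp_poly_tendsto: "(\<lambda>d. poly (exp_poly d) x) \<longlonglongrightarrow> cexp x"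
proof (cases "x = 0")
  case True
  then show ?thesis by (simp add: carlitz_exp_def lattice_exp_def)
next
  case x: False
  define \<Lambda> where "\<Lambda> = range (\<lambda>a. \<pi> * emb a) - {0}"
  obtain l where l: "(\<lambda>d. poly (exp_poly d) x) \<longlonglongrightarrow> l"
    using exp_poly_convergent convergent_def by blast
  obtain d0 where d0: "\<forall>d\<ge>d0. absv x / (absv \<pi> * real (CARD('q)) ^ d) < 1"
    using radius_exists[of 1 x] by auto
  \<comment> \<open>A bound for all later partial products, whose absolute values are constant from
    \<open>d0\<close> on; the added 1 makes it positive and the bound strict.\<close>
  define B where "B = absv (poly (exp_poly d0) x / x) + 1"
  have B: "B > 0" by (simp add: B_def add_nonneg_pos)
  have "((\<lambda>F. \<Prod>y\<in>F. 1 - x / y) \<longlongrightarrow> l / x) (finite_subsets_at_top \<Lambda>)"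
    unfolding tendsto_absv_iff
  proof (intro allI impI)
    fix \<epsilon> :: real assume \<epsilon>: "\<epsilon> > 0"
    obtain d1 where d1: "\<forall>d\<ge>d1. absv x / (absv \<pi> * real (CARD('q)) ^ d) < \<epsilon> / B"
      using radius_exists[of "\<epsilon> / B" x] \<epsilon> B by auto
    have "\<forall>\<^sub>F d in sequentially. absv (poly (exp_poly d) x / x - l / x) < \<epsilon>"
      using lim_divide[OF l tendsto_const x] \<epsilon> unfolding tendsto_absv_iff by blast
    then obtain d2 where d2: "\<forall>d\<ge>d2. absv (poly (exp_poly d) x / x - l / x) < \<epsilon>"
      by (auto simp: eventually_sequentially)
    define d where "d = max d0 (max d1 d2)"
    define X where "X = (\<lambda>a. \<pi> * emb a) ` (polys_lt d - {0})"
    have inj: "inj (\<lambda>a. \<pi> * emb a)" by (auto simp: inj_on_def)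
    have X: "finite X" "X \<subseteq> \<Lambda>" by (auto simp: X_def \<Lambda>_def)
    have PX: "(\<Prod>y\<in>X. 1 - x / y) = poly (exp_poly d) x / x"
      unfolding X_def using inj x by (subst prod.reindex) (auto simp: exp_poly_prod inj_on_def)
    have "absv ((\<Prod>y\<in>Y. 1 - x / y) - l / x) < \<epsilon>" if Y: "finite Y" "X \<subseteq> Y" "Y \<subseteq> \<Lambda>" for Y
    proof -
      define R where "R = (\<Prod>y\<in>Y - X. 1 - x / y)"
      have "absv (x / y) \<le> absv x / (absv \<pi> * real (CARD('q)) ^ d)" if "y \<in> Y - X" for y
      proof -
        have "y \<in> \<Lambda>" "y \<notin> X" using that Y by auto
        then obtain b where b: "y = \<pi> * emb b" "y \<noteq> 0" unfolding \<Lambda>_def by blast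
        then have "b \<notin> polys_lt d" using \<open>y \<notin> X\<close> unfolding X_def by auto
        then show ?thesis using b absv_div_lattice_le[of b d x] by simp
      qed
      then have "absv (R - 1) \<le> absv x / (absv \<pi> * real (CARD('q)) ^ d)"
        unfolding R_def using d0 card_gt_1 by (intro absv_prod_minus_1_le) (auto simp: d_def)
      also have "\<dots> < \<epsilon> / B" using d1 by (simp add: d_def)
      finally have "absv (R - 1) < \<epsilon> / B" .
      moreover have "absv (poly (exp_poly d) x / x) < B"
        using absv_exp_poly_eq[of d0 d x] d0 by (simp add: B_def d_def absv_divide)
      ultimately have "absv (poly (exp_poly d) x / x) * absv (R - 1) < B * (\<epsilon> / B)"
        by (intro mult_strict_mono) (use B in auto)
      then have 1: "absv (poly (exp_poly d) x / x * (R - 1)) < \<epsilon>"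
        unfolding absv_mult using B by simp
      have "(\<Prod>y\<in>Y. 1 - x / y) = (\<Prod>y\<in>X. 1 - x / y) * R"
        unfolding R_def using prod.subset_diff[OF Y(2,1)] by (simp add: mult.commute)
      then have e: "(\<Prod>y\<in>Y. 1 - x / y) - l / x = poly (exp_poly d) x / x * (R - 1) + (poly (exp_poly d) x / x - l / x)"
        unfolding PX by (simp only: right_diff_distrib mult_1_right) simp
      have 2: "absv (poly (exp_poly d) x / x - l / x) < \<epsilon>" using d2 by (simp add: d_def)
      show ?thesis unfolding e using 1 2
          absv_add[of "poly (exp_poly d) x / x * (R - 1)" "poly (exp_poly d) x / x - l / x"] by linarith
    qed
    then show "\<forall>\<^sub>F F in finite_subsets_at_top \<Lambda>. absv ((\<Prod>y\<in>F. 1 - x / y) - l / x) < \<epsilon>"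
      unfolding eventually_finite_subsets_at_top using X by blast
  qed
  then have "Lim (finite_subsets_at_top \<Lambda>) (\<lambda>F. \<Prod>y\<in>F. 1 - x / y) = l / x"
    by (rule tendsto_Lim[rotated]) simp
  then have "cexp x = l"
    using x by (simp add: carlitz_exp_def lattice_exp_def \<Lambda>_def)
  then show ?thesis using l by simp
qed

lemma cexp_add: "cexp (x + y) = cexp x + cexp y"
  using LIMSEQ_unique[OF exp_poly_tendsto[of "x + y"] lim_add[OF exp_poly_tendsto[of x] exp_poly_tendsto[of y], folded exp_poly_add]] .

lemma cexp_const_mult: "cexp (const_emb u * x) = const_emb u * cexp x"
  using LIMSEQ_unique[OF exp_poly_tendsto[of "const_emb u * x"] lim_cmult[OF exp_poly_tendsto[of x], of "const_emb u", folded exp_poly_const_mult]] .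

lemma cexp_lattice: "cexp (\<pi> * emb a) = 0"
proof -
  have "poly (exp_poly d) (\<pi> * emb a) = 0" if "d \<ge> Suc (degree a)" for d
  proof (cases "a = 0")
    case False
    then have "a \<in> polys_lt d - {0}" using that by (auto simp: polys_lt_def)
    moreover have "1 - \<pi> * emb a / (\<pi> * emb a) = 0" using False by simp
    ultimately have "(\<Prod>b\<in>polys_lt d - {0}. 1 - \<pi> * emb a / (\<pi> * emb b)) = 0"
      by (intro prod_zero) (auto intro!: bexI[of _ a])
    then show ?thesis by (simp add: exp_poly_prod del: mult_divide_mult_cancel_left)
  qed simp
  then have "(\<lambda>d. poly (exp_poly d) (\<pi> * emb a)) \<longlonglongrightarrow> 0"
    by (intro tendsto_eventually) (auto simp: eventually_sequentially)
  then show ?thesis using LIMSEQ_unique[OF exp_poly_tendsto] by blast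
qed

lemma cexp_0 [simp]: "cexp 0 = 0"
  using cexp_lattice[of 0] by simp

lemma cexp_\<theta>_mult: "cexp (\<theta> * z) = \<theta> * cexp z + cexp z ^ CARD('q)"
  using period unfolding carlitz_period_def by blast

lemma absv_cexp:
  assumes "absv x / (absv \<pi> * real (CARD('q)) ^ d) < 1"
  shows "absv (cexp x) = absv (poly (exp_poly d) x)"
proof -
  have "\<forall>\<^sub>F d' in sequentially. absv (poly (exp_poly d') x) = absv (poly (exp_poly d) x)"
    unfolding eventually_sequentially using absv_exp_poly_eq[OF _ assms] by blast
  then show ?thesis
    using LIMSEQ_unique[OF lim_absv[OF exp_poly_tendsto[of x]] tendsto_eventually] by blast
qed

text \<open>The absolute value equals that of a finite stage, a product whose factors vanish only at
  lattice points.\<close>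

lemma cexp_nonzero:
  assumes "z \<in> Omega \<iota>" shows "cexp (\<pi> * z) \<noteq> 0"
proof -
  obtain d where d: "absv (\<pi> * z) / (absv \<pi> * real (CARD('q)) ^ d) < 1"
    using radius_exists[of 1 "\<pi> * z"] by auto
  have "z \<noteq> emb b" for b using assms emb_in_range[of b] by (auto simp: Omega_def)
  moreover have "z \<noteq> 0" using \<open>z \<noteq> emb 0\<close> by simp
  ultimately have "poly (exp_poly d) (\<pi> * z) \<noteq> 0"
    by (auto simp: exp_poly_prod prod_zero_iff)
  then show ?thesis using absv_cexp[OF d] by auto
qed

lemma cexp_periodic: "cexp (\<pi> * (z + emb a)) = cexp (\<pi> * z)"
  by (simp add: distrib_left cexp_add cexp_lattice)

text \<open>After subtraction of a nearest polynomial, z becomes y with |y| = \<open>im y\<close>,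
  no closer to any b than to 0. Then |y - b| >= |b|, so every factor of the product has absolute
  value at least 1, and the leading factor \<pi> y bounds the exponential from below.\<close>

lemma absv_cexp_ge:
  assumes "1 \<le> im z" shows "absv \<pi> * im z \<le> absv (cexp (\<pi> * z))"
proof -
  obtain a where a: "absv (z - emb a) = im z" using near_poly[OF assms] .
  define y where "y = z - emb a"
  have y: "absv y = im y" "im y = im z"
    using a im_emb_add[of z "- a"] by (simp_all add: y_def emb_uminus)
  obtain d where d: "absv (\<pi> * y) / (absv \<pi> * real (CARD('q)) ^ d) < 1"
    using radius_exists[of 1 "\<pi> * y"] by auto
  have "1 \<le> (\<Prod>b\<in>polys_lt d - {0}. absv (1 - \<pi> * y / (\<pi> * emb b)))"
  proof (rule prod_ge_1)
    fix b :: "'q poly" assume "b \<in> polys_lt d - {0}"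
    then have b: "emb b \<noteq> 0" by simp
    have "absv (1 - \<pi> * y / (\<pi> * emb b)) = absv (y - emb b) / absv (emb b)"
      using b by (simp add: absv_divide[symmetric] diff_divide_distrib absv_minus_commute)
    moreover have "absv (emb b) \<le> absv (y - emb b)"
    proof (cases "absv (emb b) \<le> absv y")
      case True
      have "im y \<le> absv (y - emb b)" unfolding A_emb_def by (rule im_le)
      then show ?thesis using True y by simp
    next
      case False
      then show ?thesis using absv_diff_eq[of y "emb b"] by (simp add: absv_minus_commute)
    qed
    ultimately show "1 \<le> absv (1 - \<pi> * y / (\<pi> * emb b))" using b by simp
  qed
  from mult_left_mono[OF this, of "absv (\<pi> * y)"]
  have "absv (\<pi> * y) \<le> absv (poly (exp_poly d) (\<pi> * y))"
    unfolding exp_poly_prod absv_mult absv_prod by simp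
  moreover have "cexp (\<pi> * y) = cexp (\<pi> * z)"
    using cexp_periodic[of z "- a"] by (simp add: y_def emb_uminus)
  ultimately show ?thesis using absv_cexp[OF d] y by (simp add: absv_mult)
qed

text \<open>The second claim bounds the Gauss norm of e_d^n on the disc of radius |\<pi>| by
  |\<pi>|^n. In the induction for n = 1 the correction e_d^q / \<epsilon>^(q - 1) obeys the same
  bound, because the first claim gives |\<epsilon>| >= |\<pi>|.\<close>

lemma absv_exp_poly_\<theta>: "absv \<pi> * real (CARD('q)) ^ d \<le> absv (poly (exp_poly d) (\<pi> * \<theta> ^ d))"
  and exp_poly_power_bound: "absv (coeff (exp_poly d ^ n) i) * absv \<pi> ^ i \<le> absv \<pi> ^ n"
proof -
  have pow: "absv (coeff (p ^ n) i) * absv \<pi> ^ i \<le> absv \<pi> ^ n"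
    if p: "\<And>i. absv (coeff p i) * absv \<pi> ^ i \<le> absv \<pi>" for p :: "'c poly" and n i
  proof (induction n arbitrary: i)
    case 0
    then show ?case by (cases i) (auto simp: coeff_1)
  next
    case (Suc n)
    have "absv (coeff (p ^ Suc n) i * \<pi> ^ i) = absv (\<Sum>j\<le>i. (coeff p j * \<pi> ^ j) * (coeff (p ^ n) (i - j) * \<pi> ^ (i - j)))"
      unfolding power_Suc coeff_mult sum_distrib_right
      by (intro arg_cong[where f = absv] sum.cong) (auto simp: power_add[symmetric] algebra_simps)
    also have "\<dots> \<le> absv \<pi> * absv \<pi> ^ n"
    proof (rule absv_sum_le)
      fix j
      show "absv (coeff p j * \<pi> ^ j * (coeff (p ^ n) (i - j) * \<pi> ^ (i - j))) \<le> absv \<pi> * absv \<pi> ^ n"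
        unfolding absv_mult absv_power using p[of j] Suc[of "i - j"] by (intro mult_mono) auto
    qed simp
    finally show ?case by (simp add: absv_mult absv_power)
  qed
  show \<theta>: "absv \<pi> * real (CARD('q)) ^ d \<le> absv (poly (exp_poly d) (\<pi> * \<theta> ^ d))" for d
  proof -
    have "1 \<le> (\<Prod>b\<in>polys_lt d - {0}. absv (1 - \<pi> * \<theta> ^ d / (\<pi> * emb b)))"
    proof (rule prod_ge_1)
      fix b :: "'q poly" assume b: "b \<in> polys_lt d - {0}"
      then have lt: "absv (emb b) < absv (\<theta> ^ d)"
        using card_gt_1 by (auto simp: polys_lt_def absv_emb absv_\<theta>_power intro!: power_strict_increasing)
      then have "absv (\<theta> ^ d - emb b) = absv (\<theta> ^ d)" by (rule absv_diff_eq)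
      moreover have "absv (1 - \<pi> * \<theta> ^ d / (\<pi> * emb b)) = absv (\<theta> ^ d - emb b) / absv (emb b)"
        using b by (simp add: absv_divide[symmetric] diff_divide_distrib absv_minus_commute)
      ultimately show "1 \<le> absv (1 - \<pi> * \<theta> ^ d / (\<pi> * emb b))" using lt b by simp
    qed
    from mult_left_mono[OF this, of "absv (\<pi> * \<theta> ^ d)"]
    have "absv (\<pi> * \<theta> ^ d) \<le> absv (poly (exp_poly d) (\<pi> * \<theta> ^ d))"
      unfolding exp_poly_prod absv_mult absv_prod by simp
    then show ?thesis by (simp add: absv_mult absv_\<theta>_power)
  qed
  have bd: "absv (coeff (exp_poly d) i) * absv \<pi> ^ i \<le> absv \<pi>" for d i
  proof (induction d arbitrary: i)
    case 0
    then show ?case by (auto simp: coeff_pCons split: nat.splits)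
  next
    case (Suc d)
    define \<epsilon> where "\<epsilon> = poly (exp_poly d) (\<pi> * \<theta> ^ d)"
    have "absv \<pi> * 1 \<le> absv \<pi> * real (CARD('q)) ^ d" using card_gt_1 by (intro mult_left_mono) auto
    then have "absv \<pi> \<le> absv \<epsilon>" unfolding \<epsilon>_def using \<theta>[of d] by linarith
    then have "absv \<pi> ^ (CARD('q) - 1) \<le> absv \<epsilon> ^ (CARD('q) - 1)" by (intro power_mono) auto
    moreover have "0 < absv \<pi> ^ (CARD('q) - 1)" by simp
    ultimately have le1: "absv \<pi> ^ (CARD('q) - 1) / absv \<epsilon> ^ (CARD('q) - 1) \<le> 1"
      by (simp only: divide_le_eq_1_pos order_less_le_trans)
    have "absv (inverse (\<epsilon> ^ (CARD('q) - 1)) * coeff (exp_poly d ^ CARD('q)) i) * absv \<pi> ^ i \<le>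
        absv \<pi> ^ CARD('q) / absv \<epsilon> ^ (CARD('q) - 1)"
      using divide_right_mono[OF pow[OF Suc, of "CARD('q)" i], of "absv \<epsilon> ^ (CARD('q) - 1)"]
      by (simp only: absv_mult absv_inverse absv_power divide_inverse mult_ac absv_nonneg zero_le_power simp_thms)
    also have "absv \<pi> ^ CARD('q) = absv \<pi> * absv \<pi> ^ (CARD('q) - 1)"
      using power_Suc[of "absv \<pi>" "CARD('q) - 1"] by simp
    also have "absv \<pi> * absv \<pi> ^ (CARD('q) - 1) / absv \<epsilon> ^ (CARD('q) - 1) \<le> absv \<pi>"
      using mult_left_mono[OF le1, of "absv \<pi>"] by simp
    finally have "absv (inverse (\<epsilon> ^ (CARD('q) - 1)) * coeff (exp_poly d ^ CARD('q)) i * \<pi> ^ i) \<le> absv \<pi>"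
      by (simp add: absv_mult absv_power)
    moreover have "absv (coeff (exp_poly d) i * \<pi> ^ i) \<le> absv \<pi>"
      using Suc[of i] by (simp add: absv_mult absv_power)
    moreover have e: "coeff (exp_poly (Suc d)) i * \<pi> ^ i = coeff (exp_poly d) i * \<pi> ^ i -
        inverse (\<epsilon> ^ (CARD('q) - 1)) * coeff (exp_poly d ^ CARD('q)) i * \<pi> ^ i"
      by (simp add: \<epsilon>_def algebra_simps)
    ultimately have "absv (coeff (exp_poly (Suc d)) i * \<pi> ^ i) \<le> absv \<pi>"
      unfolding e using absv_diff_le[of "coeff (exp_poly d) i * \<pi> ^ i"
          "inverse (\<epsilon> ^ (CARD('q) - 1)) * coeff (exp_poly d ^ CARD('q)) i * \<pi> ^ i"] by linarith
    then show ?case by (simp only: absv_mult absv_power)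
  qed
  show "absv (coeff (exp_poly d ^ n) i) * absv \<pi> ^ i \<le> absv \<pi> ^ n"
    by (rule pow) (rule bd)
qed

text \<open>Consecutive coefficients differ by one of e_d^q divided by \<epsilon>^(q - 1); the
  numerator is bounded uniformly in d, and the denominator grows at least like q^d.\<close>

lemma coeff_exp_poly_convergent: "convergent (\<lambda>d. coeff (exp_poly d) i)"
proof (rule convergent_absvI)
  fix e :: real assume e: "e > 0"
  define C where "C = absv \<pi> ^ CARD('q) / absv \<pi> ^ i"
  have C: "C \<ge> 0" by (simp add: C_def)
  obtain d0 where d0: "\<forall>d\<ge>d0. absv (1::'c) / (absv \<pi> * real (CARD('q)) ^ d) < min 1 (e / (C + 1))"
    using radius_exists[of "min 1 (e / (C + 1))" 1] e C by auto
  have "absv (coeff (exp_poly (Suc d)) i - coeff (exp_poly d) i) < e" if d: "d \<ge> d0" for d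
  proof -
    define \<epsilon> where "\<epsilon> = poly (exp_poly d) (\<pi> * \<theta> ^ d)"
    define r where "r = absv \<pi> * real (CARD('q)) ^ d"
    have r: "r > 0" using card_gt_1 by (simp add: r_def)
    have r1: "r > 1" "C + 1 < e * r"
      using d0[rule_format, OF d] r C by (auto simp: field_simps simp flip: r_def)
    have "r \<le> absv \<epsilon>" using absv_exp_poly_\<theta>[of d] by (simp add: \<epsilon>_def r_def)
    \<comment> \<open>The exponent is at least 1, with equality for q = 2, and the base exceeds 1 by
      the choice of \<open>d0\<close>.\<close>
    also have "\<dots> \<le> absv \<epsilon> ^ (CARD('q) - 1)"
      using calculation r1 card_field_ge_2[where 'q='q] by (intro self_le_power) auto
    finally have r\<epsilon>: "r \<le> absv \<epsilon> ^ (CARD('q) - 1)" .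
    have "coeff (exp_poly (Suc d)) i - coeff (exp_poly d) i = - (inverse (\<epsilon> ^ (CARD('q) - 1)) * coeff (exp_poly d ^ CARD('q)) i)"
      by (simp add: \<epsilon>_def)
    then have "absv (coeff (exp_poly (Suc d)) i - coeff (exp_poly d) i) = absv (coeff (exp_poly d ^ CARD('q)) i) / absv \<epsilon> ^ (CARD('q) - 1)"
      by (simp only: absv_uminus absv_mult absv_inverse absv_power divide_inverse mult.commute)
    also have "\<dots> \<le> C / r"
    proof (rule frac_le)
      show "absv (coeff (exp_poly d ^ CARD('q)) i) \<le> C"
        using exp_poly_power_bound[of d "CARD('q)" i] by (simp add: C_def pos_le_divide_eq)
    qed (use C r r\<epsilon> in auto)
    also have "\<dots> < e" using r1 r by (simp add: divide_less_eq)
    finally show ?thesis .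
  qed
  then show "\<exists>N. \<forall>n\<ge>N. absv (coeff (exp_poly (Suc n)) i - coeff (exp_poly n) i) < e" by blast
qed

end

subsection \<open>Goss polynomials\<close>

context C_infty
begin

lemma embed_in_alg_elements: "\<iota> u \<in> alg_elements \<iota>"
  unfolding alg_elements_def
  by (intro CollectI exI[of _ "[:- u, 1:]"]) (simp add: map_poly_pCons embed_uminus embed_one)

lemma root_over_embed:
  assumes "degree p > 0" "\<And>i. coeff p i \<in> range \<iota>" obtains x where "poly p x = 0"
  using alg_closed[OF assms(1)] assms(2) embed_in_alg_elements by (metis imageE)

text \<open>A square root of T has half-integral valuation and so lies outside K_infty, in every
  characteristic; multiplication by powers of T raises its positive imaginary part beyond any
  bound.\<close>

lemma exists_im_ge: "\<exists>z. r \<le> im z"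
proof -
  have "coeff [:- \<theta>, 0, 1:] i \<in> range \<iota>" for i
    by (auto simp: coeff_pCons embed_uminus[symmetric] split: nat.splits)
       (metis embed_one embed_0 range_eqI)+
  then obtain x where "poly [:- \<theta>, 0, 1:] x = 0"
    using root_over_embed[of "[:- \<theta>, 0, 1:]"] by auto
  then have x: "x ^ 2 = \<theta>" by (simp add: power2_eq_square)
  have "x \<notin> range \<iota>"
  proof
    assume "x \<in> range \<iota>"
    then obtain u where u: "x = \<iota> u" by auto
    then have "\<iota> (u ^ 2) = \<theta>" using x by (simp add: embed_power)
    then have "u ^ 2 = fls_X_inv" by simp
    then have "fls_subdegree (u * u) = fls_subdegree (fls_X_inv :: 'q fls)" by (simp add: power2_eq_square)
    then have "2 * fls_subdegree u = -1" using \<open>u ^ 2 = fls_X_inv\<close> by (cases "u = 0") (auto simp: )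
    then show False by presburger
  qed
  then have pos: "0 < im x" by (rule im_pos)
  obtain n where "r / im x < real (CARD('q)) ^ n" using card_gt_1 real_arch_pow by blast
  moreover have "im (emb (monom 1 n) * x) = real (CARD('q)) ^ n * im x"
    by (subst im_emb_mult) (auto simp: absv_emb degree_monom_eq)
  ultimately have "r \<le> im (emb (monom 1 n) * x)"
    using pos by (simp add: divide_less_eq)
  then show ?thesis ..
qed

lemma infinite_C: "infinite (UNIV :: 'c set)"
proof
  assume "finite (UNIV :: 'c set)"
  then have "finite (range (\<lambda>n::nat. \<theta> ^ n))" by (rule rev_finite_subset) simp
  moreover have "inj (\<lambda>n::nat. \<theta> ^ n)"
  proof (rule injI)
    fix m n :: nat assume "\<theta> ^ m = \<theta> ^ n"
    then have "real (CARD('q)) ^ m = real (CARD('q)) ^ n" by (metis absv_\<theta>_power)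
    then show "m = n" using card_gt_1 by (simp add: power_inject_exp)
  qed
  ultimately show False using finite_imageD by blast
qed

lemma poly_eq_on_infinite:
  assumes "infinite S" "\<And>x. x \<in> S \<Longrightarrow> poly p x = poly r (x::'c)" shows "p = r"
proof (rule ccontr)
  assume "p \<noteq> r"
  then have "finite {x. poly (p - r) x = 0}" by (intro poly_roots_finite) simp
  moreover have "S \<subseteq> {x. poly (p - r) x = 0}" using assms(2) by auto
  ultimately show False using assms(1) finite_subset by blast
qed

text \<open>The tail of an ultrametric sum is controlled by its largest term, so a limit over all
  finite sets can be taken along the exhaustion by degree.\<close>

lemma has_sum_polysI:
  assumes tail: "\<And>\<epsilon>. \<epsilon> > 0 \<Longrightarrow> \<exists>d. \<forall>b. b \<notin> polys_lt d \<longrightarrow> absv (h b :: 'c) < \<epsilon>"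
    and lim: "(\<lambda>d. \<Sum>b\<in>polys_lt d. h b) \<longlonglongrightarrow> s"
  shows "(h has_sum s) (UNIV :: 'q poly set)"
  unfolding has_sum_absv_iff
proof (intro allI impI)
  fix \<epsilon> :: real assume \<epsilon>: "\<epsilon> > 0"
  obtain d1 where d1: "\<And>b. b \<notin> polys_lt d1 \<Longrightarrow> absv (h b) < \<epsilon> / 2" using tail[of "\<epsilon> / 2"] \<epsilon> by auto
  obtain d2 where d2: "\<And>d. d \<ge> d2 \<Longrightarrow> absv ((\<Sum>b\<in>polys_lt d. h b) - s) < \<epsilon>"
    using lim \<epsilon> unfolding tendsto_absv_iff eventually_sequentially by blast
  define d where "d = max d1 d2"
  have "absv (sum h Y - s) < \<epsilon>" if Y: "finite Y" "polys_lt d \<subseteq> Y" for Y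
  proof -
    have "absv (sum h (Y - polys_lt d)) \<le> \<epsilon> / 2"
    proof (rule absv_sum_le)
      fix b assume "b \<in> Y - polys_lt d"
      then have "b \<notin> polys_lt d1" using polys_lt_mono[of d1 d, where 'a='q] by (auto simp: d_def)
      then show "absv (h b) \<le> \<epsilon> / 2" using d1 less_imp_le by blast
    qed (use \<epsilon> in simp)
    moreover have "absv (sum h (polys_lt d) - s) < \<epsilon>" using d2 by (simp add: d_def)
    moreover have e: "sum h Y - s = sum h (Y - polys_lt d) + (sum h (polys_lt d) - s)"
      using sum.subset_diff[OF Y(2,1), of h] by simp
    ultimately show ?thesis unfolding e
      using absv_add[of "sum h (Y - polys_lt d)" "sum h (polys_lt d) - s"] \<epsilon> by linarith
  qed
  then show "\<exists>X. finite X \<and> X \<subseteq> UNIV \<and> (\<forall>Y. finite Y \<and> X \<subseteq> Y \<and> Y \<subseteq> UNIV \<longrightarrow> absv (sum h Y - s) < \<epsilon>)"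
    by (intro exI[of _ "polys_lt d"]) auto
qed

lemma has_sum_unique_C: "(h has_sum (s::'c)) S \<Longrightarrow> (h has_sum s') S \<Longrightarrow> s = s'"
  unfolding has_sum_def by (rule tendsto_unique[OF finite_subsets_at_top_neq_bot])

end

lemma inverse_const_minus_X_nth:
  assumes "w \<noteq> (0 :: 'a::field)"
  shows "fps_nth (inverse (fps_const w - fps_X)) n = 1 / w ^ Suc n"
proof -
  have "(fps_const w - fps_X) * Abs_fps (\<lambda>n. 1 / w ^ Suc n) = 1"
  proof (rule fps_ext)
    fix n
    show "fps_nth ((fps_const w - fps_X) * Abs_fps (\<lambda>n. 1 / w ^ Suc n)) n = fps_nth 1 n"
      using assms by (cases n) (auto simp: left_diff_distrib field_simps)
  qed
  then have "inverse (fps_const w - fps_X) = Abs_fps (\<lambda>n. 1 / w ^ Suc n)"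
    by (metis fps_inverse_unique)
  then show ?thesis by simp
qed

text \<open>The geometric series for 1 / (s - F), cut off at m = n because F has no constant
  term.\<close>

lemma inverse_const_minus_nth:
  fixes F :: "'a::field fps"
  assumes s: "s \<noteq> 0" and F0: "fps_nth F 0 = 0"
  shows "fps_nth (inverse (fps_const s - F)) n = (\<Sum>m\<le>n. fps_nth (F ^ m) n / s ^ Suc m)"
proof -
  define G where "G = fps_const (1 / s) * F"
  have e: "fps_const s - F = fps_const s * (1 - G)"
    using s by (simp add: G_def right_diff_distrib flip: mult.assoc)
  have nz: "fps_nth (fps_const s - F) 0 \<noteq> 0" using s F0 by simp
  define H where "H = fps_const (1 / s) * (\<Sum>m\<le>n. G ^ m)"
  have "(fps_const s - F) * H = 1 - G ^ Suc n"
  proof -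
    have "(fps_const s - F) * H = fps_const s * fps_const (1 / s) * ((1 - G) * (\<Sum>m<Suc n. G ^ m))"
      unfolding e H_def lessThan_Suc_atMost by (simp only: mult_ac)
    also have "\<dots> = 1 - G ^ Suc n"
      using s one_diff_power_eq[of G "Suc n"] by simp
    finally show ?thesis .
  qed
  moreover have "inverse (fps_const s - F) * ((fps_const s - F) * H) = H"
    by (simp only: mult.assoc[symmetric] inverse_mult_eq_1[OF nz] mult_1_left)
  ultimately have "H = inverse (fps_const s - F) - inverse (fps_const s - F) * G ^ Suc n"
    by (simp only: right_diff_distrib mult_1_right)
  then have "inverse (fps_const s - F) = H + inverse (fps_const s - F) * G ^ Suc n"
    by (simp only: diff_add_cancel)
  then have "fps_nth (inverse (fps_const s - F)) n = fps_nth H n + fps_nth (inverse (fps_const s - F) * G ^ Suc n) n"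
    by (metis fps_add_nth)
  moreover have "fps_nth (G ^ Suc n) j = 0" if "j \<le> n" for j
    using F0 that by (intro startsby_zero_power_prefix[rule_format]) (auto simp: G_def)
  then have "fps_nth (inverse (fps_const s - F) * G ^ Suc n) n = 0"
    by (simp add: fps_mult_nth del: power_Suc)
  moreover have "fps_nth H n = (\<Sum>m\<le>n. fps_nth (F ^ m) n / s ^ Suc m)"
    by (simp add: H_def G_def power_mult_distrib fps_sum_nth sum_distrib_left fps_const_power power_divide)
  ultimately show ?thesis by simp
qed

context carlitz_setting
begin

definition exp_fps :: "'c fps" where
  "exp_fps = Abs_fps (\<lambda>i. lim (\<lambda>d. coeff (exp_poly d) i))"

text \<open>
  The coefficient of \<open>u^(n - 1)\<close> in \<open>1 / (s - e(u))\<close> with \<open>s = 1 / X\<close>, where \<open>1 / (e(z) - e(u))\<close>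
  is the generating function of the power sums over \<open>z + \<pi>A\<close>.
\<close>

definition goss :: "nat \<Rightarrow> 'c poly" where
  "goss n = (\<Sum>m<n. monom (fps_nth (exp_fps ^ m) (n - 1)) (Suc m))"

lemma coeff_exp_poly_power_tendsto: "(\<lambda>d. coeff (exp_poly d ^ m) n) \<longlonglongrightarrow> fps_nth (exp_fps ^ m) n"
proof (induction m arbitrary: n)
  case (Suc m)
  have "(\<lambda>d. coeff (exp_poly d) i) \<longlonglongrightarrow> fps_nth exp_fps i" for i
    using coeff_exp_poly_convergent[of i] by (simp add: exp_fps_def convergent_LIMSEQ_iff)
  then show ?case using Suc
    unfolding power_Suc coeff_mult fps_mult_nth atLeast0AtMost by (intro lim_sum lim_mult)
qed (auto simp: coeff_1)

text \<open>The polynomial s - e_d(X) is a constant times the product of the w + \<pi> b - X, and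
  its derivative is -1. Its logarithmic derivative is therefore the partial fraction expansion of 1
  / (s - e_d(X)), and the coefficient of X^n is the claim.\<close>

lemma sum_inverse_powers_finite:
  assumes nz: "\<And>b. b \<in> polys_lt d \<Longrightarrow> w + \<pi> * emb b \<noteq> 0"
  shows "(\<Sum>b\<in>polys_lt d. 1 / (w + \<pi> * emb b) ^ Suc n) =
         (\<Sum>m\<le>n. coeff (exp_poly d ^ m) n / poly (exp_poly d) w ^ Suc m)"
proof -
  define K where "K = (\<Prod>b\<in>polys_lt d - {0}. \<pi> * emb b)"
  have K: "K \<noteq> 0" by (simp add: K_def)
  define s where "s = poly (exp_poly d) w"
  have "(\<Prod>b\<in>polys_lt d. w + \<pi> * emb b) \<noteq> 0" using nz by (simp add: prod_zero_iff)
  then have "K * s \<noteq> 0" by (simp add: prod_shift_lattice s_def K_def)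
  then have s: "s \<noteq> 0" by simp
  define L where "L = (\<lambda>b. [:w + \<pi> * emb b, -1:])"
  have P: "[:s:] - exp_poly d = smult (1 / K) (\<Prod>b\<in>polys_lt d. L b)"
  proof (rule poly_eq_on_infinite[OF infinite_C])
    fix x
    have "K * (s - poly (exp_poly d) x) = (\<Prod>b\<in>polys_lt d. w - x + \<pi> * emb b)"
      by (simp add: prod_shift_lattice exp_poly_diff K_def s_def)
    then show "poly ([:s:] - exp_poly d) x = poly (smult (1 / K) (\<Prod>b\<in>polys_lt d. L b)) x"
      using K by (simp add: poly_prod L_def field_simps)
  qed
  have "pderiv ([:s:] - exp_poly d) = - 1"
    by (simp add: pderiv_diff pderiv_exp_poly pderiv_pCons)
  moreover have "pderiv (smult (1 / K) (\<Prod>b\<in>polys_lt d. L b)) =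
      - smult (1 / K) (\<Sum>b\<in>polys_lt d. \<Prod>b'\<in>polys_lt d - {b}. L b')"
  proof -
    have "pderiv (L b) = - 1" for b
      by (simp add: L_def pderiv_pCons one_pCons)
    then show ?thesis by (simp add: pderiv_smult pderiv_prod sum_negf)
  qed
  \<comment> \<open>The common numerator of the partial fractions is constant because
    \<open>exp_poly d\<close> has derivative 1.\<close>
  ultimately have one: "smult (1 / K) (\<Sum>b\<in>polys_lt d. \<Prod>b'\<in>polys_lt d - {b}. L b') = 1"
    by (metis P minus_equation_iff)
  define F where "F = fps_of_poly (exp_poly d)"
  have F: "fps_const s - F = fps_const (1 / K) * (\<Prod>b\<in>polys_lt d. fps_of_poly (L b))"
    using arg_cong[OF P, of fps_of_poly]
    by (simp add: F_def fps_of_poly_diff fps_of_poly_smult fps_of_poly_prod fps_of_poly_const)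
  have L0: "fps_nth (fps_of_poly (L b)) 0 \<noteq> 0" if "b \<in> polys_lt d" for b
    using nz[OF that] by (simp add: L_def)
  have F0: "fps_nth F 0 = 0"
    using exp_poly_0[of d] by (simp add: F_def poly_0_coeff_0)
  have "(fps_const s - F) * (\<Sum>b\<in>polys_lt d. inverse (fps_of_poly (L b))) =
      fps_const (1 / K) * (\<Sum>b\<in>polys_lt d. \<Prod>b'\<in>polys_lt d - {b}. fps_of_poly (L b'))"
    unfolding F mult.assoc sum_distrib_left
  proof (intro sum.cong refl)
    fix b :: "'q poly" assume b: "b \<in> polys_lt d"
    show "fps_const (1 / K) * ((\<Prod>b\<in>polys_lt d. fps_of_poly (L b)) * inverse (fps_of_poly (L b))) =
      fps_const (1 / K) * (\<Prod>b'\<in>polys_lt d - {b}. fps_of_poly (L b'))"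
      using inverse_mult_eq_1'[OF L0[OF b]] b
      by (simp add: prod.remove[OF finite_polys_lt b] mult_ac)
  qed
  also have "\<dots> = fps_of_poly (smult (1 / K) (\<Sum>b\<in>polys_lt d. \<Prod>b'\<in>polys_lt d - {b}. L b'))"
    by (simp add: fps_of_poly_smult fps_of_poly_sum fps_of_poly_prod)
  finally have "(fps_const s - F) * (\<Sum>b\<in>polys_lt d. inverse (fps_of_poly (L b))) = 1"
    by (simp add: one)
  then have "inverse (fps_const s - F) = (\<Sum>b\<in>polys_lt d. inverse (fps_of_poly (L b)))"
    by (rule fps_inverse_unique)
  then have "(\<Sum>b\<in>polys_lt d. fps_nth (inverse (fps_of_poly (L b))) n) = (\<Sum>m\<le>n. fps_nth (F ^ m) n / s ^ Suc m)"
    using inverse_const_minus_nth[OF s F0, of n] by (simp add: fps_sum_nth)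
  moreover have "fps_nth (inverse (fps_of_poly (L b))) n = 1 / (w + \<pi> * emb b) ^ Suc n" if "b \<in> polys_lt d" for b
  proof -
    have e: "fps_of_poly (L b) = fps_const (w + \<pi> * emb b) - fps_X"
      by (simp add: L_def fps_of_poly_pCons)
    show ?thesis unfolding e by (rule inverse_const_minus_X_nth[OF nz[OF that]])
  qed
  ultimately show ?thesis
    by (simp add: F_def s_def flip: fps_of_poly_power)
qed

lemma poly_goss_inverse: "poly (goss (Suc n)) (1 / x) = (\<Sum>m\<le>n. fps_nth (exp_fps ^ m) n / x ^ Suc m)"
  by (simp add: goss_def poly_sum poly_monom power_one_over lessThan_Suc_atMost divide_inverse power_inverse)

lemma goss_has_sum:
  assumes z: "z \<in> Omega \<iota>" and n: "n > 0"
  shows "((\<lambda>b. 1 / (\<pi> * z + \<pi> * emb b) ^ n) has_sum poly (goss n) (tp z)) UNIV"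
proof (rule has_sum_polysI)
  obtain n' where n': "n = Suc n'" using n by (cases n) auto
  have "z \<noteq> - emb b" for b
    using z emb_in_range[of "- b"] by (auto simp: Omega_def emb_uminus)
  then have "z + emb b \<noteq> 0" for b by (metis eq_neg_iff_add_eq_0)
  then have nz: "\<pi> * z + \<pi> * emb b \<noteq> 0" for b by (simp flip: distrib_left)
  have "(\<lambda>d. \<Sum>m\<le>n'. coeff (exp_poly d ^ m) n' / poly (exp_poly d) (\<pi> * z) ^ Suc m) \<longlonglongrightarrow>
      (\<Sum>m\<le>n'. fps_nth (exp_fps ^ m) n' / cexp (\<pi> * z) ^ Suc m)"
    using cexp_nonzero[OF z]
    by (intro lim_sum lim_divide lim_power coeff_exp_poly_power_tendsto exp_poly_tendsto) auto
  then show "(\<lambda>d. \<Sum>b\<in>polys_lt d. 1 / (\<pi> * z + \<pi> * emb b) ^ n) \<longlonglongrightarrow> poly (goss n) (tp z)"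
    unfolding n' sum_inverse_powers_finite[OF nz] t_param_def poly_goss_inverse .
  fix \<epsilon> :: real assume \<epsilon>: "\<epsilon> > 0"
  obtain d1 where d1: "\<forall>d\<ge>d1. absv (\<pi> * z) / (absv \<pi> * real (CARD('q)) ^ d) < 1"
    using radius_exists[of 1 "\<pi> * z"] by auto
  \<comment> \<open>With 1/r below both 1 and \<epsilon>, its n-th power is below \<epsilon> for
    every n >= 1.\<close>
  obtain d2 where d2: "\<forall>d\<ge>d2. absv (1::'c) / (absv \<pi> * real (CARD('q)) ^ d) < min 1 \<epsilon>"
    using radius_exists[of "min 1 \<epsilon>" 1] \<epsilon> by auto
  define d where "d = max d1 d2"
  define r where "r = absv \<pi> * real (CARD('q)) ^ d"
  have r: "r > 0" using card_gt_1 by (simp add: r_def)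
  have r1: "absv (\<pi> * z) < r" "1 / r < 1" "1 / r < \<epsilon>"
  proof -
    have "d1 \<le> d" "d2 \<le> d" by (auto simp: d_def)
    then have "absv (\<pi> * z) / r < 1" "absv (1::'c) / r < min 1 \<epsilon>"
      unfolding r_def using d1 d2 by blast+
    then show "absv (\<pi> * z) < r" "1 / r < 1" "1 / r < \<epsilon>" using r by (simp_all add: divide_less_eq)
  qed
  have "absv (1 / (\<pi> * z + \<pi> * emb b) ^ n) < \<epsilon>" if "b \<notin> polys_lt d" for b
  proof -
    have ge: "r \<le> absv (\<pi> * emb b)" using absv_lattice_ge[OF that] by (simp add: r_def)
    then have "absv (\<pi> * z + \<pi> * emb b) = absv (\<pi> * emb b)" using r1 by (intro absv_add_eq') simp
    then have "absv (1 / (\<pi> * z + \<pi> * emb b) ^ n) = (1 / absv (\<pi> * emb b)) ^ n"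
      by (simp add: absv_divide absv_power power_one_over)
    also have "\<dots> \<le> (1 / r) ^ n" using r ge by (intro power_mono frac_le) auto
    also have "\<dots> \<le> 1 / r" using n r r1 power_decreasing[of 1 n "1 / r"] by simp
    finally show ?thesis using r1 by simp
  qed
  then show "\<exists>d. \<forall>b. b \<notin> polys_lt d \<longrightarrow> absv (1 / (\<pi> * z + \<pi> * emb b) ^ n) < \<epsilon>" by blast
qed

section \<open>The parameter t near infinity\<close>

lemma t_param_nonzero: "z \<in> Omega \<iota> \<Longrightarrow> tp z \<noteq> 0"
  by (simp add: t_param_def cexp_nonzero)

lemma absv_t_param_le:
  assumes "1 \<le> im z" shows "absv (tp z) \<le> 1 / (absv \<pi> * im z)"
  using absv_cexp_ge[OF assms] assms unfolding t_param_def absv_divide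
  by (intro frac_le) auto

lemma t_param_small:
  assumes "\<epsilon> > 0" obtains r where "r \<ge> 1" "\<And>z. r \<le> im z \<Longrightarrow> absv (tp z) < \<epsilon>"
proof -
  define r where "r = max 1 (2 / (absv \<pi> * \<epsilon>))"
  have "absv (tp z) < \<epsilon>" if "r \<le> im z" for z
  proof -
    have z: "1 \<le> im z" "2 / (absv \<pi> * \<epsilon>) \<le> im z" using that by (auto simp: r_def)
    then have "2 \<le> im z * (absv \<pi> * \<epsilon>)" using assms by (simp add: divide_le_eq)
    then have "1 / (absv \<pi> * im z) < \<epsilon>" using z by (simp add: divide_less_eq mult_ac)
    then show ?thesis using absv_t_param_le[OF z(1)] by simp
  qed
  then show ?thesis using that[of r] by (simp add: r_def)
qed

text \<open>The values of t come arbitrarily close to 0 without reaching it. Infinitely many values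
  determine a polynomial, which makes the description in \<open>goss_poly\<close> unique.\<close>

lemma infinite_t_param: "infinite (tp ` Omega \<iota>)"
proof
  assume fin: "finite (tp ` Omega \<iota>)"
  obtain z0 where z0: "1 \<le> im z0" using exists_im_ge by blast
  then have ne: "tp ` Omega \<iota> \<noteq> {}" using Omega_iff[of z0] by auto
  define \<epsilon> where "\<epsilon> = Min (absv ` tp ` Omega \<iota>)"
  have "\<epsilon> \<in> absv ` tp ` Omega \<iota>" unfolding \<epsilon>_def using fin ne by (intro Min_in) auto
  then have "\<epsilon> > 0" using t_param_nonzero by auto
  then obtain r where r: "r \<ge> 1" "\<And>z. r \<le> im z \<Longrightarrow> absv (tp z) < \<epsilon>" using t_param_small by blast
  obtain z where z: "r \<le> im z" using exists_im_ge by blast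
  then have "z \<in> Omega \<iota>" using r by (simp add: Omega_iff)
  then have "\<epsilon> \<le> absv (tp z)" unfolding \<epsilon>_def using fin by (intro Min_le) auto
  then show False using r(2)[OF z] by simp
qed

lemma goss_poly_eq: assumes "n > 0" shows "goss_poly \<iota> \<pi> n = goss n"
  unfolding goss_poly_def
proof (rule the_equality)
  show "\<forall>z\<in>Omega \<iota>. ((\<lambda>b. 1 / (\<pi> * z + \<pi> * emb b) ^ n) has_sum poly (goss n) (tp z)) UNIV"
    using goss_has_sum assms by blast
  fix G assume G: "\<forall>z\<in>Omega \<iota>. ((\<lambda>b. 1 / (\<pi> * z + \<pi> * emb b) ^ n) has_sum poly G (tp z)) UNIV"
  show "G = goss n"
  proof (rule poly_eq_on_infinite[OF infinite_t_param])
    fix x assume "x \<in> tp ` Omega \<iota>"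
    then show "poly G x = poly (goss n) x"
      using G goss_has_sum[OF _ assms] has_sum_unique_C by blast
  qed
qed

lemma goss_0_eq_0: "poly (goss n) 0 = 0"
  by (simp add: goss_def poly_sum poly_monom)

lemma exp_fps_nth_1: "fps_nth exp_fps 1 = 1" and exp_fps_nth_0: "fps_nth exp_fps 0 = 0"
proof -
  have "coeff (exp_poly d) 1 = 1" for d
    using arg_cong[OF pderiv_exp_poly[of d], of "\<lambda>p. coeff p 0"] by (simp add: coeff_pderiv)
  moreover have "coeff (exp_poly d) 0 = 0" for d
    using exp_poly_0[of d] by (simp add: poly_0_coeff_0)
  ultimately show "fps_nth exp_fps 1 = 1" "fps_nth exp_fps 0 = 0"
    using coeff_exp_poly_power_tendsto[of 1 1] coeff_exp_poly_power_tendsto[of 1 0]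
    by (simp_all add: LIMSEQ_const_iff)
qed

text \<open>The top term m = n - 1 contributes the coefficient of u^(n - 1) in e(u)^(n - 1), which
  is 1 because e(u) starts with u; so the coefficient of X^n is 1.\<close>

lemma goss_nonzero: assumes "n > 0" shows "goss n \<noteq> 0"
proof -
  have e: "fps_nth (exp_fps ^ m) m = 1" for m
    using exp_fps_nth_0 exp_fps_nth_1 by (subst startsby_zero_power_nth_same) (auto simp: )
  obtain n' where n': "n = Suc n'" using assms by (cases n) auto
  have "coeff (goss n) n = (\<Sum>m<n. if m = n' then fps_nth (exp_fps ^ m) (n - 1) else 0)"
    unfolding goss_def coeff_sum by (intro sum.cong) (auto simp: n')
  also have "\<dots> = 1" using e[of n'] by (simp add: n')
  finally show ?thesis by auto
qed

end

subsection \<open>Expansions in the parameter at infinity\<close>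

context carlitz_setting
begin

definition near_infinity :: "'c filter" where
  "near_infinity = filtercomap im at_top"

lemma eventually_near_infinity: "eventually P near_infinity \<longleftrightarrow> (\<exists>r. \<forall>z. r \<le> im z \<longrightarrow> P z)"
  unfolding near_infinity_def eventually_filtercomap_at_top_linorder by blast

lemma near_infinity_neq_bot [simp]: "near_infinity \<noteq> bot"
  unfolding trivial_limit_def eventually_near_infinity using exists_im_ge by blast

lemma eventually_Omega: "\<forall>\<^sub>F z in near_infinity. z \<in> Omega \<iota>"
  unfolding eventually_near_infinity Omega_iff by (intro exI[of _ 1]) auto

lemma eventually_t_param_nonzero: "\<forall>\<^sub>F z in near_infinity. tp z \<noteq> 0"
  using eventually_Omega by eventually_elim (rule t_param_nonzero)

lemma eventually_t_param_small: "\<epsilon> > 0 \<Longrightarrow> \<forall>\<^sub>F z in near_infinity. absv (tp z) < \<epsilon>"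
  unfolding eventually_near_infinity using t_param_small by metis

lemma eventually_near_infinity_mult:
  assumes "eventually P near_infinity" "a \<noteq> 0" shows "\<forall>\<^sub>F z in near_infinity. P (emb a * z)"
proof -
  obtain r where r: "\<And>z. r \<le> im z \<Longrightarrow> P z" using assms(1) unfolding eventually_near_infinity by blast
  have "P (emb a * z)" if "max r 0 \<le> im z" for z
  proof (rule r)
    have "1 * im z \<le> absv (emb a) * im z"
      using absv_emb_ge_1[OF assms(2)] that by (intro mult_right_mono) auto
    then show "r \<le> im (emb a * z)" using that assms(2) by (simp add: im_emb_mult)
  qed
  then show ?thesis unfolding eventually_near_infinity by blast
qed

lemma eventually_near_infinity_divide:
  assumes "eventually P near_infinity" "a \<noteq> 0" shows "\<forall>\<^sub>F z in near_infinity. P ((z + emb b) / emb a)"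
proof -
  obtain r where r: "\<And>z. r \<le> im z \<Longrightarrow> P z" using assms(1) unfolding eventually_near_infinity by blast
  have "P ((z + emb b) / emb a)" if "r * absv (emb a) \<le> im z" for z
    using that assms(2) absv_emb_ge_1[OF assms(2)] by (intro r) (simp add: im_emb_divide im_emb_add field_simps)
  then show ?thesis unfolding eventually_near_infinity by blast
qed

text \<open>Vanishing to order M at infinity, as a growth estimate: it makes sense for any function
  near infinity, in particular for \<phi>((z + \<beta>)/\<pp>), and can be carried through such
  substitutions.\<close>

definition t_bigo :: "nat \<Rightarrow> ('c \<Rightarrow> 'c) \<Rightarrow> bool" where
  "t_bigo M \<phi> \<longleftrightarrow> (\<exists>C\<ge>0. \<forall>\<^sub>F z in near_infinity. absv (\<phi> z) \<le> C * absv (tp z) ^ M)"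

lemma t_bigoI: "0 \<le> C \<Longrightarrow> \<forall>\<^sub>F z in near_infinity. absv (\<phi> z) \<le> C * absv (tp z) ^ M \<Longrightarrow> t_bigo M \<phi>"
  unfolding t_bigo_def by blast

lemma t_bigoE:
  assumes "t_bigo M \<phi>"
  obtains C where "0 \<le> C" "\<forall>\<^sub>F z in near_infinity. absv (\<phi> z) \<le> C * absv (tp z) ^ M"
  using assms unfolding t_bigo_def by blast

lemma t_bigo_cong:
  assumes "t_bigo M \<phi>" "\<forall>\<^sub>F z in near_infinity. \<phi> z = \<psi> z" shows "t_bigo M \<psi>"
proof -
  obtain C where C: "0 \<le> C" "\<forall>\<^sub>F z in near_infinity. absv (\<phi> z) \<le> C * absv (tp z) ^ M"
    using assms(1) by (rule t_bigoE)
  from C(2) assms(2) have "\<forall>\<^sub>F z in near_infinity. absv (\<psi> z) \<le> C * absv (tp z) ^ M"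
    by eventually_elim simp
  then show ?thesis using C(1) by (intro t_bigoI)
qed

lemma t_bigo_zero [simp]: "t_bigo M (\<lambda>z. 0)"
  by (rule t_bigoI[of 0]) auto

lemma t_bigo_add:
  assumes "t_bigo M \<phi>" "t_bigo M \<psi>" shows "t_bigo M (\<lambda>z. \<phi> z + \<psi> z)"
proof -
  obtain C where C: "0 \<le> C" "\<forall>\<^sub>F z in near_infinity. absv (\<phi> z) \<le> C * absv (tp z) ^ M"
    using assms(1) by (rule t_bigoE)
  obtain D where D: "0 \<le> D" "\<forall>\<^sub>F z in near_infinity. absv (\<psi> z) \<le> D * absv (tp z) ^ M"
    using assms(2) by (rule t_bigoE)
  from C(2) D(2) have "\<forall>\<^sub>F z in near_infinity. absv (\<phi> z + \<psi> z) \<le> max C D * absv (tp z) ^ M"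
  proof eventually_elim
    case (elim z)
    have "C * absv (tp z) ^ M \<le> max C D * absv (tp z) ^ M" "D * absv (tp z) ^ M \<le> max C D * absv (tp z) ^ M"
      by (intro mult_right_mono; simp)+
    then show ?case using elim absv_add[of "\<phi> z" "\<psi> z"] by linarith
  qed
  then show ?thesis using C(1) by (intro t_bigoI[of "max C D"]) auto
qed

lemma t_bigo_mult:
  assumes "t_bigo M \<phi>" "t_bigo N \<psi>" shows "t_bigo (M + N) (\<lambda>z. \<phi> z * \<psi> z)"
proof -
  obtain C where C: "0 \<le> C" "\<forall>\<^sub>F z in near_infinity. absv (\<phi> z) \<le> C * absv (tp z) ^ M"
    using assms(1) by (rule t_bigoE)
  obtain D where D: "0 \<le> D" "\<forall>\<^sub>F z in near_infinity. absv (\<psi> z) \<le> D * absv (tp z) ^ N"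
    using assms(2) by (rule t_bigoE)
  from C(2) D(2) have "\<forall>\<^sub>F z in near_infinity. absv (\<phi> z * \<psi> z) \<le> (C * D) * absv (tp z) ^ (M + N)"
  proof eventually_elim
    case (elim z)
    then have "absv (\<phi> z) * absv (\<psi> z) \<le> (C * absv (tp z) ^ M) * (D * absv (tp z) ^ N)"
      using C(1) by (intro mult_mono) auto
    then show ?case by (simp add: absv_mult power_add mult_ac)
  qed
  then show ?thesis using C(1) D(1) by (intro t_bigoI[of "C * D"]) auto
qed

lemma t_bigo_const: "t_bigo 0 (\<lambda>z. c)"
  by (rule t_bigoI[of "absv c"]) auto

lemma t_bigo_cmult: "t_bigo M \<phi> \<Longrightarrow> t_bigo M (\<lambda>z. c * \<phi> z)"
  using t_bigo_mult[OF t_bigo_const[of c], of M \<phi>] by simp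

lemma t_bigo_uminus: "t_bigo M \<phi> \<Longrightarrow> t_bigo M (\<lambda>z. - \<phi> z)"
  using t_bigo_cmult[of M \<phi> "-1"] by simp

lemma t_bigo_diff: "t_bigo M \<phi> \<Longrightarrow> t_bigo M \<psi> \<Longrightarrow> t_bigo M (\<lambda>z. \<phi> z - \<psi> z)"
  using t_bigo_add[OF _ t_bigo_uminus[of M \<psi>], of \<phi>] by simp

lemma t_bigo_sum: "(\<And>i. i \<in> S \<Longrightarrow> t_bigo M (\<phi> i)) \<Longrightarrow> t_bigo M (\<lambda>z. \<Sum>i\<in>S. \<phi> i z)"
  by (induction S rule: infinite_finite_induct) (auto intro: t_bigo_add)

lemma t_bigo_t_power: "t_bigo M (\<lambda>z. tp z ^ M)"
  by (rule t_bigoI[of 1]) (auto simp: absv_power)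

lemma t_bigo_mono:
  assumes "t_bigo M \<phi>" "N \<le> M" shows "t_bigo N \<phi>"
proof -
  obtain C where C: "0 \<le> C" "\<forall>\<^sub>F z in near_infinity. absv (\<phi> z) \<le> C * absv (tp z) ^ M"
    using assms(1) by (rule t_bigoE)
  from C(2) eventually_t_param_small[OF zero_less_one] have "\<forall>\<^sub>F z in near_infinity. absv (\<phi> z) \<le> C * absv (tp z) ^ N"
  proof eventually_elim
    case (elim z)
    have "C * absv (tp z) ^ M \<le> C * absv (tp z) ^ N"
      using C(1) elim assms(2) by (intro mult_left_mono power_decreasing) auto
    then show ?case using elim by linarith
  qed
  then show ?thesis using C(1) by (intro t_bigoI)
qed

text \<open>Dividing by t^j leaves |c| <= C |t|, and t tends to 0 at infinity without
  vanishing.\<close>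

lemma t_bigo_coeff_zero:
  assumes "t_bigo (Suc j) (\<lambda>z. c * tp z ^ j)" shows "c = 0"
proof (rule ccontr)
  assume c: "c \<noteq> 0"
  obtain C where C: "0 \<le> C" "\<forall>\<^sub>F z in near_infinity. absv (c * tp z ^ j) \<le> C * absv (tp z) ^ Suc j"
    using assms by (rule t_bigoE)
  have "absv c / (C + 1) > 0" using c C(1) by simp
  from C(2) eventually_t_param_small[OF this] eventually_t_param_nonzero
  have "\<forall>\<^sub>F z in near_infinity. False"
  proof eventually_elim
    case (elim z)
    have "absv c * absv (tp z) ^ j \<le> C * absv (tp z) * absv (tp z) ^ j"
      using elim(1) by (simp add: absv_mult absv_power mult_ac)
    then have "absv c \<le> C * absv (tp z)" using elim(3) by simp
    also have "\<dots> \<le> (C + 1) * absv (tp z)" by (intro mult_right_mono) auto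
    also have "\<dots> < absv c" using elim(2) C(1) by (simp add: less_divide_eq mult.commute)
    finally show False by simp
  qed
  then show False by simp
qed

text \<open>An asymptotic expansion in the sense of Poincare. As convergence is not asked for, sums,
  products and polynomials are handled by order estimates alone.\<close>

definition t_asymp :: "('c \<Rightarrow> 'c) \<Rightarrow> 'c fps \<Rightarrow> bool" where
  "t_asymp f F \<longleftrightarrow> (\<forall>M. t_bigo M (\<lambda>z. f z - (\<Sum>i<M. fps_nth F i * tp z ^ i)))"

lemma t_bigo_partial_sum: "t_bigo 0 (\<lambda>z. \<Sum>i\<in>S. h i * tp z ^ i)"
proof (rule t_bigo_sum)
  fix i
  show "t_bigo 0 (\<lambda>z. h i * tp z ^ i)"
    using t_bigo_mono[OF t_bigo_cmult[OF t_bigo_t_power[of i], of "h i"]] by simp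
qed

lemma t_asymp_coeff_zero:
  assumes "t_asymp f F" "t_bigo N f" "i < N" shows "fps_nth F i = 0"
  using assms(3)
proof (induction i rule: less_induct)
  case (less i)
  have e: "(\<Sum>j<Suc i. fps_nth F j * tp z ^ j) = fps_nth F i * tp z ^ i" for z
    using less by simp
  have "t_bigo (Suc i) (\<lambda>z. f z - (\<Sum>j<Suc i. fps_nth F j * tp z ^ j))"
    by (rule assms(1)[unfolded t_asymp_def, rule_format, of "Suc i"])
  then have "t_bigo (Suc i) (\<lambda>z. f z - fps_nth F i * tp z ^ i)"
    by (simp only: e)
  from t_bigo_diff[OF t_bigo_mono[OF assms(2), of "Suc i"] this] less.prems
  have "t_bigo (Suc i) (\<lambda>z. fps_nth F i * tp z ^ i)" by simp
  then show ?case by (rule t_bigo_coeff_zero)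
qed

lemma t_asymp_diff: "t_asymp f F \<Longrightarrow> t_asymp g G \<Longrightarrow> t_asymp (\<lambda>z. f z - g z) (F - G)"
  unfolding t_asymp_def
proof
  fix M
  assume *: "\<forall>M. t_bigo M (\<lambda>z. f z - (\<Sum>i<M. fps_nth F i * tp z ^ i))" "\<forall>M. t_bigo M (\<lambda>z. g z - (\<Sum>i<M. fps_nth G i * tp z ^ i))"
  show "t_bigo M (\<lambda>z. f z - g z - (\<Sum>i<M. fps_nth (F - G) i * tp z ^ i))"
    using t_bigo_diff[OF *(1)[rule_format, of M] *(2)[rule_format, of M]]
    by (simp add: algebra_simps sum_subtractf)
qed

lemma t_asymp_unique: assumes "t_asymp f F" "t_asymp f G" shows "F = G"
proof -
  have "t_asymp (\<lambda>z. 0) (F - G)" using t_asymp_diff[OF assms] by simp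
  then have "fps_nth (F - G) i = 0" for i by (rule t_asymp_coeff_zero[of _ _ "Suc i"]) auto
  then show ?thesis by (simp add: fps_eq_iff)
qed

lemma t_asymp_add: "t_asymp f F \<Longrightarrow> t_asymp g G \<Longrightarrow> t_asymp (\<lambda>z. f z + g z) (F + G)"
  unfolding t_asymp_def
proof
  fix M
  assume *: "\<forall>M. t_bigo M (\<lambda>z. f z - (\<Sum>i<M. fps_nth F i * tp z ^ i))" "\<forall>M. t_bigo M (\<lambda>z. g z - (\<Sum>i<M. fps_nth G i * tp z ^ i))"
  show "t_bigo M (\<lambda>z. f z + g z - (\<Sum>i<M. fps_nth (F + G) i * tp z ^ i))"
    using t_bigo_add[OF *(1)[rule_format, of M] *(2)[rule_format, of M]]
    by (simp add: algebra_simps sum.distrib)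
qed

lemma t_asymp_const: "t_asymp (\<lambda>z. c) (fps_const c)"
  unfolding t_asymp_def
proof
  fix M
  have "(\<Sum>i<M. fps_nth (fps_const c) i * tp z ^ i) = (if M = 0 then 0 else c)" for z
  proof -
    have "(\<Sum>i<M. fps_nth (fps_const c) i * tp z ^ i) = (\<Sum>i<M. if i = 0 then c else 0)"
      by (intro sum.cong) auto
    then show ?thesis by simp
  qed
  then show "t_bigo M (\<lambda>z. c - (\<Sum>i<M. fps_nth (fps_const c) i * tp z ^ i))"
    by (cases "M = 0") (auto simp: t_bigo_const)
qed

lemma t_asymp_mult:
  assumes f: "t_asymp f F" and g: "t_asymp g G" shows "t_asymp (\<lambda>z. f z * g z) (F * G)"
  unfolding t_asymp_def
proof
  fix M
  define p where "p = (\<Sum>i<M. monom (fps_nth F i) i)"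
  define r where "r = (\<Sum>i<M. monom (fps_nth G i) i)"
  have ev: "poly p x = (\<Sum>i<M. fps_nth F i * x ^ i)" "poly r x = (\<Sum>i<M. fps_nth G i * x ^ i)" for x
    by (simp_all add: p_def r_def poly_sum poly_monom)
  have co: "coeff p i = (if i < M then fps_nth F i else 0)" "coeff r i = (if i < M then fps_nth G i else 0)" for i
    by (simp_all add: p_def r_def coeff_sum)
  have low: "coeff (p * r) k = fps_nth (F * G) k" if "k < M" for k
    using that unfolding coeff_mult fps_mult_nth atLeast0AtMost by (intro sum.cong) (auto simp: co)
  have f0: "t_bigo 0 f" using f[unfolded t_asymp_def, rule_format, of 0] by simp
  have r0: "t_bigo 0 (\<lambda>z. poly r (tp z))" unfolding ev by (rule t_bigo_partial_sum)
  have 1: "t_bigo M (\<lambda>z. f z * (g z - poly r (tp z)))"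
    using t_bigo_mult[OF f0, of M "\<lambda>z. g z - poly r (tp z)"] g unfolding t_asymp_def ev by simp
  have 2: "t_bigo M (\<lambda>z. (f z - poly p (tp z)) * poly r (tp z))"
    using t_bigo_mult[OF _ r0, of M "\<lambda>z. f z - poly p (tp z)"] f unfolding t_asymp_def ev(1) by simp
  \<comment> \<open>\<open>N\<close> exceeds the degree of the product, so that everything from
    order M on is a finite sum of powers t^k with k >= M.\<close>
  define N where "N = max M (Suc (degree (p * r)))"
  have 3: "poly (p * r) x - (\<Sum>k<M. fps_nth (F * G) k * x ^ k) = (\<Sum>k\<in>{M..<N}. coeff (p * r) k * x ^ k)" for x
  proof -
    have "poly (p * r) x = (\<Sum>k<N. coeff (p * r) k * x ^ k)"
      unfolding poly_altdef by (rule sum.mono_neutral_left) (auto simp: N_def coeff_eq_0)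
    also have "\<dots> = (\<Sum>k<M. coeff (p * r) k * x ^ k) + (\<Sum>k\<in>{M..<N}. coeff (p * r) k * x ^ k)"
      by (subst sum.union_disjoint[symmetric]) (auto simp: N_def ivl_disj_un intro: sum.cong)
    finally show ?thesis using low by simp
  qed
  have "t_bigo M (\<lambda>z. \<Sum>k\<in>{M..<N}. coeff (p * r) k * tp z ^ k)"
    by (intro t_bigo_sum t_bigo_mono[OF t_bigo_cmult[OF t_bigo_t_power]]) auto
  then have "t_bigo M (\<lambda>z. (f z * (g z - poly r (tp z)) + (f z - poly p (tp z)) * poly r (tp z)) +
      (poly (p * r) (tp z) - (\<Sum>k<M. fps_nth (F * G) k * tp z ^ k)))"
    unfolding 3 by (intro t_bigo_add 1 2)
  then show "t_bigo M (\<lambda>z. f z * g z - (\<Sum>k<M. fps_nth (F * G) k * tp z ^ k))"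
    by (simp add: algebra_simps)
qed

lemma t_asymp_poly: "t_asymp f F \<Longrightarrow> t_asymp (\<lambda>z. poly p (f z)) (poly (map_poly fps_const p) F)"
proof (induction p)
  case 0
  then show ?case using t_asymp_const[of 0] by simp
next
  case (pCons a p)
  then show ?case
    using t_asymp_add[OF t_asymp_const[of a] t_asymp_mult[OF pCons.prems pCons.IH[OF pCons.prems]]]
    by (simp add: map_poly_pCons)
qed

text \<open>Convergence at a single t1 \<noteq> 0 bounds the terms a_i t1^i. For |t| < |t1| the tail
  from M on is then at most B (|t| / |t1|)^M, by the strong triangle inequality.\<close>

lemma has_t_expansion_imp_t_asymp:
  assumes "has_t_expansion \<iota> \<pi> f F" shows "t_asymp f F"
proof -
  obtain r where r: "r > 0" "\<And>z. r \<le> im z \<Longrightarrow> (\<lambda>i. fps_nth F i * tp z ^ i) sums f z"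
    using assms unfolding has_t_expansion_def by blast
  obtain z1 where z1: "r \<le> im z1" using exists_im_ge by blast
  define t1 where "t1 = tp z1"
  have t1: "t1 \<noteq> 0" using z1 r(1) unfolding t1_def by (intro t_param_nonzero) (auto simp: Omega_iff)
  obtain B where B: "0 \<le> B" "\<And>i. absv (fps_nth F i * t1 ^ i) \<le> B"
  proof -
    define S where "S = (\<lambda>n. \<Sum>i<n. fps_nth F i * t1 ^ i)"
    have S: "S \<longlonglongrightarrow> f z1" using r(2)[OF z1] unfolding sums_def S_def t1_def .
    have "(\<lambda>n. S (Suc n) - S n) \<longlonglongrightarrow> f z1 - f z1" by (intro lim_diff LIMSEQ_Suc S)
    then have "(\<lambda>i. fps_nth F i * t1 ^ i) \<longlonglongrightarrow> 0" by (simp add: S_def)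
    then have "(\<lambda>i. absv (fps_nth F i * t1 ^ i)) \<longlonglongrightarrow> absv (0::'c)" by (rule lim_absv)
    then have "Bseq (\<lambda>i. absv (fps_nth F i * t1 ^ i))" by (rule convergent_imp_Bseq[OF convergentI])
    then obtain B where "0 < B" "\<And>i. norm (absv (fps_nth F i * t1 ^ i)) \<le> B" unfolding Bseq_def by blast
    then show ?thesis by (intro that[of B]) auto
  qed
  show ?thesis unfolding t_asymp_def
  proof
    fix M
    have "\<forall>\<^sub>F z in near_infinity. r \<le> im z" unfolding eventually_near_infinity by blast
    moreover have "\<forall>\<^sub>F z in near_infinity. absv (tp z) < absv t1" using t1 by (intro eventually_t_param_small) simp
    ultimately have "\<forall>\<^sub>F z in near_infinity. absv (f z - (\<Sum>i<M. fps_nth F i * tp z ^ i)) \<le> (B / absv t1 ^ M) * absv (tp z) ^ M"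
    proof eventually_elim
      case (elim z)
      define u where "u = absv (tp z) / absv t1"
      have u: "0 \<le> u" "u \<le> 1" using elim t1 by (auto simp: u_def divide_le_eq)
      have tm: "absv (fps_nth F i * tp z ^ i) \<le> B * u ^ M" if "i \<ge> M" for i
      proof -
        have "absv (fps_nth F i * tp z ^ i) = absv (fps_nth F i * t1 ^ i) * u ^ i"
          using t1 by (simp add: u_def absv_mult absv_power power_divide)
        also have "\<dots> \<le> B * u ^ M"
          using B u that by (intro mult_mono power_decreasing) auto
        finally show ?thesis .
      qed
      have "(\<lambda>n. (\<Sum>i<n. fps_nth F i * tp z ^ i) - (\<Sum>i<M. fps_nth F i * tp z ^ i)) \<longlonglongrightarrow> f z - (\<Sum>i<M. fps_nth F i * tp z ^ i)"
        using r(2)[OF elim(1)] unfolding sums_def by (intro lim_diff tendsto_const)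
      moreover have "\<forall>\<^sub>F n in sequentially. absv ((\<Sum>i<n. fps_nth F i * tp z ^ i) - (\<Sum>i<M. fps_nth F i * tp z ^ i)) \<le> B * u ^ M"
        unfolding eventually_sequentially
      proof (intro exI[of _ M] allI impI)
        fix n assume "M \<le> n"
        then have e: "(\<Sum>i<n. fps_nth F i * tp z ^ i) - (\<Sum>i<M. fps_nth F i * tp z ^ i) = (\<Sum>i\<in>{M..<n}. fps_nth F i * tp z ^ i)"
          by (subst sum_diff[symmetric]) (auto intro!: sum.cong)
        show "absv ((\<Sum>i<n. fps_nth F i * tp z ^ i) - (\<Sum>i<M. fps_nth F i * tp z ^ i)) \<le> B * u ^ M"
          unfolding e using B(1) u(1) tm by (intro absv_sum_le) auto
      qed
      ultimately have "absv (f z - (\<Sum>i<M. fps_nth F i * tp z ^ i)) \<le> B * u ^ M"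
        by (intro absv_le_lim[where F = sequentially]) auto
      then show ?case by (simp add: u_def power_divide)
    qed
    then show "t_bigo M (\<lambda>z. f z - (\<Sum>i<M. fps_nth F i * tp z ^ i))"
      using B(1) by (intro t_bigoI[of "B / absv t1 ^ M"]) auto
  qed
qed

lemma t_expansion_eq: "has_t_expansion \<iota> \<pi> f F \<Longrightarrow> t_expansion \<iota> \<pi> f = F"
  unfolding t_expansion_def using has_t_expansion_imp_t_asymp t_asymp_unique by (intro the_equality) blast+

end

subsection \<open>Expansions of the Goss functions\<close>

lemma A_plus_nonzero: "a \<in> A_plus \<Longrightarrow> a \<noteq> 0"
  by (auto simp: A_plus_def)

context carlitz_setting
begin

text \<open>This is the Carlitz module, built by Horner's scheme: the polynomial for u + T a is u X
  + \<theta> \<rho>_a + \<rho>_a^q, by the functional equation of the exponential. For nonzero a the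
  q-th power has the largest degree.\<close>

lemma carlitz_action_exists:
  "\<exists>\<rho>. (\<forall>z. cexp (\<pi> * (emb a * z)) = poly \<rho> (cexp (\<pi> * z))) \<and>
       (a \<noteq> 0 \<longrightarrow> degree \<rho> = CARD('q) ^ degree a \<and> lead_coeff \<rho> = const_emb (lead_coeff a))"
proof (induction a)
  case 0
  then show ?case by (intro exI[of _ 0]) simp
next
  case (pCons u a)
  show ?case
  proof (cases "a = 0")
    case True
    then have "u \<noteq> 0" using pCons.hyps by simp
    have "cexp (\<pi> * (emb (pCons u a) * z)) = poly [:0, const_emb u:] (cexp (\<pi> * z))" for z
      using True cexp_const_mult[of u "\<pi> * z"] by (simp add: mult_ac)
    then show ?thesis using True \<open>u \<noteq> 0\<close> by (intro exI[of _ "[:0, const_emb u:]"]) simp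
  next
    case False
    then obtain \<rho> where \<rho>: "\<And>z. cexp (\<pi> * (emb a * z)) = poly \<rho> (cexp (\<pi> * z))"
        "degree \<rho> = CARD('q) ^ degree a" "lead_coeff \<rho> = const_emb (lead_coeff a)"
      using pCons.IH by blast
    have d1: "1 \<le> degree \<rho>" by (simp add: \<rho>(2) Suc_le_eq)
    have dq: "degree (\<rho> ^ CARD('q)) = CARD('q) * degree \<rho>" by (rule degree_power_eq) (use d1 in auto)
    have "degree ([:0, const_emb u:] + smult \<theta> \<rho>) \<le> degree \<rho>"
      using d1 by (intro degree_add_le) (auto intro: order.trans[OF degree_pCons_le])
    moreover have "degree \<rho> < degree (\<rho> ^ CARD('q))"
      unfolding dq using d1 card_field_ge_2[where 'q='q] by simp
    ultimately have less: "degree ([:0, const_emb u:] + smult \<theta> \<rho>) < degree (\<rho> ^ CARD('q))" by linarith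
    define r where "r = ([:0, const_emb u:] + smult \<theta> \<rho>) + \<rho> ^ CARD('q)"
    have "cexp (\<pi> * (emb (pCons u a) * z)) = poly r (cexp (\<pi> * z))" for z
    proof -
      have "\<pi> * (emb (pCons u a) * z) = const_emb u * (\<pi> * z) + \<theta> * (\<pi> * (emb a * z))"
        by (simp add: algebra_simps)
      then show ?thesis
        by (simp add: cexp_add cexp_const_mult cexp_\<theta>_mult \<rho>(1) r_def)
    qed
    moreover have "degree r = CARD('q) ^ degree (pCons u a)"
      unfolding r_def degree_add_eq_right[OF less] dq using False by (simp add: \<rho>(2))
    moreover have "lead_coeff r = const_emb (lead_coeff (pCons u a))"
      unfolding r_def lead_coeff_add_le[OF less] lead_coeff_power \<rho>(3) using False by simp
    ultimately show ?thesis by blast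
  qed
qed

text \<open>t(az) = 1 / \<rho>_a(1/t), and B is \<rho>_a with its coefficients reversed; the
  constant term of B is the leading coefficient of a, hence 1 for monic a.\<close>

lemma t_param_emb_mult:
  assumes "a \<in> A_plus"
  obtains B where "coeff B 0 = 1"
    "\<And>z. z \<in> Omega \<iota> \<Longrightarrow> tp (emb a * z) = tp z ^ (CARD('q) ^ degree a) / poly B (tp z)"
proof -
  obtain \<rho> where \<rho>: "\<And>z. cexp (\<pi> * (emb a * z)) = poly \<rho> (cexp (\<pi> * z))"
      "degree \<rho> = CARD('q) ^ degree a" "lead_coeff \<rho> = const_emb (lead_coeff a)"
    using carlitz_action_exists[of a] A_plus_nonzero[OF assms] by blast
  have "tp (emb a * z) = tp z ^ (CARD('q) ^ degree a) / poly (reflect_poly \<rho>) (tp z)" if "z \<in> Omega \<iota>" for z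
    using t_param_nonzero[OF that] cexp_nonzero[OF that]
    by (simp add: poly_reflect_poly_nz \<rho>(2)) (simp add: t_param_def \<rho>(1))
  moreover have "coeff (reflect_poly \<rho>) 0 = 1"
    using assms by (simp add: \<rho>(3) A_plus_def embed_one)
  ultimately show ?thesis using that by blast
qed

lemma coeff_bound_exists: "\<exists>C\<ge>1. \<forall>i. absv (coeff (p :: 'c poly) i) \<le> C"
proof -
  define C where "C = Max (insert 1 ((\<lambda>i. absv (coeff p i)) ` {..degree p}))"
  have "absv (coeff p i) \<le> C" for i
  proof (cases "i \<le> degree p")
    case True
    then show ?thesis unfolding C_def by (intro Max_ge) auto
  next
    case False
    then have "coeff p i = 0" by (simp add: coeff_eq_0)
    moreover have "1 \<le> C" unfolding C_def by (intro Max_ge) auto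
    ultimately show ?thesis by simp
  qed
  moreover have "1 \<le> C" unfolding C_def by (intro Max_ge) auto
  ultimately show ?thesis by blast
qed

lemma absv_poly_eq_1:
  assumes B: "coeff B 0 = 1" and C: "C \<ge> 1" "\<And>i. absv (coeff B i) \<le> C" and x: "absv (x::'c) < 1 / C"
  shows "absv (poly B x) = 1"
proof -
  obtain B' where B': "B = pCons 1 B'" using B by (cases B) auto
  have x1: "absv x < 1" using x C by (smt (verit) divide_le_eq_1)
  have "absv (poly B' x) \<le> C"
    unfolding poly_altdef
  proof (rule absv_sum_le)
    fix i
    have "absv (coeff B' i * x ^ i) \<le> C * 1"
      unfolding absv_mult absv_power using C(2)[of "Suc i"] x1 C(1)
      by (intro mult_mono power_le_one) (auto simp: B')
    then show "absv (coeff B' i * x ^ i) \<le> C" by simp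
  qed (use C in simp)
  then have "absv (x * poly B' x) \<le> absv x * C" by (simp add: absv_mult mult_left_mono)
  also have "\<dots> < 1" using x C by (simp add: field_simps)
  finally show ?thesis by (simp add: B' absv_add_eq)
qed

text \<open>By the recursion for a reciprocal series, the coefficients of 1/B are at most C^n if C
  >= 1 bounds those of B; so the series converges for |t| < 1/C.\<close>

lemma has_t_expansion_inverse:
  assumes B: "coeff B 0 = 1" and f: "\<And>z. z \<in> Omega \<iota> \<Longrightarrow> f z = tp z ^ N / poly B (tp z)"
  shows "has_t_expansion \<iota> \<pi> f (fps_X ^ N * inverse (fps_of_poly B))"
proof -
  obtain C where C: "C \<ge> 1" "\<And>i. absv (coeff B i) \<le> C" using coeff_bound_exists[of B] by blast
  define I where "I = inverse (fps_of_poly B)"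
  have BI: "fps_of_poly B * I = 1" unfolding I_def using B by (intro inverse_mult_eq_1') simp
  have I: "absv (fps_nth I n) \<le> C ^ n" for n
  proof (induction n rule: less_induct)
    case (less n)
    show ?case
    proof (cases n)
      case 0
      then show ?thesis using B by (simp add: I_def)
    next
      case (Suc n')
      have "0 = fps_nth (fps_of_poly B * I) n" using BI Suc by simp
      also have "\<dots> = fps_nth I n + (\<Sum>i=1..n. coeff B i * fps_nth I (n - i))"
        unfolding fps_mult_nth by (subst sum.atLeast_Suc_atMost) (auto simp: B)
      finally have "fps_nth I n = - (\<Sum>i=1..n. coeff B i * fps_nth I (n - i))"
        by (simp add: eq_neg_iff_add_eq_0)
      moreover have "absv (\<Sum>i=1..n. coeff B i * fps_nth I (n - i)) \<le> C ^ n"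
      proof (rule absv_sum_le)
        fix i assume i: "i \<in> {1..n}"
        then have "absv (coeff B i) * absv (fps_nth I (n - i)) \<le> C * C ^ (n - i)"
          using C less[of "n - i"] by (intro mult_mono) auto
        also have "\<dots> = C ^ Suc (n - i)" by simp
        also have "\<dots> \<le> C ^ n" using C i by (intro power_increasing) auto
        finally show "absv (coeff B i * fps_nth I (n - i)) \<le> C ^ n" by (simp add: absv_mult)
      qed (use C in simp)
      ultimately show ?thesis by simp
    qed
  qed
  obtain r where r: "r \<ge> 1" "\<And>z. r \<le> im z \<Longrightarrow> absv (tp z) < 1 / C"
    using t_param_small[of "1 / C"] C by auto
  have "(\<lambda>i. fps_nth (fps_X ^ N * I) i * tp z ^ i) sums f z" if z: "r \<le> im z" for z
  proof -
    define x where "x = tp z"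
    have x: "absv x < 1 / C" using r z by (simp add: x_def)
    then have x1: "C * absv x < 1" using C by (simp add: field_simps)
    have zO: "z \<in> Omega \<iota>" using z r by (simp add: Omega_iff)
    have Bx: "absv (poly B x) = 1" by (rule absv_poly_eq_1[OF B C x])
    define S where "S = (\<lambda>n. \<Sum>i<n. fps_nth I i * x ^ i)"
    \<comment> \<open>The product of B with the truncation \<open>S n\<close> differs from 1 only in
      degrees k >= n, with coefficients at most C^k.\<close>
    have bnd: "absv (poly B x * S n - 1) \<le> (C * absv x) ^ n" if "n > 0" for n
    proof -
      define p where "p = (\<Sum>i<n. monom (fps_nth I i) i)"
      have px: "poly p x = S n" by (simp add: p_def S_def poly_sum poly_monom)
      have co: "coeff p i = (if i < n then fps_nth I i else 0)" for i
        by (simp add: p_def coeff_sum)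
      have low: "coeff (B * p - 1) k = 0" if "k < n" for k
      proof -
        have "coeff (B * p) k = fps_nth (fps_of_poly B * I) k"
          using that unfolding coeff_mult fps_mult_nth atLeast0AtMost by (intro sum.cong) (auto simp: co)
        then show ?thesis by (simp add: BI coeff_1)
      qed
      have bd: "absv (coeff (B * p - 1) k) \<le> C ^ k" if "n \<le> k" for k
      proof -
        have "absv (coeff (B * p) k) \<le> C ^ k"
          unfolding coeff_mult
        proof (rule absv_sum_le)
          fix i assume i: "i \<in> {..k}"
          show "absv (coeff B i * coeff p (k - i)) \<le> C ^ k"
          proof (cases "i = 0")
            case True
            then show ?thesis using I[of k] C by (simp add: co B)
          next
            case False
            have "absv (coeff B i) * absv (coeff p (k - i)) \<le> C * C ^ (k - i)"
              using C I[of "k - i"] by (intro mult_mono) (auto simp: co)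
            also have "\<dots> = C ^ Suc (k - i)" by simp
            also have "\<dots> \<le> C ^ k" using C i False by (intro power_increasing) auto
            finally show ?thesis by (simp add: absv_mult)
          qed
        qed (use C in simp)
        then show ?thesis using that \<open>n > 0\<close> by (simp add: coeff_1)
      qed
      have e: "poly B x * S n - 1 = poly (B * p - 1) x" by (simp add: px)
      have "absv (poly (B * p - 1) x) \<le> (C * absv x) ^ n"
        unfolding poly_altdef
      proof (rule absv_sum_le)
        fix k
        show "absv (coeff (B * p - 1) k * x ^ k) \<le> (C * absv x) ^ n"
        proof (cases "k < n")
          case True
          then show ?thesis unfolding low[OF True] using C by simp
        next
          case False
          have "absv (coeff (B * p - 1) k) * absv x ^ k \<le> C ^ k * absv x ^ k"
            using bd[of k] False by (intro mult_right_mono) auto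
          also have "\<dots> = (C * absv x) ^ k" by (simp add: power_mult_distrib)
          also have "\<dots> \<le> (C * absv x) ^ n" using x1 C False by (intro power_decreasing) auto
          finally show ?thesis by (simp add: absv_mult absv_power)
        qed
      qed (use C in simp)
      then show ?thesis unfolding e .
    qed
    have lim0: "(\<lambda>n. (C * absv x) ^ n) \<longlonglongrightarrow> 0" using x1 C by (intro LIMSEQ_realpow_zero) auto
    have "(\<lambda>n. absv (poly B x * S n - 1)) \<longlonglongrightarrow> 0"
    proof (rule Lim_null_comparison[OF _ lim0])
      show "\<forall>\<^sub>F n in sequentially. norm (absv (poly B x * S n - 1)) \<le> (C * absv x) ^ n"
        unfolding eventually_sequentially using bnd by (intro exI[of _ 1]) simp
    qed
    then have "(\<lambda>n. poly B x * S n) \<longlonglongrightarrow> 1" by (simp add: lim_cong_absv)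
    from lim_cmult[OF this, of "x ^ N / poly B x"]
    have "(\<lambda>n. x ^ N * S n) \<longlonglongrightarrow> f z"
      using Bx by (cases "poly B x = 0") (auto simp: f[OF zO] x_def)
    moreover have "(\<Sum>i<n + N. fps_nth (fps_X ^ N * I) i * x ^ i) = x ^ N * S n" for n
    proof -
      have "(\<Sum>i<n + N. fps_nth (fps_X ^ N * I) i * x ^ i) = (\<Sum>i\<in>{N..<n + N}. fps_nth I (i - N) * x ^ i)"
        by (rule sum.mono_neutral_cong_right) (auto simp: fps_X_power_mult_nth)
      also have "\<dots> = (\<Sum>i<n. fps_nth I i * x ^ (i + N))"
        using sum.shift_bounds_nat_ivl[of "\<lambda>i. fps_nth I (i - N) * x ^ i" 0 N n] by (simp add: atLeast0LessThan)
      finally show ?thesis by (simp add: S_def sum_distrib_left power_add mult_ac)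
    qed
    ultimately have "(\<lambda>n. \<Sum>i<n + N. fps_nth (fps_X ^ N * I) i * x ^ i) \<longlonglongrightarrow> f z" by simp
    then show ?thesis unfolding sums_def x_def by (rule LIMSEQ_offset)
  qed
  then show ?thesis using r(1) unfolding has_t_expansion_def I_def by (intro exI[of _ r]) auto
qed

lemma t_asymp_t_param_emb_mult:
  assumes "a \<in> A_plus"
  shows "t_asymp (\<lambda>z. tp (emb a * z)) (t_expansion \<iota> \<pi> (\<lambda>z. tp (emb a * z)))"
proof -
  obtain B where "coeff B 0 = 1"
    "\<And>z. z \<in> Omega \<iota> \<Longrightarrow> tp (emb a * z) = tp z ^ (CARD('q) ^ degree a) / poly B (tp z)"
    using t_param_emb_mult[OF assms] by blast
  from has_t_expansion_inverse[OF this] show ?thesis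
    using has_t_expansion_imp_t_asymp t_expansion_eq by metis
qed

lemma eventually_absv_t_param_emb_mult:
  assumes "a \<in> A_plus"
  shows "\<forall>\<^sub>F z in near_infinity. absv (tp (emb a * z)) = absv (tp z) ^ (CARD('q) ^ degree a)"
proof -
  obtain B where B: "coeff B 0 = 1"
    "\<And>z. z \<in> Omega \<iota> \<Longrightarrow> tp (emb a * z) = tp z ^ (CARD('q) ^ degree a) / poly B (tp z)"
    using t_param_emb_mult[OF assms] by blast
  obtain C where C: "C \<ge> 1" "\<And>i. absv (coeff B i) \<le> C" using coeff_bound_exists[of B] by blast
  have "1 / C > 0" using C by simp
  from eventually_t_param_small[OF this] eventually_Omega show ?thesis
  proof eventually_elim
    case (elim z)
    then show ?case using absv_poly_eq_1[OF B(1) C elim(1)] by (simp add: B(2) absv_divide absv_power)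
  qed
qed

definition goss_fun :: "nat \<Rightarrow> 'q poly \<Rightarrow> 'c \<Rightarrow> 'c" where
  "goss_fun n a z = poly (goss n) (tp (emb a * z))"

lemma t_asymp_goss_fun: "n > 0 \<Longrightarrow> a \<in> A_plus \<Longrightarrow> t_asymp (goss_fun n a) (goss_t \<iota> \<pi> n a)"
  using t_asymp_poly[OF t_asymp_t_param_emb_mult, of a "goss n"]
  by (simp add: goss_t_def goss_poly_eq goss_fun_def[abs_def])

text \<open>G_n has no constant term, so G_n(t_a) is bounded by a multiple of t_a, whose absolute
  value is |t|^(q^deg a).\<close>

lemma t_bigo_goss_fun:
  assumes a: "a \<in> A_plus" shows "t_bigo (CARD('q) ^ degree a) (goss_fun n a)"
proof -
  obtain p where p: "goss n = pCons 0 p"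
    using goss_0_eq_0[of n] by (cases "goss n") auto
  obtain C where C: "C \<ge> 1" "\<And>i. absv (coeff p i) \<le> C" using coeff_bound_exists[of p] by blast
  have "\<forall>\<^sub>F z in near_infinity. absv (tp (emb a * z)) < 1"
    by (intro eventually_near_infinity_mult eventually_t_param_small) (use A_plus_nonzero[OF a] in auto)
  with eventually_absv_t_param_emb_mult[OF a]
  have "\<forall>\<^sub>F z in near_infinity. absv (goss_fun n a z) \<le> C * absv (tp z) ^ (CARD('q) ^ degree a)"
  proof eventually_elim
    case (elim z)
    define y where "y = tp (emb a * z)"
    have "absv (poly p y) \<le> C" unfolding poly_altdef
    proof (rule absv_sum_le)
      fix i
      have "absv (coeff p i * y ^ i) \<le> C * 1"
        unfolding absv_mult absv_power using C elim by (intro mult_mono power_le_one) (auto simp: y_def)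
      then show "absv (coeff p i * y ^ i) \<le> C" by simp
    qed (use C in simp)
    then have "absv (goss_fun n a z) \<le> absv y * C"
      by (simp add: goss_fun_def p absv_mult mult_left_mono flip: y_def)
    then show ?case using elim by (simp add: y_def mult.commute)
  qed
  then show ?thesis using C by (intro t_bigoI[of C]) auto
qed

definition monic_lt :: "nat \<Rightarrow> 'q poly set" where
  "monic_lt D = A_plus \<inter> polys_lt D"

lemma finite_monic_lt [simp]: "finite (monic_lt D)"
  by (simp add: monic_lt_def)

lemma monic_lt_iff: "a \<in> monic_lt D \<longleftrightarrow> a \<in> A_plus \<and> degree a < D"
  using A_plus_nonzero by (auto simp: monic_lt_def polys_lt_def)

lemma goss_t_nth_eq_0:
  assumes "n > 0" "a \<in> A_plus" "i < CARD('q) ^ degree a" shows "fps_nth (goss_t \<iota> \<pi> n a) i = 0"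
  using t_asymp_coeff_zero[OF t_asymp_goss_fun t_bigo_goss_fun] assms by blast

text \<open>t-adically, each coefficient of the partial sums is eventually constant along finite
  sets. Such a set may be enlarged by \<open>monic_lt D\<close>, and its members of degree at least
  D have order at least q^D > i.\<close>

lemma A_expansion_coeff:
  assumes n: "n > 0" and A: "has_A_expansion \<iota> \<pi> n c0 c f" and i: "i < CARD('q) ^ D"
  shows "fps_nth (t_expansion \<iota> \<pi> f - fps_const c0) i = (\<Sum>a\<in>monic_lt D. c a * fps_nth (goss_t \<iota> \<pi> n a) i)"
proof -
  define P where "P = (\<lambda>Y. fps_nth (\<Sum>a\<in>Y. fps_const (c a) * goss_t \<iota> \<pi> n a) i =
      fps_nth (t_expansion \<iota> \<pi> f - fps_const c0) i)"
  have "eventually P (finite_subsets_at_top A_plus)"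
    using A unfolding has_A_expansion_def has_sum_def tendsto_fps_iff P_def by blast
  then have "\<exists>X. finite X \<and> X \<subseteq> A_plus \<and> (\<forall>Y. finite Y \<and> X \<subseteq> Y \<and> Y \<subseteq> A_plus \<longrightarrow> P Y)"
    by (simp only: eventually_finite_subsets_at_top)
  then obtain X where X': "finite X \<and> X \<subseteq> A_plus \<and> (\<forall>Y. finite Y \<and> X \<subseteq> Y \<and> Y \<subseteq> A_plus \<longrightarrow> P Y)"
    by (rule exE)
  then have X: "finite X" "X \<subseteq> A_plus" by auto
  have XY: "P Y" if "finite Y" "X \<subseteq> Y" "Y \<subseteq> A_plus" for Y
    using X' that by (metis (no_types))
  have "fps_nth (t_expansion \<iota> \<pi> f - fps_const c0) i =
      fps_nth (\<Sum>a\<in>X \<union> monic_lt D. fps_const (c a) * goss_t \<iota> \<pi> n a) i"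
    using XY[of "X \<union> monic_lt D"] X by (auto simp: monic_lt_def P_def)
  also have "\<dots> = (\<Sum>a\<in>X \<union> monic_lt D. c a * fps_nth (goss_t \<iota> \<pi> n a) i)"
    by (simp add: fps_sum_nth)
  also have "\<dots> = (\<Sum>a\<in>monic_lt D. c a * fps_nth (goss_t \<iota> \<pi> n a) i)"
  proof (rule sum.mono_neutral_right)
    show "\<forall>a\<in>X \<union> monic_lt D - monic_lt D. c a * fps_nth (goss_t \<iota> \<pi> n a) i = 0"
    proof
      fix a assume "a \<in> X \<union> monic_lt D - monic_lt D"
      then have a: "a \<in> A_plus" "D \<le> degree a" using X by (auto simp: monic_lt_iff)
      have "CARD('q) ^ D \<le> CARD('q) ^ degree a" using a by (intro power_increasing) auto
      then show "c a * fps_nth (goss_t \<iota> \<pi> n a) i = 0" using goss_t_nth_eq_0[OF n a(1)] i by simp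
    qed
  qed (use X in auto)
  finally show ?thesis .
qed

text \<open>The passage from the formal identity to functions: the truncated A-expansion leaves a
  remainder of order q^D, the order guaranteed for the first omitted terms.\<close>

lemma A_expansion_bigt:
  assumes n: "n > 0" and A: "has_A_expansion \<iota> \<pi> n c0 c f" and f: "t_asymp f (t_expansion \<iota> \<pi> f)"
  shows "t_bigo (CARD('q) ^ D) (\<lambda>z. f z - (c0 + (\<Sum>a\<in>monic_lt D. c a * goss_fun n a z)))"
proof -
  define M where "M = CARD('q) ^ D"
  define F where "F = t_expansion \<iota> \<pi> f"
  have M: "M > 0" by (simp add: M_def)
  have co: "(\<Sum>i<M. fps_nth F i * x ^ i) = c0 + (\<Sum>a\<in>monic_lt D. c a * (\<Sum>i<M. fps_nth (goss_t \<iota> \<pi> n a) i * x ^ i))" for x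
  proof -
    have "(\<Sum>i<M. fps_nth F i * x ^ i) = (\<Sum>i<M. fps_nth (fps_const c0) i * x ^ i) + (\<Sum>i<M. fps_nth (F - fps_const c0) i * x ^ i)"
      by (simp add: algebra_simps flip: sum.distrib)
    also have "(\<Sum>i<M. fps_nth (fps_const c0) i * x ^ i) = (\<Sum>i<M. if i = 0 then c0 else 0)"
      by (intro sum.cong) auto
    also have "\<dots> = c0" using M by simp
    also have "(\<Sum>i<M. fps_nth (F - fps_const c0) i * x ^ i) = (\<Sum>i<M. (\<Sum>a\<in>monic_lt D. c a * fps_nth (goss_t \<iota> \<pi> n a) i) * x ^ i)"
      using A_expansion_coeff[OF n A] by (intro sum.cong refl arg_cong2[where f = "(*)"]) (auto simp: M_def F_def)
    also have "\<dots> = (\<Sum>a\<in>monic_lt D. c a * (\<Sum>i<M. fps_nth (goss_t \<iota> \<pi> n a) i * x ^ i))"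
      unfolding sum_distrib_right sum_distrib_left by (subst sum.swap) (simp add: mult_ac)
    finally show ?thesis .
  qed
  have "t_bigo M (\<lambda>z. \<Sum>a\<in>monic_lt D. c a * (goss_fun n a z - (\<Sum>i<M. fps_nth (goss_t \<iota> \<pi> n a) i * tp z ^ i)))"
  proof (rule t_bigo_sum)
    fix a assume "a \<in> monic_lt D"
    then have "t_asymp (goss_fun n a) (goss_t \<iota> \<pi> n a)" using t_asymp_goss_fun[OF n] by (simp add: monic_lt_iff)
    from t_bigo_cmult[OF this[unfolded t_asymp_def, rule_format, of M]]
    show "t_bigo M (\<lambda>z. c a * (goss_fun n a z - (\<Sum>i<M. fps_nth (goss_t \<iota> \<pi> n a) i * tp z ^ i)))" .
  qed
  from t_bigo_diff[OF f[unfolded t_asymp_def, rule_format, of M] this]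
  show ?thesis
    unfolding F_def[symmetric] co M_def[symmetric]
    by (simp add: algebra_simps sum_subtractf)
qed

end

subsection \<open>Hecke operators and uniqueness of A-expansions\<close>

lemma one_in_A_plus [simp]: "1 \<in> A_plus"
  by (simp add: A_plus_def)

lemma A_plus_mult: "a \<in> A_plus \<Longrightarrow> b \<in> A_plus \<Longrightarrow> a * b \<in> A_plus"
  by (simp add: A_plus_def lead_coeff_mult)

lemma A_plus_mult_cancel: "a \<in> A_plus \<Longrightarrow> a * b \<in> A_plus \<Longrightarrow> b \<in> A_plus"
  by (simp add: A_plus_def lead_coeff_mult)

lemma A_plus_degree_0: "a \<in> A_plus \<Longrightarrow> degree a = 0 \<Longrightarrow> a = 1"
  by (auto simp: A_plus_def one_pCons elim!: degree_eq_zeroE)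

lemma monic_primesD:
  assumes "\<pp> \<in> monic_primes"
  shows "\<pp> \<in> A_plus" "prime_elem \<pp>" "0 < degree \<pp>" "\<pp> \<noteq> 0"
proof -
  show p: "\<pp> \<in> A_plus" "prime_elem \<pp>" using assms by (auto simp: monic_primes_def A_plus_def)
  then show "\<pp> \<noteq> 0" by auto
  show "0 < degree \<pp>"
  proof (rule ccontr)
    assume "\<not> 0 < degree \<pp>"
    then have 1: "\<pp> = 1" using A_plus_degree_0[OF p(1)] by simp
    show False using p(2) unfolding 1 by (simp add: prime_elem_def)
  qed
qed

text \<open>A monic divisor of least positive degree is irreducible, since a proper factor, made
  monic, would have smaller degree.\<close>

lemma monic_prime_divisor_exists:
  fixes x :: "'q::field poly"
  assumes x: "x \<in> A_plus" and d: "0 < degree x"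
  obtains \<pp> where "\<pp> \<in> monic_primes" "\<pp> dvd x"
proof -
  define P where "P = (\<lambda>p. p \<in> A_plus \<and> 0 < degree p \<and> p dvd x)"
  have "P x" using assms by (simp add: P_def)
  then obtain p where p: "P p" and min: "\<And>r. P r \<Longrightarrow> degree p \<le> degree r"
    by (metis ex_has_least_nat)
  have "irreducible p"
  proof (rule irreducibleI)
    show "p \<noteq> 0" using p by (auto simp: P_def)
    show "\<not> p dvd 1" using p by (auto simp: P_def is_unit_poly_iff)
    fix a b assume ab: "p = a * b"
    then have nz: "a \<noteq> 0" "b \<noteq> 0" using \<open>p \<noteq> 0\<close> by auto
    show "a dvd 1 \<or> b dvd 1"
    proof (rule ccontr)
      assume "\<not> (a dvd 1 \<or> b dvd 1)"
      then have deg: "0 < degree a" "0 < degree b" using nz by (auto simp: is_unit_iff_degree)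
      have "P (smult (1 / lead_coeff a) a)"
        unfolding P_def
      proof (intro conjI)
        have "a dvd p" by (simp add: ab)
        then show "smult (1 / lead_coeff a) a dvd x"
          using nz p by (auto simp: P_def smult_dvd_iff intro: dvd_trans)
      qed (use nz deg in \<open>auto simp: A_plus_def\<close>)
      from min[OF this] show False using deg nz by (simp add: ab degree_mult_eq)
    qed
  qed
  then have "prime_elem p" by (rule field_poly_irreducible_imp_prime)
  then show ?thesis using p that by (auto simp: P_def monic_primes_def A_plus_def)
qed

context C_infty
begin

lemma has_sum_cmult_C: "(h has_sum (s::'c)) S \<Longrightarrow> ((\<lambda>x. c * h x) has_sum c * s) S"
  unfolding has_sum_def sum_distrib_left[symmetric] by (rule lim_cmult)

lemma has_sum_Un_disjoint_C:
  assumes "(h has_sum (s::'c)) A" "(h has_sum s') B" "A \<inter> B = {}"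
  shows "(h has_sum (s + s')) (A \<union> B)"
  unfolding has_sum_absv_iff
proof (intro allI impI)
  fix \<epsilon> :: real assume \<epsilon>: "\<epsilon> > 0"
  from assms(1)[unfolded has_sum_absv_iff, rule_format, OF \<epsilon>]
  obtain X where X: "finite X \<and> X \<subseteq> A \<and> (\<forall>Y. finite Y \<and> X \<subseteq> Y \<and> Y \<subseteq> A \<longrightarrow> absv (sum h Y - s) < \<epsilon>)"
    by (rule exE)
  from assms(2)[unfolded has_sum_absv_iff, rule_format, OF \<epsilon>]
  obtain X' where X': "finite X' \<and> X' \<subseteq> B \<and> (\<forall>Y. finite Y \<and> X' \<subseteq> Y \<and> Y \<subseteq> B \<longrightarrow> absv (sum h Y - s') < \<epsilon>)"
    by (rule exE)
  have "absv (sum h Y - (s + s')) < \<epsilon>" if Y: "finite Y" "X \<union> X' \<subseteq> Y" "Y \<subseteq> A \<union> B" for Y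
  proof -
    have "Y = (Y \<inter> A) \<union> (Y \<inter> B)" "(Y \<inter> A) \<inter> (Y \<inter> B) = {}" using Y assms(3) by auto
    then have "sum h Y = sum h (Y \<inter> A) + sum h (Y \<inter> B)"
      using Y(1) by (metis finite_Int sum.union_disjoint)
    then have e: "sum h Y - (s + s') = (sum h (Y \<inter> A) - s) + (sum h (Y \<inter> B) - s')" by simp
    have "absv (sum h (Y \<inter> A) - s) < \<epsilon>" "absv (sum h (Y \<inter> B) - s') < \<epsilon>"
      using Y X X' by auto
    then show ?thesis unfolding e
      using absv_add[of "sum h (Y \<inter> A) - s" "sum h (Y \<inter> B) - s'"] by linarith
  qed
  then show "\<exists>X. finite X \<and> X \<subseteq> A \<union> B \<and> (\<forall>Y. finite Y \<and> X \<subseteq> Y \<and> Y \<subseteq> A \<union> B \<longrightarrow> absv (sum h Y - (s + s')) < \<epsilon>)"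
    using X X' by (intro exI[of _ "X \<union> X'"]) auto
qed

lemma has_sum_UN_disjoint_C:
  assumes "finite I" "\<And>i. i \<in> I \<Longrightarrow> (h has_sum (s i :: 'c)) (A i)"
    "\<And>i j. i \<in> I \<Longrightarrow> j \<in> I \<Longrightarrow> i \<noteq> j \<Longrightarrow> A i \<inter> A j = {}"
  shows "(h has_sum (\<Sum>i\<in>I. s i)) (\<Union>i\<in>I. A i)"
  using assms
proof (induction I rule: finite_induct)
  case (insert i I)
  have "(h has_sum (s i + (\<Sum>i\<in>I. s i))) (A i \<union> (\<Union>i\<in>I. A i))"
  proof (rule has_sum_Un_disjoint_C)
    show "A i \<inter> \<Union> (A ` I) = {}" using insert.hyps insert.prems(2)[of i] by auto
  qed (use insert in auto)
  then show ?case using insert.hyps by simp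
qed simp

end

context carlitz_setting
begin

section \<open>Hecke sums of Goss functions\<close>

lemma t_param_periodic: "tp (z + emb a) = tp z"
  by (simp add: t_param_def cexp_periodic)

lemma Omega_emb_mult: "z \<in> Omega \<iota> \<Longrightarrow> a \<noteq> 0 \<Longrightarrow> emb a * z \<in> Omega \<iota>"
  using absv_emb_ge_1[of a] by (simp add: Omega_iff im_emb_mult)

lemma Omega_emb_divide: "z \<in> Omega \<iota> \<Longrightarrow> a \<noteq> 0 \<Longrightarrow> (z + emb b) / emb a \<in> Omega \<iota>"
  using absv_emb_ge_1[of a] by (simp add: Omega_iff im_emb_divide im_emb_add)

text \<open>The second part of the Hecke operator, the analogue of Atkin's U_p. Summing over
  \<open>polys_lt\<close> gives access to its cardinality q^deg \<pp>; this agrees with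
  \<open>hecke\<close> because primes have positive degree.\<close>

definition hecke_sum :: "'q poly \<Rightarrow> ('c \<Rightarrow> 'c) \<Rightarrow> 'c \<Rightarrow> 'c" where
  "hecke_sum \<pp> \<phi> z = (\<Sum>\<beta>\<in>polys_lt (degree \<pp>). \<phi> ((z + emb \<beta>) / emb \<pp>))"

lemma hecke_eq:
  "\<pp> \<in> monic_primes \<Longrightarrow> hecke \<iota> k \<pp> f z = emb \<pp> powi k * f (emb \<pp> * z) + hecke_sum \<pp> f z"
  using monic_primesD(3)[of \<pp>] by (simp add: hecke_def hecke_sum_def polys_lt_pos)

lemma hecke_sum_goss_dvd:
  assumes "\<pp> \<in> monic_primes" "\<pp> dvd a" shows "hecke_sum \<pp> (goss_fun n a) z = 0"
proof -
  obtain b where b: "a = \<pp> * b" using assms(2) by auto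
  have p: "\<pp> \<noteq> 0" "0 < degree \<pp>" using monic_primesD[OF assms(1)] by auto
  have "emb a * ((z + emb \<beta>) / emb \<pp>) = emb b * z + emb (b * \<beta>)" for \<beta>
    using p by (simp add: b emb_mult field_simps)
  then have "goss_fun n a ((z + emb \<beta>) / emb \<pp>) = goss_fun n b z" for \<beta>
    by (simp add: goss_fun_def t_param_periodic)
  then show ?thesis
    using p by (simp add: hecke_sum_def card_polys_lt power_0_left)
qed

text \<open>Pulling \<pp> out of each denominator gives the factor \<pp>^n and turns the lattice sum
  at (z + \<beta>)/\<pp> into the one over the class a \<beta> + \<pp> A. As a is invertible modulo
  \<pp>, these classes partition A, and the pieces recombine to the full sum.\<close>

lemma hecke_sum_goss_not_dvd:
  assumes P: "\<pp> \<in> monic_primes" and a: "a \<in> A_plus" and nd: "\<not> \<pp> dvd a" and n: "n > 0" and z: "z \<in> Omega \<iota>"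
  shows "hecke_sum \<pp> (goss_fun n a) z = emb \<pp> ^ n * goss_fun n a z"
proof -
  note p = monic_primesD[OF P]
  have a0: "a \<noteq> 0" using a by (rule A_plus_nonzero)
  define h where "h = (\<lambda>x. 1 / (\<pi> * (emb a * z) + \<pi> * emb x) ^ n)"
  define R where "R = (\<lambda>\<beta>. range (\<lambda>b. a * \<beta> + \<pp> * b))"
  have full: "(h has_sum goss_fun n a z) UNIV"
    unfolding h_def goss_fun_def using z a0 n by (intro goss_has_sum Omega_emb_mult)
  have part: "(h has_sum goss_fun n a ((z + emb \<beta>) / emb \<pp>) / emb \<pp> ^ n) (R \<beta>)" for \<beta>
  proof -
    define w where "w = (z + emb \<beta>) / emb \<pp>"
    have "((\<lambda>b. 1 / (\<pi> * (emb a * w) + \<pi> * emb b) ^ n) has_sum goss_fun n a w) UNIV"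
      unfolding goss_fun_def w_def using z a0 n p by (intro goss_has_sum Omega_emb_mult Omega_emb_divide)
    from has_sum_cmult_C[OF this, of "1 / emb \<pp> ^ n"]
    have "((\<lambda>b. 1 / emb \<pp> ^ n * (1 / (\<pi> * (emb a * w) + \<pi> * emb b) ^ n)) has_sum goss_fun n a w / emb \<pp> ^ n) UNIV"
      by simp
    moreover have "1 / emb \<pp> ^ n * (1 / (\<pi> * (emb a * w) + \<pi> * emb b) ^ n) = h (a * \<beta> + \<pp> * b)" for b
    proof -
      have "emb \<pp> * (\<pi> * (emb a * w) + \<pi> * emb b) = \<pi> * (emb a * z) + \<pi> * emb (a * \<beta> + \<pp> * b)"
        using p(4) by (simp add: w_def emb_add emb_mult field_simps)
      then show ?thesis by (simp add: h_def flip: power_mult_distrib)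
    qed
    moreover have "inj (\<lambda>b. a * \<beta> + \<pp> * b)" using p by (auto simp: inj_on_def)
    ultimately show ?thesis
      unfolding R_def w_def by (subst has_sum_reindex) (auto simp: o_def)
  qed
  have inj: "\<beta> = \<beta>'" if b: "\<beta> \<in> polys_lt (degree \<pp>)" "\<beta>' \<in> polys_lt (degree \<pp>)" "\<pp> dvd a * \<beta> - a * \<beta>'" for \<beta> \<beta>'
  proof (rule ccontr)
    assume "\<beta> \<noteq> \<beta>'"
    have "\<pp> dvd a * (\<beta> - \<beta>')" using b by (simp add: right_diff_distrib)
    then have "\<pp> dvd \<beta> - \<beta>'" using prime_elem_dvd_mult_iff[OF p(2)] nd by blast
    then have "degree \<pp> \<le> degree (\<beta> - \<beta>')" using \<open>\<beta> \<noteq> \<beta>'\<close> by (intro dvd_imp_degree_le) auto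
    moreover have "degree (\<beta> - \<beta>') < degree \<pp>" using b p by (auto simp: polys_lt_pos intro: degree_diff_less)
    ultimately show False by simp
  qed
  have disj: "R \<beta> \<inter> R \<beta>' = {}" if "\<beta> \<in> polys_lt (degree \<pp>)" "\<beta>' \<in> polys_lt (degree \<pp>)" "\<beta> \<noteq> \<beta>'" for \<beta> \<beta>'
  proof (rule ccontr)
    assume "R \<beta> \<inter> R \<beta>' \<noteq> {}"
    then obtain b b' where "a * \<beta> + \<pp> * b = a * \<beta>' + \<pp> * b'" by (auto simp: R_def)
    then have "a * \<beta> - a * \<beta>' = \<pp> * (b' - b)" by (simp add: algebra_simps)
    then have "\<pp> dvd a * \<beta> - a * \<beta>'" by simp
    then show False using inj that by blast
  qed
  have "(\<Union>\<beta>\<in>polys_lt (degree \<pp>). R \<beta>) = UNIV"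
  proof -
    define m where "m = (\<lambda>\<beta>. (a * \<beta>) mod \<pp>)"
    have mod_in: "y mod \<pp> \<in> polys_lt (degree \<pp>)" for y
      using degree_mod_less[OF p(4), of y] by (auto simp: polys_lt_def)
    \<comment> \<open>Multiplication by a modulo \<pp> is injective on the finite set of residues,
      hence surjective.\<close>
    have "inj_on m (polys_lt (degree \<pp>))"
      using inj by (auto simp: inj_on_def m_def mod_eq_dvd_iff)
    then have surj: "m ` polys_lt (degree \<pp>) = polys_lt (degree \<pp>)"
      using mod_in by (intro endo_inj_surj) (auto simp: m_def)
    have "x \<in> (\<Union>\<beta>\<in>polys_lt (degree \<pp>). R \<beta>)" for x
    proof -
      obtain \<beta> where \<beta>: "\<beta> \<in> polys_lt (degree \<pp>)" "m \<beta> = x mod \<pp>"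
        using surj mod_in[of x] by (metis imageE)
      then have "\<pp> dvd x - a * \<beta>" by (simp add: m_def mod_eq_dvd_iff[symmetric])
      then obtain b where "x - a * \<beta> = \<pp> * b" by auto
      then have "x = a * \<beta> + \<pp> * b" by (simp add: algebra_simps)
      then show ?thesis using \<beta> by (auto simp: R_def)
    qed
    then show ?thesis by blast
  qed
  moreover have "(h has_sum (\<Sum>\<beta>\<in>polys_lt (degree \<pp>). goss_fun n a ((z + emb \<beta>) / emb \<pp>) / emb \<pp> ^ n)) (\<Union>\<beta>\<in>polys_lt (degree \<pp>). R \<beta>)"
    by (rule has_sum_UN_disjoint_C[OF finite_polys_lt part disj])
  ultimately have "(h has_sum hecke_sum \<pp> (goss_fun n a) z / emb \<pp> ^ n) UNIV"
    by (simp add: hecke_sum_def sum_divide_distrib)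
  from has_sum_unique_C[OF full this] show ?thesis using p by simp
qed

text \<open>From t(a w) = t(z) with w = (z + b)/a one gets |t(w)|^(q^deg a) = |t(z)|, so the order
  is divided by q^deg a.\<close>

lemma t_bigo_divide_arg:
  assumes \<phi>: "t_bigo (M * CARD('q) ^ degree a) \<phi>" and a: "a \<in> A_plus"
  shows "t_bigo M (\<lambda>z. \<phi> ((z + emb b) / emb a))"
proof -
  note a0 = A_plus_nonzero[OF a]
  obtain C where C: "0 \<le> C" "\<forall>\<^sub>F z in near_infinity. absv (\<phi> z) \<le> C * absv (tp z) ^ (M * CARD('q) ^ degree a)"
    using \<phi> by (rule t_bigoE)
  from eventually_near_infinity_divide[OF C(2) a0, of b] eventually_near_infinity_divide[OF eventually_absv_t_param_emb_mult[OF a] a0, of b]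
  have "\<forall>\<^sub>F z in near_infinity. absv (\<phi> ((z + emb b) / emb a)) \<le> C * absv (tp z) ^ M"
  proof eventually_elim
    case (elim z)
    have "absv (tp ((z + emb b) / emb a)) ^ (M * CARD('q) ^ degree a) = absv (tp (emb a * ((z + emb b) / emb a))) ^ M"
      unfolding elim(2) by (simp add: mult.commute flip: power_mult)
    also have "emb a * ((z + emb b) / emb a) = z + emb b" using a0 by simp
    finally show ?case using elim(1) by (simp add: t_param_periodic)
  qed
  then show ?thesis using C(1) by (intro t_bigoI)
qed

lemma t_bigo_mult_arg:
  assumes \<phi>: "t_bigo M \<phi>" and a: "a \<in> A_plus"
  shows "t_bigo (M * CARD('q) ^ degree a) (\<lambda>z. \<phi> (emb a * z))"
proof -
  note a0 = A_plus_nonzero[OF a]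
  obtain C where C: "0 \<le> C" "\<forall>\<^sub>F z in near_infinity. absv (\<phi> z) \<le> C * absv (tp z) ^ M"
    using \<phi> by (rule t_bigoE)
  from eventually_near_infinity_mult[OF C(2) a0] eventually_absv_t_param_emb_mult[OF a]
  have "\<forall>\<^sub>F z in near_infinity. absv (\<phi> (emb a * z)) \<le> C * absv (tp z) ^ (M * CARD('q) ^ degree a)"
    by eventually_elim (simp add: mult.commute flip: power_mult)
  then show ?thesis using C(1) by (intro t_bigoI)
qed

lemma t_bigo_hecke_sum:
  assumes "t_bigo (M * CARD('q) ^ degree \<pp>) \<phi>" "\<pp> \<in> A_plus" shows "t_bigo M (hecke_sum \<pp> \<phi>)"
  unfolding hecke_sum_def[abs_def] by (rule t_bigo_sum) (rule t_bigo_divide_arg[OF assms])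

lemma hecke_sum_linear:
  "hecke_sum \<pp> (\<lambda>z. \<Sum>x\<in>S. d x * \<phi> x z) z = (\<Sum>x\<in>S. d x * hecke_sum \<pp> (\<phi> x) z)"
  unfolding hecke_sum_def sum_distrib_left by (rule sum.swap)

lemma hecke_sum_goss_sum:
  assumes P: "\<pp> \<in> monic_primes" and n: "n > 0" and z: "z \<in> Omega \<iota>"
  shows "hecke_sum \<pp> (\<lambda>z. \<Sum>x\<in>monic_lt D. d x * goss_fun n x z) z =
         emb \<pp> ^ n * (\<Sum>x\<in>monic_lt D. (if \<pp> dvd x then 0 else d x) * goss_fun n x z)"
  unfolding hecke_sum_linear sum_distrib_left
  by (intro sum.cong refl)
     (simp add: hecke_sum_goss_dvd[OF P] hecke_sum_goss_not_dvd[OF P _ _ n z] monic_lt_iff)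

text \<open>The formal identity that the d_x G_n(t_x) sum to 0, in terms of functions. The order M
  is prescribed first and the bound on D follows, so losing a fixed factor in the order is
  harmless.\<close>

definition null_expansion :: "nat \<Rightarrow> ('q poly \<Rightarrow> 'c) \<Rightarrow> bool" where
  "null_expansion n d \<longleftrightarrow> (\<forall>M. \<exists>D0. \<forall>D\<ge>D0. t_bigo M (\<lambda>z. \<Sum>x\<in>monic_lt D. d x * goss_fun n x z))"

lemma null_expansion_diff:
  assumes "null_expansion n d" "null_expansion n d'" shows "null_expansion n (\<lambda>x. d x - d' x)"
  unfolding null_expansion_def
proof
  fix M
  obtain D1 where D1: "\<forall>D\<ge>D1. t_bigo M (\<lambda>z. \<Sum>x\<in>monic_lt D. d x * goss_fun n x z)"
    using assms(1) unfolding null_expansion_def by blast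
  obtain D2 where D2: "\<forall>D\<ge>D2. t_bigo M (\<lambda>z. \<Sum>x\<in>monic_lt D. d' x * goss_fun n x z)"
    using assms(2) unfolding null_expansion_def by blast
  have "t_bigo M (\<lambda>z. \<Sum>x\<in>monic_lt D. (d x - d' x) * goss_fun n x z)" if "D \<ge> max D1 D2" for D
    using t_bigo_diff[OF D1[rule_format, of D] D2[rule_format, of D]] that
    by (simp add: left_diff_distrib sum_subtractf)
  then show "\<exists>D0. \<forall>D\<ge>D0. t_bigo M (\<lambda>z. \<Sum>x\<in>monic_lt D. (d x - d' x) * goss_fun n x z)" by blast
qed

text \<open>On each partial sum the Hecke sum acts as \<pp>^n times the sieve. It costs a factor
  q^deg \<pp> in the order, so the hypothesis is used with M q^deg \<pp>.\<close>

lemma null_expansion_not_dvd: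
  assumes d: "null_expansion n d" and P: "\<pp> \<in> monic_primes" and n: "n > 0"
  shows "null_expansion n (\<lambda>x. if \<pp> dvd x then 0 else d x)"
  unfolding null_expansion_def
proof
  fix M
  note p = monic_primesD[OF P]
  obtain D0 where D0: "\<forall>D\<ge>D0. t_bigo (M * CARD('q) ^ degree \<pp>) (\<lambda>z. \<Sum>x\<in>monic_lt D. d x * goss_fun n x z)"
    using d unfolding null_expansion_def by blast
  have "t_bigo M (\<lambda>z. \<Sum>x\<in>monic_lt D. (if \<pp> dvd x then 0 else d x) * goss_fun n x z)" if D: "D \<ge> D0" for D
  proof (rule t_bigo_cong)
    show "t_bigo M (\<lambda>z. 1 / emb \<pp> ^ n * hecke_sum \<pp> (\<lambda>z. \<Sum>x\<in>monic_lt D. d x * goss_fun n x z) z)"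
      using D0 D p(1) by (intro t_bigo_cmult t_bigo_hecke_sum) auto
    show "\<forall>\<^sub>F z in near_infinity. 1 / emb \<pp> ^ n * hecke_sum \<pp> (\<lambda>z. \<Sum>x\<in>monic_lt D. d x * goss_fun n x z) z =
        (\<Sum>x\<in>monic_lt D. (if \<pp> dvd x then 0 else d x) * goss_fun n x z)"
      using eventually_Omega
    proof eventually_elim
      case (elim z)
      show ?case unfolding hecke_sum_goss_sum[OF P n elim] using p(4) by simp
    qed
  qed
  then show "\<exists>D0. \<forall>D\<ge>D0. t_bigo M (\<lambda>z. \<Sum>x\<in>monic_lt D. (if \<pp> dvd x then 0 else d x) * goss_fun n x z)" by blast
qed

lemma monic_lt_multiples:
  assumes P: "\<pp> \<in> monic_primes"
  shows "{x \<in> monic_lt (D + degree \<pp>). \<pp> dvd x} = (\<lambda>y. \<pp> * y) ` monic_lt D"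
proof -
  note p = monic_primesD[OF P]
  have "\<pp> * y \<in> monic_lt (D + degree \<pp>) \<longleftrightarrow> y \<in> monic_lt D" for y
    using A_plus_mult[OF p(1)] A_plus_mult_cancel[OF p(1), of y] A_plus_nonzero[of y] p
    by (cases "y = 0") (auto simp: monic_lt_iff degree_mult_eq)
  then show ?thesis by (auto elim!: dvdE)
qed

text \<open>The terms divisible by \<pp> are the difference of the expansion and its sieved form.
  They make up F(\<pp> z), where F has the coefficients d(\<pp> y), because \<pp> y z = y (\<pp> z);
  the substitution z -> z/\<pp> recovers F.\<close>

lemma null_expansion_dvd:
  assumes d: "null_expansion n d" and P: "\<pp> \<in> monic_primes" and n: "n > 0"
  shows "null_expansion n (\<lambda>y. d (\<pp> * y))"
  unfolding null_expansion_def
proof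
  fix M
  note p = monic_primesD[OF P]
  have "null_expansion n (\<lambda>x. d x - (if \<pp> dvd x then 0 else d x))"
    by (intro null_expansion_diff null_expansion_not_dvd d P n)
  then obtain D0 where D0: "\<forall>D\<ge>D0. t_bigo (M * CARD('q) ^ degree \<pp>)
      (\<lambda>z. \<Sum>x\<in>monic_lt D. (d x - (if \<pp> dvd x then 0 else d x)) * goss_fun n x z)"
    unfolding null_expansion_def by blast
  have "t_bigo M (\<lambda>z. \<Sum>y\<in>monic_lt D. d (\<pp> * y) * goss_fun n y z)" if D: "D \<ge> D0" for D
  proof -
    have e: "(\<Sum>x\<in>monic_lt (D + degree \<pp>). (d x - (if \<pp> dvd x then 0 else d x)) * goss_fun n x z) =
        (\<Sum>y\<in>monic_lt D. d (\<pp> * y) * goss_fun n y (emb \<pp> * z))" for z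
    proof -
      have "(\<Sum>x\<in>monic_lt (D + degree \<pp>). (d x - (if \<pp> dvd x then 0 else d x)) * goss_fun n x z) =
          (\<Sum>x\<in>{x \<in> monic_lt (D + degree \<pp>). \<pp> dvd x}. d x * goss_fun n x z)"
        by (rule sum.mono_neutral_cong_right) auto
      also have "\<dots> = (\<Sum>y\<in>monic_lt D. d (\<pp> * y) * goss_fun n (\<pp> * y) z)"
        unfolding monic_lt_multiples[OF P] by (subst sum.reindex) (use p in \<open>auto simp: inj_on_def\<close>)
      also have "\<dots> = (\<Sum>y\<in>monic_lt D. d (\<pp> * y) * goss_fun n y (emb \<pp> * z))"
        by (simp add: goss_fun_def emb_mult mult_ac)
      finally show ?thesis .
    qed
    have "t_bigo (M * CARD('q) ^ degree \<pp>) (\<lambda>z. \<Sum>y\<in>monic_lt D. d (\<pp> * y) * goss_fun n y (emb \<pp> * z))"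
      using D0[rule_format, of "D + degree \<pp>"] D unfolding e by simp
    from t_bigo_divide_arg[OF this p(1), of 0] show ?thesis using p by simp
  qed
  then show "\<exists>D0. \<forall>D\<ge>D0. t_bigo M (\<lambda>z. \<Sum>y\<in>monic_lt D. d (\<pp> * y) * goss_fun n y z)" by blast
qed

lemma null_expansion_coprime:
  assumes "finite S" "S \<subseteq> monic_primes" "null_expansion n d" "n > 0"
  shows "null_expansion n (\<lambda>x. if \<exists>\<pp>\<in>S. \<pp> dvd x then 0 else d x)"
  using assms(1,2)
proof (induction S rule: finite_induct)
  case (insert \<pp> S)
  have "null_expansion n (\<lambda>x. if \<pp> dvd x then 0 else if \<exists>\<pp>\<in>S. \<pp> dvd x then 0 else d x)"
    using insert assms(4) by (intro null_expansion_not_dvd) auto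
  moreover have "(\<lambda>x. if \<pp> dvd x then 0 else if \<exists>\<pp>\<in>S. \<pp> dvd x then 0 else d x) =
      (\<lambda>x. if \<exists>\<pp>\<in>insert \<pp> S. \<pp> dvd x then 0 else d x)" by auto
  ultimately show ?case by simp
qed (use assms in simp)

text \<open>
  Sieving out all primes of degree at most \<open>E\<close> leaves only the term at \<open>1\<close> and terms of
  degree greater than \<open>E\<close>, and the latter have high order in \<open>t\<close>.
\<close>

lemma null_expansion_at_1:
  assumes d: "null_expansion n d" and n: "n > 0" shows "d 1 = 0"
proof -
  have ne: "goss n \<noteq> 0" using n by (rule goss_nonzero)
  define m where "m = (LEAST i. coeff (goss n) i \<noteq> 0)"
  have m: "coeff (goss n) m \<noteq> 0" "\<And>i. i < m \<Longrightarrow> coeff (goss n) i = 0"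
    unfolding m_def using ne by (metis (mono_tags, lifting) LeastI leading_coeff_0_iff) (use not_less_Least in blast)
  \<comment> \<open>\<open>m\<close> is the order of G_n at 0. Beyond degree m + 1 the order q^deg x
    of a term exceeds m, so only the term at 1 can contribute to t^m.\<close>
  define E where "E = Suc m"
  define S :: "'q poly set" where "S = {\<pp> \<in> monic_primes. degree \<pp> \<le> E}"
  have "S \<subseteq> polys_lt (Suc E)" by (auto simp: S_def polys_lt_def)
  then have S: "finite S" "S \<subseteq> monic_primes" using finite_subset[OF _ finite_polys_lt] by (auto simp: S_def)
  define d' where "d' = (\<lambda>x. if \<exists>\<pp>\<in>S. \<pp> dvd x then 0 else d x)"
  have "null_expansion n d'" unfolding d'_def by (rule null_expansion_coprime[OF S d n])
  then obtain D0 where D0: "\<forall>D\<ge>D0. t_bigo (Suc m) (\<lambda>z. \<Sum>x\<in>monic_lt D. d' x * goss_fun n x z)"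
    unfolding null_expansion_def by blast
  \<comment> \<open>The successor makes D positive, so that 1 belongs to
    \<open>monic_lt D\<close>.\<close>
  define D where "D = Suc D0"
  have "\<not> (\<exists>\<pp>\<in>S. \<pp> dvd 1)"
    using S(2) monic_primesD(2) by (auto simp: prime_elem_def)
  then have d'1: "d' 1 = d 1" by (simp add: d'_def)
  have "t_bigo (Suc m) (\<lambda>z. \<Sum>x\<in>monic_lt D - {1}. d' x * goss_fun n x z)"
  proof (rule t_bigo_sum)
    fix x assume x: "x \<in> monic_lt D - {1}"
    then have xA: "x \<in> A_plus" "x \<noteq> 1" by (auto simp: monic_lt_iff)
    show "t_bigo (Suc m) (\<lambda>z. d' x * goss_fun n x z)"
    proof (cases "degree x \<le> E")
      case True
      have "0 < degree x" using A_plus_degree_0[OF xA(1)] xA(2) by auto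
      then obtain \<pp> where p: "\<pp> \<in> monic_primes" "\<pp> dvd x" using monic_prime_divisor_exists[OF xA(1)] by blast
      then have "degree \<pp> \<le> degree x" using A_plus_nonzero[OF xA(1)] by (intro dvd_imp_degree_le) auto
      then have "\<pp> \<in> S" using p True by (simp add: S_def)
      then have "d' x = 0" using p by (auto simp: d'_def)
      then show ?thesis by simp
    next
      case False
      have "Suc m \<le> degree x" using False by (simp add: E_def)
      also have "\<dots> < CARD('q) ^ degree x" using card_field_ge_2[where 'q='q] by (intro power_gt_expt) simp
      finally show ?thesis by (intro t_bigo_cmult t_bigo_mono[OF t_bigo_goss_fun[OF xA(1)]]) simp
    qed
  qed
  moreover have "t_bigo (Suc m) (\<lambda>z. \<Sum>x\<in>monic_lt D. d' x * goss_fun n x z)" using D0 by (simp add: D_def)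
  moreover have "(\<Sum>x\<in>monic_lt D. d' x * goss_fun n x z) = d' 1 * goss_fun n 1 z + (\<Sum>x\<in>monic_lt D - {1}. d' x * goss_fun n x z)" for z
    by (rule sum.remove) (auto simp: monic_lt_iff D_def)
  ultimately have "t_bigo (Suc m) (\<lambda>z. d' 1 * goss_fun n 1 z)"
    using t_bigo_diff[of "Suc m" "\<lambda>z. \<Sum>x\<in>monic_lt D. d' x * goss_fun n x z" "\<lambda>z. \<Sum>x\<in>monic_lt D - {1}. d' x * goss_fun n x z"] by simp
  moreover have "t_bigo (Suc m) (\<lambda>z. d' 1 * (\<Sum>i\<in>{m<..degree (goss n)}. coeff (goss n) i * tp z ^ i))"
    by (intro t_bigo_cmult t_bigo_sum t_bigo_mono[OF t_bigo_cmult[OF t_bigo_t_power]]) auto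
  moreover have "goss_fun n 1 z = coeff (goss n) m * tp z ^ m + (\<Sum>i\<in>{m<..degree (goss n)}. coeff (goss n) i * tp z ^ i)" for z
  proof -
    have "m \<le> degree (goss n)" using m(1) by (rule le_degree)
    have "goss_fun n 1 z = (\<Sum>i\<le>degree (goss n). coeff (goss n) i * tp z ^ i)"
      by (simp add: goss_fun_def poly_altdef)
    also have "\<dots> = (\<Sum>i\<in>{m..degree (goss n)}. coeff (goss n) i * tp z ^ i)"
      by (rule sum.mono_neutral_right) (auto simp: m(2))
    also have "\<dots> = coeff (goss n) m * tp z ^ m + (\<Sum>i\<in>{m<..degree (goss n)}. coeff (goss n) i * tp z ^ i)"
      using \<open>m \<le> degree (goss n)\<close> by (rule sum.head)
    finally show ?thesis .
  qed
  ultimately have "t_bigo (Suc m) (\<lambda>z. d' 1 * coeff (goss n) m * tp z ^ m)"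
    using t_bigo_diff[of "Suc m" "\<lambda>z. d' 1 * goss_fun n 1 z" "\<lambda>z. d' 1 * (\<Sum>i\<in>{m<..degree (goss n)}. coeff (goss n) i * tp z ^ i)"]
    by (simp add: algebra_simps)
  then have "d' 1 * coeff (goss n) m = 0" by (rule t_bigo_coeff_zero)
  then show ?thesis using m(1) d'1 by simp
qed

lemma null_expansion_eq_0:
  assumes "null_expansion n d" "n > 0" "b \<in> A_plus" shows "d b = 0"
  using assms(1,3)
proof (induction "degree b" arbitrary: b d rule: less_induct)
  case less
  show ?case
  proof (cases "degree b = 0")
    case True
    then show ?thesis using A_plus_degree_0[OF less.prems(2)] null_expansion_at_1[OF less.prems(1) assms(2)] by simp
  next
    case False
    then obtain \<pp> where p: "\<pp> \<in> monic_primes" "\<pp> dvd b"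
      using monic_prime_divisor_exists[OF less.prems(2)] by blast
    then obtain y where y: "b = \<pp> * y" by auto
    have yA: "y \<in> A_plus" using less.prems(2) monic_primesD(1)[OF p(1)] by (auto simp: y intro: A_plus_mult_cancel)
    have "degree y < degree b"
      using monic_primesD[OF p(1)] A_plus_nonzero[OF yA] by (simp add: y degree_mult_eq)
    from less.hyps[OF this null_expansion_dvd[OF less.prems(1) p(1) assms(2)] yA] show ?thesis by (simp add: y)
  qed
qed

end

subsection \<open>The identity theorem\<close>

lemma rigid_analyticE:
  assumes "rigid_analytic \<iota> f"
  obtains Q P where "\<And>i z. z \<in> Omega_affinoid \<iota> j \<Longrightarrow> poly (Q i) z \<noteq> 0"
    "uniform_limit (Omega_affinoid \<iota> j) (\<lambda>i z. poly (P i) z / poly (Q i) z) f sequentially"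
proof -
  from assms[unfolded rigid_analytic_def, rule_format, of j]
  obtain P Q where "(\<forall>i. \<forall>z\<in>Omega_affinoid \<iota> j. poly (Q i) z \<noteq> 0) \<and>
      uniform_limit (Omega_affinoid \<iota> j) (\<lambda>i z. poly (P i) z / poly (Q i) z) f sequentially"
    by (elim exE)
  then show ?thesis using that by auto
qed

context C_infty
begin

section \<open>Algebraic closedness of the completed field\<close>

definition splits :: "'c poly \<Rightarrow> bool" where
  "splits p \<longleftrightarrow> (\<exists>c as. p = smult c (\<Prod>a\<leftarrow>as. [:- a, 1:]))"

text \<open>Roots are assumed only for degrees below n, so that the lemma can serve inside the
  induction that proves their existence.\<close>

lemma splitsI:
  assumes "\<And>r. 0 < degree r \<Longrightarrow> degree r < n \<Longrightarrow> \<exists>x. poly r x = (0::'c)" "degree p < n"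
  shows "splits p"
  using assms(2)
proof (induction "degree p" arbitrary: p rule: less_induct)
  case less
  show ?case
  proof (cases "degree p = 0")
    case True
    then obtain c where "p = [:c:]" by (auto elim: degree_eq_zeroE)
    then show ?thesis unfolding splits_def by (intro exI[of _ c] exI[of _ "[]"]) simp
  next
    case False
    then obtain x where "poly p x = 0" using assms(1)[of p] less.prems by auto
    then obtain p' where p': "p = [:- x, 1:] * p'" by (auto simp: poly_eq_0_iff_dvd)
    then have "p' \<noteq> 0" using False by auto
    then have d: "degree p = Suc (degree p')" unfolding p' by (subst degree_mult_eq) auto
    have "splits p'" using less.hyps[of p'] d less.prems by simp
    then obtain c as where "p' = smult c (\<Prod>a\<leftarrow>as. [:- a, 1:])" unfolding splits_def by blast
    then have "p = smult c (\<Prod>a\<leftarrow>x # as. [:- a, 1:])" by (simp add: p')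
    then show ?thesis unfolding splits_def by blast
  qed
qed

lemma degree_prod_list_linear: "degree (\<Prod>a\<leftarrow>as. [:- a, 1 :: 'c:]) = length as"
  and lead_coeff_prod_list_linear: "lead_coeff (\<Prod>a\<leftarrow>as. [:- a, 1 :: 'c:]) = 1"
proof -
  have "degree (\<Prod>a\<leftarrow>as. [:- a, 1 :: 'c:]) = length as \<and> lead_coeff (\<Prod>a\<leftarrow>as. [:- a, 1 :: 'c:]) = 1"
  proof (induction as)
    case (Cons a as)
    define R where "R = (\<Prod>a\<leftarrow>as. [:- a, 1 :: 'c:])"
    have R: "degree R = length as" "lead_coeff R = 1" using Cons unfolding R_def by blast+
    then have "R \<noteq> 0" by auto
    then have "degree ([:- a, 1:] * R) = Suc (length as)"
      using R by (subst degree_mult_eq) auto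
    moreover have "lead_coeff ([:- a, 1:] * R) = 1"
      using R(2) by (subst lead_coeff_mult) simp
    ultimately show ?case by (simp only: list.map prod_list.Cons list.size R_def[symmetric]) simp
  qed simp
  then show "degree (\<Prod>a\<leftarrow>as. [:- a, 1 :: 'c:]) = length as" "lead_coeff (\<Prod>a\<leftarrow>as. [:- a, 1 :: 'c:]) = 1"
    by auto
qed

lemma poly_prod_list_linear: "poly (\<Prod>a\<leftarrow>as. [:- a, 1:]) (x::'c) = (\<Prod>a\<leftarrow>as. x - a)"
  by (induction as) (simp_all add: left_diff_distrib)

lemma absv_prod_list: "absv (\<Prod>a\<leftarrow>as. h a :: 'c) = (\<Prod>a\<leftarrow>as. absv (h a))"
  by (induction as) (auto simp: absv_mult)

lemma prod_list_ge_power: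
  assumes "0 \<le> \<epsilon>" "\<And>a. a \<in> set as \<Longrightarrow> \<epsilon> \<le> h a"
  shows "(\<epsilon>::real) ^ length as \<le> (\<Prod>a\<leftarrow>as. h a)"
  using assms(2)
proof (induction as)
  case (Cons a as)
  then have "\<epsilon> * \<epsilon> ^ length as \<le> h a * (\<Prod>a\<leftarrow>as. h a)"
    using assms(1) by (intro mult_mono) (auto intro: order.trans)
  then show ?case by simp
qed simp

lemma alg_elements_approx: assumes "\<delta> > 0" shows "\<exists>y\<in>alg_elements \<iota>. absv (y - x) < \<delta>"
proof -
  have "x \<in> closure (alg_elements \<iota>)" by (simp add: dense)
  then show ?thesis using assms unfolding closure_approachable dist_absv by blast
qed

lemma embed_01_alg: "0 \<in> alg_elements \<iota>" "1 \<in> alg_elements \<iota>"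
  using embed_in_alg_elements[of 0] embed_in_alg_elements[of 1] by (simp_all add: embed_one)

text \<open>
  Approximating the coefficients by algebraic ones gives a polynomial with a root, hence by
  induction on the degree a split one, so a small constant term forces a small root.
\<close>

lemma small_approximate_root:
  fixes S :: "'c poly"
  assumes IH: "\<And>r. 0 < degree r \<Longrightarrow> degree r < n \<Longrightarrow> \<exists>x. poly r x = (0::'c)"
    and S: "degree S = n" "lead_coeff S = 1" and n: "n > 0"
    and \<epsilon>: "\<epsilon> > 0" "absv (poly S 0) < \<epsilon> ^ n" and \<delta>: "\<delta> > 0"
  shows "\<exists>y. absv y < \<epsilon> \<and> absv (poly S y) < \<delta>"
proof -
  define m where "m = max 1 \<epsilon> ^ n"
  have m: "m \<ge> 1" by (simp add: m_def one_le_power)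
  \<comment> \<open>As m bounds the powers up to n of any y with |y| < \<epsilon>, the first bound
    keeps the error of the value at such y under \<delta>; the second preserves the smallness of the
    constant term.\<close>
  define \<eta> where "\<eta> = min (\<delta> / (2 * m)) (\<epsilon> ^ n)"
  have \<eta>: "\<eta> > 0" using \<epsilon> \<delta> m by (simp add: \<eta>_def)
  have "\<exists>y\<in>alg_elements \<iota>. absv (y - coeff S i) < \<eta>" for i
    using alg_elements_approx[OF \<eta>] by blast
  then obtain s where s: "\<And>i. s i \<in> alg_elements \<iota>" "\<And>i. absv (s i - coeff S i) < \<eta>" by metis
  define S' where "S' = monom 1 n + (\<Sum>i<n. monom (s i) i)"
  have co: "coeff S' i = (if i < n then s i else if i = n then 1 else 0)" for i
    by (auto simp: S'_def coeff_sum coeff_monom)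
  have dS': "degree S' = n"
    by (intro antisym degree_le le_degree) (auto simp: co)
  have "coeff S' i \<in> alg_elements \<iota>" for i using s embed_01_alg by (auto simp: co)
  then obtain y1 where y1: "poly S' y1 = 0" using alg_closed[of S'] n dS' by auto
  then obtain S2 where S2: "S' = [:- y1, 1:] * S2" by (auto simp: poly_eq_0_iff_dvd)
  then have "S2 \<noteq> 0" using n dS' by auto
  then have dS2: "n = Suc (degree S2)" using dS' unfolding S2 by (subst (asm) degree_mult_eq) auto
  have "splits S2" using splitsI[OF IH, where p = S2] dS2 by simp
  then obtain c as where "S2 = smult c (\<Prod>a\<leftarrow>as. [:- a, 1:])" unfolding splits_def by blast
  then have S'_eq: "S' = smult c (\<Prod>a\<leftarrow>y1 # as. [:- a, 1:])" by (simp add: S2)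
  have "lead_coeff S' = 1" by (simp add: dS' co)
  then have "c = 1" unfolding S'_eq lead_coeff_smult lead_coeff_prod_list_linear by simp
  then have S'_eq: "S' = (\<Prod>a\<leftarrow>y1 # as. [:- a, 1:])" using S'_eq by simp
  then have len: "length (y1 # as) = n" using dS' degree_prod_list_linear[of "y1 # as"] by simp
  have S'0: "absv (poly S' 0) = (\<Prod>a\<leftarrow>y1 # as. absv a)"
    unfolding S'_eq poly_prod_list_linear absv_prod_list by simp
  have diff: "absv (coeff S' i - coeff S i) < \<eta>" for i
    using s(2)[of i] S \<eta> by (cases "i < n"; cases "i = n") (auto simp: co coeff_eq_0)
  have "absv (poly S' 0) < \<epsilon> ^ n"
    using diff[of 0] absv_add[of "poly S' 0 - poly S 0" "poly S 0"] \<epsilon>(2)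
    by (auto simp: poly_0_coeff_0 \<eta>_def max_def split: if_splits)
  then have "\<exists>y\<in>set (y1 # as). absv y < \<epsilon>"
    using prod_list_ge_power[of \<epsilon> "y1 # as" absv] \<epsilon>(1) len unfolding S'0 by (metis less_imp_le not_less)
  then obtain y where y: "y \<in> set (y1 # as)" "absv y < \<epsilon>" by blast
  have "poly S' y = 0"
    unfolding S'_eq poly_prod_list_linear prod_list_zero_iff using y(1) by force
  have "degree (S - S') \<le> n" using S dS' by (intro degree_diff_le) auto
  then have "poly (S - S') y = (\<Sum>i\<le>n. coeff (S - S') i * y ^ i)"
    unfolding poly_altdef by (intro sum.mono_neutral_left) (auto simp: coeff_eq_0 simp del: coeff_diff)
  then have "poly S y = (\<Sum>i\<le>n. coeff (S - S') i * y ^ i)"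
    using \<open>poly S' y = 0\<close> by simp
  also have "absv \<dots> \<le> \<delta> / 2"
  proof (rule absv_sum_le)
    fix i assume "i \<in> {..n}"
    have "absv y ^ i \<le> max 1 \<epsilon> ^ i" using y by (intro power_mono) auto
    also have "\<dots> \<le> m" unfolding m_def using \<open>i \<in> {..n}\<close> by (intro power_increasing) auto
    finally have "absv y ^ i \<le> m" .
    moreover have "absv (coeff (S - S') i) \<le> \<delta> / (2 * m)"
      using diff[of i] by (simp add: absv_minus_commute \<eta>_def)
    ultimately have "absv (coeff (S - S') i) * absv y ^ i \<le> \<delta> / (2 * m) * m"
      using \<delta> m by (intro mult_mono) auto
    then show "absv (coeff (S - S') i * y ^ i) \<le> \<delta> / 2"
      using m by (simp add: absv_mult absv_power)
  qed (use \<delta> in simp)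
  finally show ?thesis using y \<delta> by (intro exI[of _ y]) auto
qed

text \<open>Successive approximation without derivatives, which may vanish in characteristic p:
  translating the previous lemma to x_k with |P(x_k)| < \<epsilon>_k^n gives a point within
  \<epsilon>_k of x_k whose value is as small as required. The sequence converges to a root.\<close>

lemma root_exists: "0 < degree p \<Longrightarrow> \<exists>x. poly p x = (0::'c)"
proof (induction "degree p" arbitrary: p rule: less_induct)
  case less
  define n where "n = degree p"
  define P where "P = smult (1 / lead_coeff p) p"
  have n: "n > 0" using less.prems by (simp add: n_def)
  then have "lead_coeff p \<noteq> 0" by (auto simp: n_def)
  then have P: "degree P = n" "lead_coeff P = 1" and Pp: "\<And>x. poly P x = 0 \<Longrightarrow> poly p x = 0"
    by (auto simp: P_def n_def)
  have IH: "\<exists>x. poly r x = 0" if "0 < degree r" "degree r < n" for r :: "'c poly"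
    using less.hyps that by (simp add: n_def)
  have step: "\<exists>x'. absv (x' - x) < \<epsilon> \<and> absv (poly P x') < \<delta>"
    if "\<epsilon> > 0" "absv (poly P x) < \<epsilon> ^ n" "\<delta> > 0" for x \<epsilon> \<delta>
  proof -
    define S where "S = pcompose P [:x, 1:]"
    have dS: "degree S = n" by (simp add: S_def P degree_pcompose)
    have lS: "lead_coeff S = 1" using P by (simp add: S_def lead_coeff_comp)
    have "absv (poly S 0) < \<epsilon> ^ n" using that by (simp add: S_def poly_pcompose)
    from small_approximate_root[OF IH dS lS n that(1) this that(3)]
    obtain y where "absv y < \<epsilon>" "absv (poly S y) < \<delta>" by blast
    then show ?thesis by (intro exI[of _ "x + y"]) (simp add: S_def poly_pcompose)
  qed
  define \<epsilon> where "\<epsilon> = (\<lambda>k::nat. (1 / 2 :: real) ^ k)"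
  have \<epsilon>: "\<epsilon> k > 0" for k by (simp add: \<epsilon>_def)
  have "\<exists>x. \<forall>k. absv (poly P (x k)) < \<epsilon> k ^ n \<and> absv (x (Suc k) - x k) < \<epsilon> k"
  proof (rule dependent_nat_choice)
    \<comment> \<open>The start is any point with |P| < 1; it is found at distance less than b from
      0, with b chosen so that |P(0)| < b <= b^n.\<close>
    define b where "b = absv (poly P 0) + 1"
    have "b \<ge> 1" by (simp add: b_def)
    then have "absv (poly P 0) < b ^ n" using n power_increasing[of 1 n b] by (simp add: b_def)
    from step[OF _ this, of "\<epsilon> 0 ^ n"] \<open>b \<ge> 1\<close>
    show "\<exists>x. absv (poly P x) < \<epsilon> 0 ^ n" by (auto simp: \<epsilon>_def)
    show "\<exists>x'. absv (poly P x') < \<epsilon> (Suc k) ^ n \<and> absv (x' - x) < \<epsilon> k" if "absv (poly P x) < \<epsilon> k ^ n" for x k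
      using step[OF \<epsilon> that, of "\<epsilon> (Suc k) ^ n"] \<epsilon>[of "Suc k"] by auto
  qed
  then obtain x where x: "\<And>k. absv (poly P (x k)) < \<epsilon> k ^ n" "\<And>k. absv (x (Suc k) - x k) < \<epsilon> k" by blast
  have lim0: "\<epsilon> \<longlonglongrightarrow> 0" unfolding \<epsilon>_def by (rule LIMSEQ_realpow_zero) auto
  have "convergent x"
  proof (rule convergent_absvI)
    fix e :: real assume "e > 0"
    then have "\<forall>\<^sub>F k in sequentially. \<epsilon> k < e" using lim0 by (rule order_tendstoD(2)[rotated])
    then show "\<exists>N. \<forall>k\<ge>N. absv (x (Suc k) - x k) < e"
      unfolding eventually_sequentially using x(2) by (meson less_trans)
  qed
  then obtain l where l: "x \<longlonglongrightarrow> l" unfolding convergent_def by blast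
  have "(\<lambda>k. absv (poly P (x k))) \<longlonglongrightarrow> 0"
  proof (rule Lim_null_comparison[OF _ lim0])
    have "norm (absv (poly P (x k))) \<le> \<epsilon> k" for k
    proof -
      have "\<epsilon> k ^ n \<le> \<epsilon> k ^ 1" using n by (intro power_decreasing) (auto simp: \<epsilon>_def power_le_one)
      then show ?thesis using x(1)[of k] by simp
    qed
    then show "\<forall>\<^sub>F k in sequentially. norm (absv (poly P (x k))) \<le> \<epsilon> k" by simp
  qed
  moreover have "(\<lambda>k. absv (poly P (x k))) \<longlonglongrightarrow> absv (poly P l)" by (intro lim_absv lim_poly l)
  ultimately have "absv (poly P l) = 0" using LIMSEQ_unique by blast
  then show ?case using Pp by auto
qed

lemma poly_splits: "splits (p :: 'c poly)"
  by (rule splitsI[of "Suc (degree p)"]) (auto intro: root_exists)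

section \<open>Rational functions and their Gauss norms\<close>

definition rat_fun :: "'c \<Rightarrow> 'c list \<Rightarrow> 'c list \<Rightarrow> 'c \<Rightarrow> 'c" where
  "rat_fun c as bs y = c * (\<Prod>a\<leftarrow>as. y - a) / (\<Prod>b\<leftarrow>bs. y - b)"

text \<open>The absolute value of \<open>rat_fun\<close> at a generic point of absolute value
  \<rho>, one whose residue class contains no zero or pole.\<close>

definition gauss_norm :: "'c \<Rightarrow> 'c list \<Rightarrow> 'c list \<Rightarrow> real \<Rightarrow> real" where
  "gauss_norm c as bs \<rho> = absv c * (\<Prod>a\<leftarrow>as. max \<rho> (absv a)) / (\<Prod>b\<leftarrow>bs. max \<rho> (absv b))"

lemma rational_factorization:
  assumes "Q \<noteq> 0"
  obtains c as bs where "\<And>y. poly P y / poly Q y = rat_fun c as bs y" "\<And>b. b \<in> set bs \<Longrightarrow> poly Q b = 0"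
proof -
  obtain c as where P: "P = smult c (\<Prod>a\<leftarrow>as. [:- a, 1:])" using poly_splits[of P] unfolding splits_def by blast
  obtain d bs where Q: "Q = smult d (\<Prod>b\<leftarrow>bs. [:- b, 1:])" using poly_splits[of Q] unfolding splits_def by blast
  have "poly P y / poly Q y = rat_fun (c / d) as bs y" for y
    by (simp add: P Q rat_fun_def poly_prod_list_linear)
  moreover have "poly Q b = 0" if "b \<in> set bs" for b
  proof -
    have "0 \<in> set (map ((-) b) bs)" using that by force
    then have "(\<Prod>x\<leftarrow>bs. b - x) = 0" by (simp add: prod_list_zero_iff)
    then show ?thesis by (simp add: Q poly_prod_list_linear)
  qed
  ultimately show ?thesis using that by blast
qed

text \<open>The fibre over one point of the tree: for \<rho> in q^Z the circle without the open
  discs of radius \<rho> around points of K_infty, for all other \<rho> > 0 the full circle.\<close>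

definition circle :: "real \<Rightarrow> 'c set" where
  "circle \<rho> = {y. absv y = \<rho> \<and> im y = \<rho>}"

lemma absv_power_minus_self_eq_1:
  assumes "absv (x ^ N - x :: 'c) = 1" "2 \<le> N" shows "absv x = 1"
proof (rule ccontr)
  assume "absv x \<noteq> 1"
  then consider "absv x < 1" | "1 < absv x" by linarith
  then show False
  proof cases
    case 1
    then have "absv x ^ N \<le> absv x ^ 1" using assms(2) by (intro power_decreasing) auto
    then show False using absv_diff_le[of "x ^ N" x] assms(1) 1 by (simp add: absv_power)
  next
    case 2
    then have "absv x ^ 1 < absv x ^ N" using assms(2) by (intro power_strict_increasing) auto
    then have "absv (x ^ N - x) = absv x ^ N" using absv_diff_eq[of x "x ^ N"] by (simp add: absv_power)
    then show False using assms 2 one_less_power[of "absv x" N] by simp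
  qed
qed

text \<open>
  Artin--Schreier towers over the finite field yield infinitely many units that are pairwise
  incongruent, and incongruent to the elements of the base field, modulo the maximal ideal.
\<close>

lemma residually_distinct_units:
  obtains u :: "nat \<Rightarrow> 'c" where "\<And>k v. 1 \<le> absv (u k - \<iota> v)" "\<And>k. absv (u k) = 1"
    "\<And>j k. j \<noteq> k \<Longrightarrow> absv (u j - u k) = 1"
proof -
  define p where "p = CHAR('c)"
  have p: "prime p" unfolding p_def by (rule prime_CHAR_C)
  \<comment> \<open>The exponents satisfy Q (k + 1) = (Q k)^p. A solution of u^(Q k) = u + 1 is
    shifted by 1 under each Q k-th power, and p shifts return it: so u k is fixed by the Q j-th
    power for all j > k.\<close>
  define Q where "Q = (\<lambda>k::nat. CARD('q) ^ (p ^ k))"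
  have Q2: "Q k \<ge> 2" for k
  proof -
    have "CARD('q) ^ 1 \<le> Q k" unfolding Q_def
      using prime_gt_0_nat[OF p] by (intro power_increasing) (auto simp: Suc_le_eq)
    then show ?thesis using card_field_ge_2[where 'q='q] by simp
  qed
  have QSuc: "Q (Suc k) = Q k ^ p" for k by (simp add: Q_def mult.commute flip: power_mult)
  have "\<exists>x. x ^ Q k - x = (1::'c)" for k
  proof -
    define P where "P = monom 1 (Q k) + [:- 1, - 1 :: 'c:]"
    have "degree [:1, 1 :: 'c:] < degree (monom (1::'c) (Q k))"
      using Q2[of k] by (simp add: degree_monom_eq)
    then have "degree P = Q k" using degree_add_eq_left[of "- [:1, 1 :: 'c:]" "monom 1 (Q k)"]
      by (simp add: P_def degree_monom_eq)
    then obtain x where "poly P x = 0" using root_exists[of P] Q2[of k] by auto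
    then show ?thesis by (intro exI[of _ x]) (simp add: P_def poly_monom algebra_simps)
  qed
  then obtain u where u: "\<And>k. u k ^ Q k - u k = (1::'c)" by metis
  have frob: "(x - y) ^ Q k = x ^ Q k - y ^ Q k" for x y :: 'c and k
    unfolding Q_def by (rule frobenius_power_diff)
  have frob_add: "(x + y) ^ Q k = x ^ Q k + y ^ Q k" for x y :: 'c and k
    unfolding Q_def by (rule frobenius_power_add)
  have of_nat_frob: "(of_nat i :: 'c) ^ Q k = of_nat i" for i k
    using Q2[of k] by (induction i) (auto simp: frob_add add.commute power_0_left)
  have fixed_Suc: "u j ^ Q (Suc j) = u j" for j
  proof -
    have "u j ^ (Q j ^ i) = u j + of_nat i" for i
    proof (induction i)
      case (Suc i)
      have "u j ^ (Q j ^ Suc i) = (u j ^ (Q j ^ i)) ^ Q j" by (simp add: mult.commute flip: power_mult)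
      also have "\<dots> = u j ^ Q j + of_nat i" by (simp add: Suc frob_add of_nat_frob)
      also have "u j ^ Q j = u j + 1" using u[of j] by (simp add: algebra_simps)
      finally show ?case by simp
    qed simp
    from this[of p] show ?thesis by (simp add: QSuc p_def)
  qed
  have fixed: "u j ^ Q k = u j" if "j < k" for j k
    using that
  proof (induction k)
    case (Suc k)
    have step: "x ^ (m ^ i) = x" if "x ^ m = x" for x :: 'c and m i
    proof (induction i)
      case (Suc i)
      then show ?case using that by (simp add: power_mult)
    qed simp
    show ?case
    proof (cases "j = k")
      case False
      then have "u j ^ Q k = u j" using Suc by simp
      then show ?thesis unfolding QSuc by (rule step)
    qed (simp add: fixed_Suc)
  qed simp
  \<comment> \<open>If x is fixed by the Q k-th power, then u k - x solves the same Artin--Schreier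
    equation, all of whose solutions have absolute value 1.\<close>
  have unit: "absv (u k - x) = 1" if "x ^ Q k = x" for x k
  proof (rule absv_power_minus_self_eq_1[OF _ Q2])
    have "(u k - x) ^ Q k - (u k - x) = 1" using u[of k] that by (simp add: frob algebra_simps)
    then show "absv ((u k - x) ^ Q k - (u k - x)) = 1" by simp
  qed
  have "absv (u j - u k) = 1" if "j \<noteq> k" for j k
    using unit[OF fixed, of j k] unit[OF fixed, of k j] that
    by (cases "j < k") (auto simp: absv_minus_commute)
  moreover have u1: "absv (u k) = 1" for k
    using unit[of 0 k] Q2[of k] by (simp add: power_0_left)
  moreover have "1 \<le> absv (u k - \<iota> v)" for k v
  proof (cases "absv (\<iota> v) > 1")
    case True
    then show ?thesis using absv_diff_eq[of "u k" "\<iota> v"] u1[of k] by (simp add: absv_minus_commute)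
  next
    case False
    \<comment> \<open>An element of K_infty of absolute value at most 1 is congruent to a constant
      from F_q, and constants are fixed by every Q k-th power.\<close>
    then obtain a where a: "absv (\<iota> v - emb a) < 1" using approx_by_poly by blast
    have a1: "absv (emb a) \<le> 1"
      using False a absv_diff_le[of "\<iota> v" "\<iota> v - emb a"] by simp
    have "degree a = 0"
    proof (rule ccontr)
      assume "degree a \<noteq> 0"
      then have "1 < real (CARD('q)) ^ degree a" using card_gt_1 by (intro one_less_power) auto
      moreover have "a \<noteq> 0" using \<open>degree a \<noteq> 0\<close> by auto
      ultimately show False using a1 by (simp add: absv_emb)
    qed
    then obtain c where "a = [:c:]" by (auto elim: degree_eq_zeroE)
    then have ac: "emb a = const_emb c" by simp
    have "const_emb c ^ Q k = const_emb c"
    proof -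
      have "const_emb c ^ (CARD('q) ^ i) = const_emb c" for i
        by (induction i) (auto simp: power_mult)
      then show ?thesis by (simp add: Q_def)
    qed
    then have uc: "absv (u k - emb a) = 1" unfolding ac by (rule unit)
    have e: "u k - \<iota> v = (u k - emb a) - (\<iota> v - emb a)" by simp
    show ?thesis unfolding e using absv_diff_eq[of "\<iota> v - emb a" "u k - emb a"] uc a by simp
  qed
  ultimately show ?thesis using that by blast
qed

lemma absv_embed_power_int: "v \<noteq> 0 \<Longrightarrow> \<exists>n. absv (\<iota> v) = real (CARD('q)) powi n"
  using embed_absv by blast

text \<open>The absolute value of y is not taken on K_infty, so |y - \<iota> v| is always the larger
  of the two absolute values.\<close>

lemma im_eq_absv:
  assumes "\<And>n. absv y \<noteq> real (CARD('q)) powi n" "y \<noteq> 0" shows "im y = absv y"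
proof (rule antisym)
  show "im y \<le> absv y" using im_le[of y 0] by simp
  show "absv y \<le> im y"
  proof (rule im_geI)
    fix v
    have "absv (\<iota> v) \<noteq> absv y" using absv_embed_power_int[of v] assms by (cases "v = 0") force+
    then show "absv y \<le> absv (y - \<iota> v)"
      using absv_diff_eq[of "\<iota> v" y] absv_diff_eq[of y "\<iota> v"] absv_minus_commute[of y "\<iota> v"]
      by (cases "absv (\<iota> v) < absv y") auto
  qed
qed

text \<open>The circle meets infinitely many residue classes, so that any finite set of zeros and
  poles can be avoided.\<close>

definition generic_radius :: "real \<Rightarrow> bool" where
  "generic_radius \<rho> \<longleftrightarrow> (\<exists>g :: nat \<Rightarrow> 'c. (\<forall>k. g k \<in> circle \<rho>) \<and> (\<forall>j k. j \<noteq> k \<longrightarrow> absv (g j - g k) = \<rho>))"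

lemma generic_radius_power_int: "generic_radius (real (CARD('q)) powi n)"
proof -
  obtain u :: "nat \<Rightarrow> 'c" where u: "\<And>k v. 1 \<le> absv (u k - \<iota> v)" "\<And>k. absv (u k) = 1"
    "\<And>j k. j \<noteq> k \<Longrightarrow> absv (u j - u k) = 1" using residually_distinct_units by blast
  define w where "w = \<theta> powi n"
  obtain v where v: "w = \<iota> v"
  proof -
    have "\<theta> powi n = \<iota> (fls_X_inv powi n)" by (simp add: power_int_def embed_power embed_inverse)
    then show ?thesis using that w_def by blast
  qed
  have w: "absv w = real (CARD('q)) powi n" by (simp add: w_def absv_powi absv_\<theta>)
  then have "absv w \<noteq> 0" using card_gt_1 by (simp add: power_int_eq_0_iff)
  then have "v \<noteq> 0" by (auto simp: v)
  have "im (u k) = 1" for k using im_geI[of 1 "u k"] u(1) im_le[of "u k" 0] u(2)[of k] by (simp add: antisym)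
  then have "w * u k \<in> circle (real (CARD('q)) powi n)" for k
    using im_scale[OF \<open>v \<noteq> 0\<close>, of "u k"] w by (simp add: circle_def absv_mult u(2) v)
  moreover have "absv (w * u j - w * u k) = real (CARD('q)) powi n" if "j \<noteq> k" for j k
    using u(3)[OF that] w by (simp add: absv_mult flip: right_diff_distrib)
  ultimately show ?thesis unfolding generic_radius_def by (intro exI[of _ "\<lambda>k. w * u k"]) auto
qed

lemma generic_radius_absv:
  assumes "\<And>n. absv y \<noteq> real (CARD('q)) powi n" "y \<noteq> (0::'c)" shows "generic_radius (absv y)"
proof -
  obtain u :: "nat \<Rightarrow> 'c" where u: "\<And>k v. 1 \<le> absv (u k - \<iota> v)" "\<And>k. absv (u k) = 1"
    "\<And>j k. j \<noteq> k \<Longrightarrow> absv (u j - u k) = 1" using residually_distinct_units by blast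
  have ay: "absv (y * u k) = absv y" for k by (simp add: absv_mult u)
  moreover have "im (y * u k) = absv y" for k
    using im_eq_absv[of "y * u k"] assms ay[of k] by (metis absv_eq_0_iff)
  moreover have "absv (y * u j - y * u k) = absv y" if "j \<noteq> k" for j k
    using u(3)[OF that] by (simp add: absv_mult flip: right_diff_distrib)
  ultimately show ?thesis unfolding generic_radius_def by (intro exI[of _ "\<lambda>k. y * u k"]) (auto simp: circle_def)
qed

text \<open>Each a spoils at most one of the points g k: two of them closer to a than \<rho> would
  be closer than \<rho> to each other.\<close>

lemma generic_pointE:
  assumes "generic_radius \<rho>" "finite S"
  obtains y where "y \<in> circle \<rho>" "\<And>a. a \<in> S \<Longrightarrow> absv (y - a) = max \<rho> (absv a)"
proof -
  obtain g :: "nat \<Rightarrow> 'c" where g: "\<And>k. g k \<in> circle \<rho>" "\<And>j k. j \<noteq> k \<Longrightarrow> absv (g j - g k) = \<rho>"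
    using assms(1) unfolding generic_radius_def by blast
  define B where "B = (\<lambda>a. {k. absv (g k - a) < max \<rho> (absv a)})"
  have "finite (B a)" for a
  proof -
    have \<rho>: "absv (g k - a) < \<rho>" if "k \<in> B a" for k
      using that g(1)[of k] absv_diff_eq[of a "g k"] absv_diff_eq[of "g k" a] absv_minus_commute[of a "g k"]
      by (cases "absv a < absv (g k)"; cases "absv (g k) < absv a") (auto simp: B_def circle_def max_def split: if_splits)
    have "j = k" if "j \<in> B a" "k \<in> B a" for j k
    proof (rule ccontr)
      assume "j \<noteq> k"
      have e: "g j - g k = (g j - a) - (g k - a)" by simp
      have "absv (g j - g k) < \<rho>" unfolding e
        using absv_diff_le[of "g j - a" "g k - a"] \<rho>[OF that(1)] \<rho>[OF that(2)] by linarith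
      then show False using g(2)[OF \<open>j \<noteq> k\<close>] by simp
    qed
    then have "B a = {} \<or> (\<exists>k. B a = {k})" by blast
    then show ?thesis by auto
  qed
  then have "finite (\<Union>a\<in>S. B a)" using assms(2) by simp
  then obtain k where k: "k \<notin> (\<Union>a\<in>S. B a)" using ex_new_if_finite[OF infinite_UNIV_nat] by blast
  have "absv (g k - a) = max \<rho> (absv a)" if "a \<in> S" for a
    using k that absv_diff_le[of "g k" a] g(1)[of k] by (auto simp: B_def circle_def not_less intro: antisym)
  then show ?thesis using that g(1) by blast
qed

lemma absv_rat_fun: "absv (rat_fun c as bs y) = absv c * (\<Prod>a\<leftarrow>as. absv (y - a)) / (\<Prod>b\<leftarrow>bs. absv (y - b))"
  by (simp add: rat_fun_def absv_divide absv_mult absv_prod_list)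

lemma gauss_norm_attained:
  assumes "generic_radius \<rho>"
  obtains y where "y \<in> circle \<rho>" "absv (rat_fun c as bs y) = gauss_norm c as bs \<rho>"
proof -
  obtain y where y: "y \<in> circle \<rho>" "\<And>a. a \<in> set as \<union> set bs \<Longrightarrow> absv (y - a) = max \<rho> (absv a)"
    using generic_pointE[OF assms, of "set as \<union> set bs"] by auto
  then have "map (\<lambda>a. absv (y - a)) as = map (\<lambda>a. max \<rho> (absv a)) as" "map (\<lambda>a. absv (y - a)) bs = map (\<lambda>a. max \<rho> (absv a)) bs"
    by auto
  then have "absv (rat_fun c as bs y) = gauss_norm c as bs \<rho>" by (simp only: absv_rat_fun gauss_norm_def)
  then show ?thesis using that y(1) by blast
qed

lemma prod_list_mono_real:
  assumes "\<And>a. a \<in> set as \<Longrightarrow> 0 \<le> h a \<and> h a \<le> (g a :: real)"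
  shows "0 \<le> (\<Prod>a\<leftarrow>as. h a) \<and> (\<Prod>a\<leftarrow>as. h a) \<le> (\<Prod>a\<leftarrow>as. g a)"
  using assms
proof (induction as)
  case (Cons a as)
  then have "0 \<le> h a" "h a \<le> g a" "0 \<le> (\<Prod>a\<leftarrow>as. h a)" "(\<Prod>a\<leftarrow>as. h a) \<le> (\<Prod>a\<leftarrow>as. g a)" by auto
  then show ?case by (auto intro!: mult_mono)
qed simp

text \<open>For poles off the circle the denominator is exact: if |y - b| were below the maximum, b
  would lie in the residue disc of y and so on the circle as well. The numerator needs only the
  strong triangle inequality.\<close>

lemma absv_rat_fun_le_gauss_norm:
  assumes y: "y \<in> circle \<rho>" and bs: "\<And>b. b \<in> set bs \<Longrightarrow> b \<notin> circle \<rho>"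
  shows "absv (rat_fun c as bs y) \<le> gauss_norm c as bs \<rho>"
proof -
  have b: "absv (y - b) = max \<rho> (absv b)" if "b \<in> set bs" for b
  proof (rule ccontr)
    assume ne: "absv (y - b) \<noteq> max \<rho> (absv b)"
    have ay: "absv y = \<rho>" "im y = \<rho>" using y by (auto simp: circle_def)
    have ab: "absv b = \<rho>"
      using ne ay absv_diff_eq[of b y] absv_diff_eq[of y b] absv_minus_commute[of y b]
      by (cases "absv b < absv y"; cases "absv y < absv b") auto
    then have less: "absv (y - b) < \<rho>" using ne absv_diff_le[of y b] ay by auto
    have "\<rho> \<le> im b"
    proof (rule im_geI)
      fix v
      have v: "\<rho> \<le> absv (y - \<iota> v)" using im_le[of y v] ay by simp
      have "absv ((y - \<iota> v) - (y - b)) = absv (y - \<iota> v)" using less v by (intro absv_diff_eq) simp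
      then show "\<rho> \<le> absv (b - \<iota> v)" using v by simp
    qed
    moreover have "im b \<le> \<rho>" using im_le[of b 0] ab by simp
    ultimately show False using bs[OF that] ab by (simp add: circle_def)
  qed
  then have e: "map (\<lambda>b. absv (y - b)) bs = map (\<lambda>b. max \<rho> (absv b)) bs" by simp
  have "0 \<le> (\<Prod>a\<leftarrow>as. absv (y - a)) \<and> (\<Prod>a\<leftarrow>as. absv (y - a)) \<le> (\<Prod>a\<leftarrow>as. max \<rho> (absv a))"
    using absv_diff_le[of y] y by (intro prod_list_mono_real) (auto simp: circle_def)
  moreover have "0 \<le> (\<Prod>b\<leftarrow>bs. max \<rho> (absv b))"
    using prod_list_mono_real[of bs "\<lambda>_. 0" "\<lambda>b. max \<rho> (absv b)"] by (auto simp: le_max_iff_disj)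
  ultimately show ?thesis unfolding absv_rat_fun gauss_norm_def e
    by (intro divide_right_mono mult_left_mono) auto
qed

text \<open>In logarithmic coordinates, max s a is convex and piecewise linear in s with its break
  at s = a, hence linear on an interval that does not contain the break inside.\<close>

lemma max_powr_interpolate:
  fixes a s0 s1 t :: real
  assumes "0 < s0" "s0 \<le> s1" "0 \<le> t" "t \<le> 1" "0 \<le> a"
  shows "max (s0 powr (1 - t) * s1 powr t) a \<le> max s0 a powr (1 - t) * max s1 a powr t"
    "a \<le> s0 \<or> s1 \<le> a \<Longrightarrow> max (s0 powr (1 - t) * s1 powr t) a = max s0 a powr (1 - t) * max s1 a powr t"
proof -
  have a: "a = a powr (1 - t) * a powr t" if "a > 0" using that by (simp flip: powr_add)
  have s0: "s0 = s0 powr (1 - t) * s0 powr t" using assms by (simp flip: powr_add)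
  have s1: "s1 = s1 powr (1 - t) * s1 powr t" using assms by (simp flip: powr_add)
  have 1: "s0 powr (1 - t) * s1 powr t \<le> max s0 a powr (1 - t) * max s1 a powr t"
    using assms by (intro mult_mono powr_mono2) auto
  have 2: "a \<le> max s0 a powr (1 - t) * max s1 a powr t" if "a > 0"
    using assms by (subst a[OF that]) (intro mult_mono powr_mono2; auto)
  show "max (s0 powr (1 - t) * s1 powr t) a \<le> max s0 a powr (1 - t) * max s1 a powr t"
    using 1 2 assms by (cases "a = 0") auto
  have lo: "s0 \<le> s0 powr (1 - t) * s1 powr t"
  proof -
    have "s0 powr (1 - t) * s0 powr t \<le> s0 powr (1 - t) * s1 powr t"
      using assms by (intro mult_left_mono powr_mono2) auto
    then show ?thesis using s0 by simp
  qed
  have hi: "s0 powr (1 - t) * s1 powr t \<le> s1"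
  proof -
    have "s0 powr (1 - t) * s1 powr t \<le> s1 powr (1 - t) * s1 powr t"
      using assms by (intro mult_right_mono powr_mono2) auto
    then show ?thesis using s1 by simp
  qed
  show "max (s0 powr (1 - t) * s1 powr t) a = max s0 a powr (1 - t) * max s1 a powr t" if "a \<le> s0 \<or> s1 \<le> a"
    using that
  proof
    assume "a \<le> s0"
    then have "max s0 a = s0" "max s1 a = s1" "max (s0 powr (1 - t) * s1 powr t) a = s0 powr (1 - t) * s1 powr t"
      using lo assms by linarith+
    then show ?thesis by simp
  next
    assume "s1 \<le> a"
    then have "a > 0" using assms by linarith
    then show ?thesis using hi \<open>s1 \<le> a\<close> assms a by (simp add: max_def)
  qed
qed

lemma prod_list_powr_interpolate:
  fixes h :: "'b \<Rightarrow> real"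
  assumes "\<And>a. 0 \<le> h a" "\<And>a. 0 \<le> g a"
  shows "(\<Prod>a\<leftarrow>as. h a powr r * g a powr t) = (\<Prod>a\<leftarrow>as. h a) powr r * (\<Prod>a\<leftarrow>as. g a) powr t"
proof (induction as)
  case (Cons a as)
  have "0 \<le> (\<Prod>a\<leftarrow>as. h a)" "0 \<le> (\<Prod>a\<leftarrow>as. g a)"
    using prod_list_mono_real[of as h h] prod_list_mono_real[of as g g] assms by auto
  then show ?case using Cons assms by (simp add: powr_mult mult_ac)
qed simp

text \<open>The analogue of Hadamard's three circle theorem.\<close>

lemma gauss_norm_log_convex:
  assumes s: "0 < s0" "s0 \<le> s1" and t: "0 \<le> t" "t \<le> 1"
    and bs: "\<And>b. b \<in> set bs \<Longrightarrow> absv b \<le> s0 \<or> s1 \<le> absv b"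
  shows "gauss_norm c as bs (s0 powr (1 - t) * s1 powr t) \<le> gauss_norm c as bs s0 powr (1 - t) * gauss_norm c as bs s1 powr t"
proof -
  define \<rho> where "\<rho> = s0 powr (1 - t) * s1 powr t"
  have nn: "0 \<le> (\<Prod>a\<leftarrow>xs. max s (absv a))" for xs :: "'c list" and s
    using prod_list_mono_real[of xs "\<lambda>_. 0" "\<lambda>b. max s (absv b)"] by (auto simp: le_max_iff_disj)
  have A: "(\<Prod>a\<leftarrow>as. max \<rho> (absv a)) \<le> (\<Prod>a\<leftarrow>as. max s0 (absv a)) powr (1 - t) * (\<Prod>a\<leftarrow>as. max s1 (absv a)) powr t"
  proof -
    have "(\<Prod>a\<leftarrow>as. max \<rho> (absv a)) \<le> (\<Prod>a\<leftarrow>as. max s0 (absv a) powr (1 - t) * max s1 (absv a) powr t)"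
      using max_powr_interpolate(1)[OF s t] unfolding \<rho>_def
      by (intro prod_list_mono_real[THEN conjunct2]) (auto simp: le_max_iff_disj)
    then show ?thesis using s by (subst (asm) prod_list_powr_interpolate) (auto simp: le_max_iff_disj)
  qed
  \<comment> \<open>No pole has absolute value strictly between s0 and s1, so the denominator is
    exactly log-linear; a break there would enter with the wrong sign.\<close>
  have B: "(\<Prod>b\<leftarrow>bs. max \<rho> (absv b)) = (\<Prod>b\<leftarrow>bs. max s0 (absv b)) powr (1 - t) * (\<Prod>b\<leftarrow>bs. max s1 (absv b)) powr t"
  proof -
    have "map (\<lambda>b. max \<rho> (absv b)) bs = map (\<lambda>b. max s0 (absv b) powr (1 - t) * max s1 (absv b) powr t) bs"
      using max_powr_interpolate(2)[OF s t _ bs] unfolding \<rho>_def by simp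
    then show ?thesis using s by (simp only:) (subst prod_list_powr_interpolate; auto simp: le_max_iff_disj)
  qed
  have C: "absv c = absv c powr (1 - t) * absv c powr t"
    by (cases "c = 0") (auto simp flip: powr_add)
  have "gauss_norm c as bs \<rho> \<le> (absv c powr (1 - t) * absv c powr t) *
      ((\<Prod>a\<leftarrow>as. max s0 (absv a)) powr (1 - t) * (\<Prod>a\<leftarrow>as. max s1 (absv a)) powr t) /
      ((\<Prod>b\<leftarrow>bs. max s0 (absv b)) powr (1 - t) * (\<Prod>b\<leftarrow>bs. max s1 (absv b)) powr t)"
    unfolding gauss_norm_def B C[symmetric] by (intro divide_right_mono mult_left_mono A) auto
  also have "\<dots> = gauss_norm c as bs s0 powr (1 - t) * gauss_norm c as bs s1 powr t"
    unfolding gauss_norm_def using nn by (simp add: powr_mult powr_divide mult_ac)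
  finally show ?thesis by (simp add: \<rho>_def)
qed

lemma gauss_norm_nonneg: "0 \<le> gauss_norm c as bs \<rho>"
  unfolding gauss_norm_def
  using prod_list_mono_real[of as "\<lambda>_. 0" "\<lambda>b. max \<rho> (absv b)"] prod_list_mono_real[of bs "\<lambda>_. 0" "\<lambda>b. max \<rho> (absv b)"]
  by (auto simp: le_max_iff_disj)

lemma gauss_norm_tendsto:
  assumes "r \<longlonglongrightarrow> s" "0 < s" shows "(\<lambda>k. gauss_norm c as bs (r k)) \<longlonglongrightarrow> gauss_norm c as bs s"
proof -
  have *: "(\<lambda>k. \<Prod>a\<leftarrow>xs. max (r k) (absv a)) \<longlonglongrightarrow> (\<Prod>a\<leftarrow>xs. max s (absv a))" for xs :: "'c list"
    by (induction xs) (auto intro!: tendsto_intros assms)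
  have "(\<Prod>b\<leftarrow>xs. max s (absv b)) \<noteq> 0" for xs :: "'c list"
    using assms(2) by (induction xs) (auto simp: max_def)
  then show ?thesis unfolding gauss_norm_def by (intro tendsto_intros *)
qed

section \<open>Descent from infinity along the tree\<close>

lemma not_power_int_between:
  assumes "real (CARD('q)) powi n < x" "x < real (CARD('q)) powi (n + 1)"
  shows "x \<noteq> real (CARD('q)) powi n'"
  using assms power_int_strict_increasing_iff[OF card_gt_1] by auto

text \<open>The radii are q^n |T|^(1/(k + 2)), realised through roots of T. They lie outside q^Z and
  approach q^n, where interpolation on the annulus says nothing.\<close>

lemma generic_radii_above_power_int:
  fixes n :: int
  obtains r where "r \<longlonglongrightarrow> real (CARD('q)) powi n"
    "\<And>k. real (CARD('q)) powi n < r k" "\<And>k. r k < real (CARD('q)) powi (n + 1)" "\<And>k. generic_radius (r k)"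
proof -
  define q where "q = real (CARD('q))"
  have q: "q > 1" using card_gt_1 by (simp add: q_def)
  define s where "s = q powi n"
  have s: "s > 0" using q by (simp add: s_def zero_less_power_int)
  \<comment> \<open>Starting at 1/2 keeps the exponents strictly between 0 and 1.\<close>
  define e where "e = (\<lambda>k. inverse (real (Suc (Suc k))))"
  have e: "0 < e k" "e k < 1" for k by (auto simp: e_def inverse_eq_divide)
  have "\<exists>x. x ^ Suc (Suc k) = \<theta>" for k
  proof -
    define P where "P = monom 1 (Suc (Suc k)) + [:- \<theta>:]"
    have "degree P = Suc (Suc k)" unfolding P_def by (subst degree_add_eq_left) (auto simp: degree_monom_eq)
    then obtain x where "poly P x = 0" using root_exists[of P] by auto
    then show ?thesis by (intro exI[of _ x]) (simp add: P_def poly_monom)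
  qed
  then obtain x where x: "\<And>k. x k ^ Suc (Suc k) = \<theta>" by metis
  have ax: "absv (x k) = q powr e k" for k
  proof -
    have "absv (x k) ^ Suc (Suc k) = q" using x[of k] absv_\<theta> by (metis absv_power q_def)
    moreover from this have "absv (x k) > 0" using q by (metis absv_nonneg less_eq_real_def not_one_less_zero power_0_Suc)
    ultimately have "q powr e k = (absv (x k) powr real (Suc (Suc k))) powr e k"
      by (simp only: powr_realpow)
    also have "\<dots> = absv (x k)"
      using \<open>absv (x k) > 0\<close> by (simp only: powr_powr e_def) simp
    finally show ?thesis by simp
  qed
  define r where "r = (\<lambda>k. s * q powr e k)"
  have "e \<longlonglongrightarrow> 0" unfolding e_def by (rule LIMSEQ_Suc[OF LIMSEQ_inverse_real_of_nat])
  then have "r \<longlonglongrightarrow> s * q powr 0" unfolding r_def using q by (intro tendsto_intros) auto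
  then have lim: "r \<longlonglongrightarrow> s" using q by simp
  have lo: "s < r k" for k
    using s q e[of k] by (simp add: r_def)
  have hi: "r k < q powi (n + 1)" for k
  proof -
    have "q powr e k < q powr 1" using q e[of k] by (intro powr_less_mono) auto
    then have "r k < s * q" using s q by (simp add: r_def)
    also have "s * q = q powi (n + 1)" using q by (simp add: s_def power_int_add)
    finally show ?thesis .
  qed
  have "generic_radius (r k)" for k
  proof -
    have "absv (\<theta> powi n * x k) = r k" by (simp add: absv_mult absv_powi absv_\<theta> ax r_def s_def q_def)
    moreover have "r k \<noteq> real (CARD('q)) powi n'" for n'
      using not_power_int_between[of n "r k" n'] lo[of k] hi[of k] by (simp add: s_def q_def)
    moreover have "\<theta> powi n * x k \<noteq> 0" using \<open>absv (\<theta> powi n * x k) = r k\<close> lo[of k] s by auto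
    ultimately show ?thesis using generic_radius_absv[of "\<theta> powi n * x k"] by simp
  qed
  then show ?thesis using lim lo hi that by (simp add: s_def q_def)
qed

text \<open>One edge of the tree, from radius s1 down to s0. The Gauss norms of the approximants
  tend to 0 at s1 and stay bounded at s0, so by log-convexity they tend to 0 at every radius in
  between; s0 itself is reached by continuity of the Gauss norm of a single approximant.\<close>

lemma identity_step:
  fixes P Q :: "nat \<Rightarrow> 'c poly" and n :: int
  defines "s0 \<equiv> real (CARD('q)) powi n" and "s1 \<equiv> real (CARD('q)) powi (n + 1)"
  assumes nz: "\<And>i y. y \<in> D \<Longrightarrow> poly (Q i) y \<noteq> 0"
    and approx: "\<And>\<epsilon>. \<epsilon> > 0 \<Longrightarrow> \<exists>N. \<forall>i\<ge>N. \<forall>y\<in>D. absv (poly (P i) y / poly (Q i) y - f y) < \<epsilon>"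
    and D: "\<And>\<rho>. s0 \<le> \<rho> \<Longrightarrow> \<rho> \<le> s1 \<Longrightarrow> circle \<rho> \<subseteq> D"
    and zero: "\<And>y. y \<in> circle s1 \<Longrightarrow> f y = 0"
    and \<rho>: "s0 \<le> \<rho>" "\<rho> \<le> s1" and y: "y \<in> circle \<rho>"
  shows "f y = 0"
proof -
  have s: "0 < s0" "s0 < s1"
    unfolding s0_def s1_def using card_gt_1 power_int_strict_increasing_iff[OF card_gt_1]
    by (auto simp: zero_less_power_int)
  have gen: "generic_radius s0" "generic_radius s1"
    unfolding s0_def s1_def by (rule generic_radius_power_int)+
  have "Q i \<noteq> 0" for i
  proof -
    obtain g where "g \<in> circle s1" using gen(2) unfolding generic_radius_def by blast
    then show ?thesis using nz[of g i] D[of s1] s by auto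
  qed
  then have "\<exists>c as bs. (\<forall>y. poly (P i) y / poly (Q i) y = rat_fun c as bs y) \<and> (\<forall>b\<in>set bs. poly (Q i) b = 0)" for i
    using rational_factorization[of "Q i" "P i"] by metis
  then obtain c as bs where rat_fun: "\<And>i y. poly (P i) y / poly (Q i) y = rat_fun (c i) (as i) (bs i) y"
    and bs: "\<And>i b. b \<in> set (bs i) \<Longrightarrow> poly (Q i) b = 0" by metis
  define R where "R = (\<lambda>i. rat_fun (c i) (as i) (bs i))"
  define G where "G = (\<lambda>i. gauss_norm (c i) (as i) (bs i))"
  have R: "\<exists>N. \<forall>i\<ge>N. \<forall>y\<in>D. absv (R i y - f y) < \<epsilon>" if "\<epsilon> > 0" for \<epsilon>
    using approx[OF that] by (simp add: rat_fun R_def)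
  have pole: "b \<notin> D" if "b \<in> set (bs i)" for b i using bs[OF that] nz by auto
  have RG: "absv (R i y) \<le> G i \<rho>" if "s0 \<le> \<rho>" "\<rho> \<le> s1" "y \<in> circle \<rho>" for i \<rho> y
    unfolding R_def G_def using that D[of \<rho>] pole by (intro absv_rat_fun_le_gauss_norm) auto
  have attained: "\<exists>y\<in>circle \<rho>. absv (R i y) = G i \<rho>" if "generic_radius \<rho>" for i \<rho>
    unfolding R_def G_def using gauss_norm_attained[OF that] by metis
  have annulus: "f y = 0" if \<rho>: "s0 < \<rho>" "\<rho> \<le> s1" and y: "y \<in> circle \<rho>" for \<rho> y
  proof (cases "\<rho> = s1")
    case True
    then show ?thesis using zero y by simp
  next
    case False
    define t where "t = ln (\<rho> / s0) / ln (s1 / s0)"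
    have ls: "0 < ln (s1 / s0)" using s by simp
    have t: "0 < t" "t \<le> 1" using \<rho> s ls by (auto simp: t_def divide_le_eq)
    have \<rho>t: "\<rho> = s0 powr (1 - t) * s1 powr t"
    proof -
      have "ln (s0 powr (1 - t) * s1 powr t) = ln s0 + t * ln (s1 / s0)"
        using s by (simp add: ln_mult ln_powr ln_div algebra_simps)
      also have "\<dots> = ln \<rho>" using \<rho> s ls by (simp add: t_def ln_div)
      finally show ?thesis using \<rho> s by (subst (asm) ln_inj_iff) auto
    qed
    \<comment> \<open>A pole with absolute value strictly between s0 and s1 would lie on a circle
      contained in \<open>D\<close>.\<close>
    have pole_abs: "absv b \<le> s0 \<or> s1 \<le> absv b" if b: "b \<in> set (bs i)" for b i
    proof (rule ccontr)
      assume a: "\<not> (absv b \<le> s0 \<or> s1 \<le> absv b)"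
      then have "b \<noteq> 0" using s by auto
      moreover have "absv b \<noteq> real (CARD('q)) powi n'" for n'
        using a not_power_int_between[of n "absv b" n'] by (auto simp: s0_def s1_def)
      ultimately have "b \<in> circle (absv b)" using im_eq_absv[of b] by (simp add: circle_def)
      then show False using D[of "absv b"] a pole[OF b] by auto
    qed
    obtain N where N: "\<And>i y. i \<ge> N \<Longrightarrow> y \<in> D \<Longrightarrow> absv (R i y - f y) < 1" using R[of 1] by auto
    define B where "B = max 1 (G N s0)"
    have B: "1 \<le> B" "G N s0 \<le> B" by (auto simp: B_def)
    \<comment> \<open>All late approximants are within 1 of f on \<open>D\<close>, hence of the N-th
      one, whose Gauss norm at s0 is a fixed number.\<close>
    have GB: "G i s0 \<le> B" if "i \<ge> N" for i
    proof -
      obtain g where g: "g \<in> circle s0" "absv (R i g) = G i s0" using attained[OF gen(1)] by blast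
      have gD: "g \<in> D" using D[of s0] s g by auto
      have e: "R i g = (R i g - f g) - ((R N g - f g) - R N g)" by simp
      have "absv (R i g) \<le> max (absv (R i g - f g)) (max (absv (R N g - f g)) (absv (R N g)))"
        by (subst e) (intro order.trans[OF absv_diff_le] max.mono absv_diff_le order_refl)
      also have "\<dots> \<le> B" using N[OF that gD] N[OF order_refl gD] RG[of s0 g N] g(1) s B by simp
      finally show ?thesis using g(2) by simp
    qed
    show ?thesis
    proof (rule ccontr)
      assume "f y \<noteq> 0"
      define \<eta> where "\<eta> = absv (f y)"
      have \<eta>: "\<eta> > 0" using \<open>f y \<noteq> 0\<close> by (simp add: \<eta>_def)
      \<comment> \<open>Chosen such that the t-th power of the norm at s1 is at most \<eta> / (2 B);
        with the bound B at s0, the interpolated norm is then at most \<eta> / 2.\<close>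
      define \<epsilon> where "\<epsilon> = min (\<eta> / 2) ((\<eta> / (2 * B)) powr (1 / t))"
      have \<epsilon>: "\<epsilon> > 0" using \<eta> B by (simp add: \<epsilon>_def)
      obtain N' where N': "\<And>i y. i \<ge> N' \<Longrightarrow> y \<in> D \<Longrightarrow> absv (R i y - f y) < \<epsilon>" using R[OF \<epsilon>] by auto
      define i where "i = max N N'"
      obtain g where g: "g \<in> circle s1" "absv (R i g) = G i s1" using attained[OF gen(2)] by blast
      then have "G i s1 \<le> \<epsilon>" using N'[of i g] zero[OF g(1)] D[of s1] s by (auto simp: i_def)
      then have "G i s1 powr t \<le> \<epsilon> powr t" using t gauss_norm_nonneg by (intro powr_mono2) (auto simp: G_def)
      also have "\<dots> \<le> ((\<eta> / (2 * B)) powr (1 / t)) powr t" using t \<epsilon> by (intro powr_mono2) (auto simp: \<epsilon>_def)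
      also have "\<dots> = \<eta> / (2 * B)" using t \<eta> B by (simp add: powr_powr)
      finally have 1: "G i s1 powr t \<le> \<eta> / (2 * B)" .
      have "G i s0 powr (1 - t) \<le> B powr (1 - t)"
        using t GB[of i] gauss_norm_nonneg by (intro powr_mono2) (auto simp: G_def i_def)
      also have "\<dots> \<le> B powr 1" using t B by (intro powr_mono) auto
      finally have 2: "G i s0 powr (1 - t) \<le> B" using B by simp
      have "absv (R i y) \<le> G i \<rho>" using RG[of \<rho> y i] \<rho> y by simp
      also have "\<dots> \<le> G i s0 powr (1 - t) * G i s1 powr t"
        unfolding G_def \<rho>t using s t pole_abs by (intro gauss_norm_log_convex) auto
      also have "\<dots> \<le> B * (\<eta> / (2 * B))" using 1 2 B by (intro mult_mono) auto
      also have "\<dots> < \<eta>" using \<eta> B by simp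
      finally have 3: "absv (R i y) < \<eta>" .
      have "y \<in> D" using D[of \<rho>] \<rho> y by auto
      then have "absv (R i y - f y) < \<eta>" using N'[of i y] \<eta> by (auto simp: i_def \<epsilon>_def)
      then have "absv (R i y - (R i y - f y)) < \<eta>" using 3 absv_diff_le[of "R i y" "R i y - f y"] by linarith
      then show False by (simp add: \<eta>_def)
    qed
  qed
  show ?thesis
  proof (cases "\<rho> = s0")
    case False
    then show ?thesis using annulus[OF _ \<rho>(2) y] \<rho> by simp
  next
    \<comment> \<open>At s0 the interpolation exponent t would be 0 and give nothing, so the radii r
      k tend to s0 with the approximant i fixed.\<close>
    case True
    obtain r where r: "r \<longlonglongrightarrow> s0" "\<And>k. s0 < r k" "\<And>k. r k < s1" "\<And>k. generic_radius (r k)"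
      using generic_radii_above_power_int[of n] unfolding s0_def s1_def by blast
    show ?thesis
    proof (rule ccontr)
      assume "f y \<noteq> 0"
      define \<epsilon> where "\<epsilon> = absv (f y) / 2"
      have \<epsilon>: "\<epsilon> > 0" using \<open>f y \<noteq> 0\<close> by (simp add: \<epsilon>_def)
      obtain i where i: "\<And>y. y \<in> D \<Longrightarrow> absv (R i y - f y) < \<epsilon>" using R[OF \<epsilon>] by blast
      have "G i (r k) \<le> \<epsilon>" for k
      proof -
        obtain g where g: "g \<in> circle (r k)" "absv (R i g) = G i (r k)" using attained[OF r(4)] by blast
        moreover have "f g = 0" using annulus[OF r(2) less_imp_le[OF r(3)] g(1)] .
        moreover have "g \<in> D" using D[of "r k"] r(2)[of k] r(3)[of k] g(1) by auto
        ultimately show ?thesis using i[of g] by simp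
      qed
      then have "G i s0 \<le> \<epsilon>"
        using gauss_norm_tendsto[OF r(1) s(1), of "c i" "as i" "bs i"] by (intro LIMSEQ_le_const2[of "\<lambda>k. G i (r k)"]) (auto simp: G_def)
      then have "absv (R i y) \<le> \<epsilon>" using RG[of s0 y i] y True s by simp
      moreover have "y \<in> D" using D[of \<rho>] \<rho> y by auto
      ultimately have "absv (R i y - (R i y - f y)) \<le> \<epsilon>"
        using i[of y] absv_diff_le[of "R i y" "R i y - f y"] by linarith
      then have "absv (f y) \<le> \<epsilon>" by simp
      then show False using \<epsilon> unfolding \<epsilon>_def by linarith
    qed
  qed
qed

text \<open>Recentering at a point v of K_infty nearest to z puts z - v on the circle of radius
  \<open>im z\<close>, and the circles around v form a path to infinity. The vanishing spreads down
  this path edge by edge.\<close>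

lemma rigid_analytic_identity:
  assumes f: "rigid_analytic \<iota> f" and zero: "\<And>z. r \<le> im z \<Longrightarrow> f z = 0" and z: "z \<in> Omega \<iota>"
  shows "f z = 0"
proof -
  define q where "q = real (CARD('q))"
  have q: "q > 1" using card_gt_1 by (simp add: q_def)
  define \<rho> where "\<rho> = im z"
  have \<rho>: "\<rho> > 0" using z by (simp add: \<rho>_def Omega_iff)
  obtain v where v: "absv (z - \<iota> v) = \<rho>" using im_attained[of z] \<rho> by (auto simp: \<rho>_def)
  \<comment> \<open>J will be so large that f vanishes at radius q^J, that translation by v stays
    within the affinoid, and that \<open>im z\<close> lies between q^(-J) and q^J.\<close>
  define b where "b = max (max r (absv (\<iota> v))) (max \<rho> (1 / \<rho>))"
  obtain J where J: "b < q ^ J" using q real_arch_pow by blast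
  have J': "r \<le> q ^ J" "absv (\<iota> v) \<le> q ^ J" "\<rho> \<le> q ^ J" "1 / \<rho> \<le> q ^ J"
    using J by (auto simp: b_def)
  have qJ: "q powi int J = q ^ J" "q powi (- int J) = 1 / q ^ J"
    by (simp_all add: power_int_minus inverse_eq_divide)
  define D where "D = {y. y + \<iota> v \<in> Omega_affinoid \<iota> J}"
  obtain P Q where PQ: "\<And>i y. y \<in> Omega_affinoid \<iota> J \<Longrightarrow> poly (Q i) y \<noteq> 0"
      "uniform_limit (Omega_affinoid \<iota> J) (\<lambda>i z. poly (P i) z / poly (Q i) z) f sequentially"
    by (rule rigid_analyticE[OF f, of J]) blast
  define P' where "P' = (\<lambda>i. pcompose (P i) [:\<iota> v, 1:])"
  define Q' where "Q' = (\<lambda>i. pcompose (Q i) [:\<iota> v, 1:])"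
  define g where "g = (\<lambda>y. f (y + \<iota> v))"
  have nz: "poly (Q' i) y \<noteq> 0" if "y \<in> D" for i y
    using PQ(1)[of "y + \<iota> v" i] that by (simp add: Q'_def D_def poly_pcompose add.commute)
  have approx: "\<exists>N. \<forall>i\<ge>N. \<forall>y\<in>D. absv (poly (P' i) y / poly (Q' i) y - g y) < \<epsilon>" if \<epsilon>: "\<epsilon> > 0" for \<epsilon>
  proof -
    obtain N where "\<forall>i\<ge>N. \<forall>y\<in>Omega_affinoid \<iota> J. absv (poly (P i) y / poly (Q i) y - f y) < \<epsilon>"
      using uniform_limitD[OF PQ(2) \<epsilon>] unfolding eventually_sequentially dist_absv by blast
    then show ?thesis by (intro exI[of _ N]) (auto simp: P'_def Q'_def g_def D_def poly_pcompose add.commute)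
  qed
  have D: "circle \<sigma> \<subseteq> D" if "q powi (- int J) \<le> \<sigma>" "\<sigma> \<le> q powi int J" for \<sigma>
  proof
    fix y assume "y \<in> circle \<sigma>"
    then have y: "absv y = \<sigma>" "im (y + \<iota> v) = \<sigma>" by (auto simp: circle_def im_add)
    then have "absv (y + \<iota> v) \<le> q ^ J" using absv_add[of y "\<iota> v"] J'(2) that(2) qJ by simp
    then show "y \<in> D" using y that(1) qJ by (simp add: D_def Omega_affinoid_def q_def)
  qed
  \<comment> \<open>\<open>k\<close> counts the edges descended from q^J; after 2 J of them q^(-J)
    is reached, which is at most \<open>im z\<close>.\<close>
  have main: "k \<le> 2 * J \<Longrightarrow> \<forall>\<sigma>. q powi (int J - int k) \<le> \<sigma> \<and> \<sigma> \<le> q powi int J \<longrightarrow> (\<forall>y\<in>circle \<sigma>. g y = 0)" for k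
  proof (induction k)
    case 0
    have "g y = 0" if "y \<in> circle (q powi int J)" for y
      unfolding g_def using that J'(1) qJ by (intro zero) (auto simp: circle_def im_add)
    then show ?case by force
  next
    case (Suc k)
    define n where "n = int J - int (Suc k)"
    have n1: "n + 1 = int J - int k" by (simp add: n_def)
    have IH: "\<And>\<sigma> y. q powi (n + 1) \<le> \<sigma> \<Longrightarrow> \<sigma> \<le> q powi int J \<Longrightarrow> y \<in> circle \<sigma> \<Longrightarrow> g y = 0"
      using Suc unfolding n1 by simp
    have le: "q powi (n + 1) \<le> q powi int J" "q powi (- int J) \<le> q powi n"
      by (rule power_int_increasing; use q Suc.prems n_def in simp)+
    show ?case
    proof (intro allI impI ballI)
      fix \<sigma> y assume \<sigma>: "q powi (int J - int (Suc k)) \<le> \<sigma> \<and> \<sigma> \<le> q powi int J" and y: "y \<in> circle \<sigma>"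
      show "g y = 0"
      proof (cases "q powi (n + 1) \<le> \<sigma>")
        case True
        then show ?thesis using IH \<sigma> y by blast
      next
        case False
        show ?thesis
        proof (rule identity_step[OF nz approx, where n = n and \<rho> = \<sigma>])
          show "circle \<sigma>' \<subseteq> D" if "real (CARD('q)) powi n \<le> \<sigma>'" "\<sigma>' \<le> real (CARD('q)) powi (n + 1)" for \<sigma>'
            using that le by (intro D) (auto simp: q_def)
          show "g y = 0" if "y \<in> circle (real (CARD('q)) powi (n + 1))" for y
            using IH[OF _ le(1)] that by (simp add: q_def)
        qed (use False \<sigma> y in \<open>auto simp: q_def n_def\<close>)
      qed
    qed
  qed
  have "q powi (- int J) \<le> \<rho>" using J'(4) \<rho> q unfolding qJ by (simp add: field_simps)
  moreover have "\<rho> \<le> q powi int J" using J'(3) qJ by simp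
  moreover have "z - \<iota> v \<in> circle \<rho>" using v im_add[of "z - \<iota> v" v] by (simp add: circle_def \<rho>_def)
  ultimately have "g (z - \<iota> v) = 0" using main[of "2 * J"] by auto
  then show ?thesis by (simp add: g_def)
qed

lemma rigid_analytic_diff_cmult:
  assumes f: "rigid_analytic \<iota> f" and g: "rigid_analytic \<iota> g"
  shows "rigid_analytic \<iota> (\<lambda>z. g z - C * f z)"
  unfolding rigid_analytic_def
proof
  fix j
  define D where "D = Omega_affinoid \<iota> j"
  obtain P Q where PQ: "\<And>i y. y \<in> D \<Longrightarrow> poly (Q i) y \<noteq> 0"
      "uniform_limit D (\<lambda>i z. poly (P i) z / poly (Q i) z) f sequentially"
    by (rule rigid_analyticE[OF f, of j, folded D_def]) blast
  obtain P' Q' where PQ': "\<And>i y. y \<in> D \<Longrightarrow> poly (Q' i) y \<noteq> 0"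
      "uniform_limit D (\<lambda>i z. poly (P' i) z / poly (Q' i) z) g sequentially"
    by (rule rigid_analyticE[OF g, of j, folded D_def]) blast
  define P2 where "P2 = (\<lambda>i. P' i * Q i - smult C (P i * Q' i))"
  define Q2 where "Q2 = (\<lambda>i. Q i * Q' i)"
  have eq: "poly (P2 i) z / poly (Q2 i) z = poly (P' i) z / poly (Q' i) z - C * (poly (P i) z / poly (Q i) z)"
    if "z \<in> D" for i z
    using PQ(1)[OF that, of i] PQ'(1)[OF that, of i] by (simp add: P2_def Q2_def field_simps)
  have "uniform_limit D (\<lambda>i z. poly (P2 i) z / poly (Q2 i) z) (\<lambda>z. g z - C * f z) sequentially"
  proof (rule uniform_limitI)
    fix e :: real assume e: "e > 0"
    have "e / (absv C + 1) > 0" using e by (simp add: add_nonneg_pos)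
    from uniform_limitD[OF PQ(2) this] uniform_limitD[OF PQ'(2) e]
    show "\<forall>\<^sub>F i in sequentially. \<forall>z\<in>D. dist (poly (P2 i) z / poly (Q2 i) z) (g z - C * f z) < e"
    proof eventually_elim
      case (elim i)
      show ?case
      proof
        fix z assume z: "z \<in> D"
        have 1: "absv (poly (P' i) z / poly (Q' i) z - g z) < e" using elim(2) z by (simp add: dist_absv)
        have "absv (poly (P i) z / poly (Q i) z - f z) < e / (absv C + 1)" using elim(1) z by (simp add: dist_absv)
        then have "(absv C + 1) * absv (poly (P i) z / poly (Q i) z - f z) < e"
          using pos_less_divide_eq[of "absv C + 1"] by (simp add: add_nonneg_pos mult.commute)
        moreover have "absv C * absv (poly (P i) z / poly (Q i) z - f z) \<le> (absv C + 1) * absv (poly (P i) z / poly (Q i) z - f z)"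
          by (intro mult_right_mono) auto
        ultimately have 2: "absv (C * (poly (P i) z / poly (Q i) z - f z)) < e" by (simp only: absv_mult)
        have e': "poly (P' i) z / poly (Q' i) z - C * (poly (P i) z / poly (Q i) z) - (g z - C * f z) =
            (poly (P' i) z / poly (Q' i) z - g z) - C * (poly (P i) z / poly (Q i) z - f z)"
          by (simp only: right_diff_distrib) simp
        show "dist (poly (P2 i) z / poly (Q2 i) z) (g z - C * f z) < e"
          unfolding dist_absv eq[OF z] e'
          using 1 2 absv_diff_le[of "poly (P' i) z / poly (Q' i) z - g z" "C * (poly (P i) z / poly (Q i) z - f z)"] by linarith
      qed
    qed
  qed
  moreover have "poly (Q2 i) z \<noteq> 0" if "z \<in> D" for i z using PQ(1)[OF that] PQ'(1)[OF that] by (simp add: Q2_def)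
  ultimately show "\<exists>P Q. (\<forall>i. \<forall>z\<in>Omega_affinoid \<iota> j. poly (Q i) z \<noteq> 0) \<and>
      uniform_limit (Omega_affinoid \<iota> j) (\<lambda>i z. poly (P i) z / poly (Q i) z) (\<lambda>z. g z - C * f z) sequentially"
    unfolding D_def by blast
qed

end

subsection \<open>Eigenforms with A-expansions\<close>

context carlitz_setting
begin

text \<open>Comparison of coefficients in the eigenvalue equation: the first part of the operator
  moves c_y, times \<pp>^k, to the index \<pp> y; the second multiplies the terms prime to \<pp> by
  \<pp>^n and kills the others.\<close>

lemma hecke_null_expansion:
  assumes n: "n > 0" and f: "t_asymp f (t_expansion \<iota> \<pi> f)" and A: "has_A_expansion \<iota> \<pi> n 0 c f"
    and P: "\<pp> \<in> monic_primes" and ev: "\<And>z. z \<in> Omega \<iota> \<Longrightarrow> hecke \<iota> k \<pp> f z = ev * f z"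
  shows "null_expansion n (\<lambda>x. ev * c x - emb \<pp> ^ n * (if \<pp> dvd x then 0 else c x) -
           emb \<pp> powi k * (if \<pp> dvd x then c (x div \<pp>) else 0))"
  unfolding null_expansion_def
proof
  fix M
  note p = monic_primesD[OF P]
  define \<delta> where "\<delta> = degree \<pp>"
  define d where "d = (\<lambda>x. ev * c x - emb \<pp> ^ n * (if \<pp> dvd x then 0 else c x) -
           emb \<pp> powi k * (if \<pp> dvd x then c (x div \<pp>) else 0))"
  have "t_bigo M (\<lambda>z. \<Sum>x\<in>monic_lt D. d x * goss_fun n x z)" if D: "D \<ge> M + \<delta>" for D
  proof -
    define S where "S = (\<lambda>z. \<Sum>a\<in>monic_lt D. c a * goss_fun n a z)"
    define R where "R = (\<lambda>z. f z - S z)"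
    \<comment> \<open>D >= M + \<delta> leaves room for the loss: even after its order has been
      divided by q^\<delta>, the remainder \<open>R\<close> is of order M.\<close>
    have "M * CARD('q) ^ \<delta> \<le> CARD('q) ^ M * CARD('q) ^ \<delta>"
      using card_field_ge_2[where 'q='q] by (intro mult_right_mono less_imp_le[OF power_gt_expt]) auto
    also have "\<dots> \<le> CARD('q) ^ D" unfolding power_add[symmetric] using D by (intro power_increasing) auto
    finally have MD: "M * CARD('q) ^ \<delta> \<le> CARD('q) ^ D" .
    have "M * 1 \<le> M * CARD('q) ^ \<delta>" by (intro mult_left_mono) auto
    then have MD1: "M \<le> CARD('q) ^ D" using MD by linarith
    have RD: "t_bigo (CARD('q) ^ D) R" using A_expansion_bigt[OF n A f, of D] by (simp add: R_def S_def)
    have R1: "t_bigo M R" by (rule t_bigo_mono[OF RD MD1])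
    have R2: "t_bigo M (\<lambda>z. R (emb \<pp> * z))"
      using t_bigo_mult_arg[OF R1 p(1)] by (rule t_bigo_mono) simp
    have R3: "t_bigo M (hecke_sum \<pp> R)"
      using t_bigo_hecke_sum[OF t_bigo_mono[OF RD MD[unfolded \<delta>_def]] p(1)] .
    \<comment> \<open>Truncation does not commute with z -> \<pp> z: the terms of degree from D -
      \<delta> to D - 1 are moved to degree D or more, where their order is high.\<close>
    have tail: "t_bigo M (\<lambda>z. \<Sum>y\<in>monic_lt D - monic_lt (D - \<delta>). c y * goss_fun n (\<pp> * y) z)"
    proof (rule t_bigo_sum)
      fix y assume "y \<in> monic_lt D - monic_lt (D - \<delta>)"
      then have y: "y \<in> A_plus" "D - \<delta> \<le> degree y" by (auto simp: monic_lt_iff)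
      then have "D \<le> degree (\<pp> * y)" using p A_plus_nonzero[OF y(1)] by (simp add: degree_mult_eq \<delta>_def)
      then have "CARD('q) ^ D \<le> CARD('q) ^ degree (\<pp> * y)" by (intro power_increasing) auto
      then have "M \<le> CARD('q) ^ degree (\<pp> * y)" using MD1 by linarith
      from t_bigo_cmult[OF t_bigo_mono[OF t_bigo_goss_fun[OF A_plus_mult[OF p(1) y(1)]] this]]
      show "t_bigo M (\<lambda>z. c y * goss_fun n (\<pp> * y) z)" .
    qed
    have S\<pp>: "S (emb \<pp> * z) = (\<Sum>x\<in>monic_lt D. (if \<pp> dvd x then c (x div \<pp>) else 0) * goss_fun n x z) +
        (\<Sum>y\<in>monic_lt D - monic_lt (D - \<delta>). c y * goss_fun n (\<pp> * y) z)" for z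
    proof -
      have "(\<Sum>x\<in>monic_lt D. (if \<pp> dvd x then c (x div \<pp>) else 0) * goss_fun n x z) =
          (\<Sum>x\<in>{x \<in> monic_lt (D - \<delta> + degree \<pp>). \<pp> dvd x}. c (x div \<pp>) * goss_fun n x z)"
        using D by (intro sum.mono_neutral_cong_right) (auto simp: \<delta>_def)
      also have "\<dots> = (\<Sum>y\<in>monic_lt (D - \<delta>). c y * goss_fun n (\<pp> * y) z)"
        unfolding monic_lt_multiples[OF P] by (subst sum.reindex) (use p in \<open>auto simp: inj_on_def\<close>)
      finally have e: "(\<Sum>x\<in>monic_lt D. (if \<pp> dvd x then c (x div \<pp>) else 0) * goss_fun n x z) =
          (\<Sum>y\<in>monic_lt (D - \<delta>). c y * goss_fun n (\<pp> * y) z)" .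
      have "S (emb \<pp> * z) = (\<Sum>y\<in>monic_lt D. c y * goss_fun n (\<pp> * y) z)"
        by (simp add: S_def goss_fun_def emb_mult mult_ac)
      also have "\<dots> = (\<Sum>y\<in>monic_lt D - monic_lt (D - \<delta>). c y * goss_fun n (\<pp> * y) z) +
          (\<Sum>y\<in>monic_lt (D - \<delta>). c y * goss_fun n (\<pp> * y) z)"
        by (rule sum.subset_diff) (auto simp: monic_lt_iff)
      finally show ?thesis unfolding e by (simp add: add.commute)
    qed
    have "t_bigo M (\<lambda>z. emb \<pp> powi k * (R (emb \<pp> * z) + (\<Sum>y\<in>monic_lt D - monic_lt (D - \<delta>). c y * goss_fun n (\<pp> * y) z)) + hecke_sum \<pp> R z - ev * R z)"
      by (intro t_bigo_diff[OF t_bigo_add] t_bigo_cmult t_bigo_add R1 R2 R3 tail)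
    then show ?thesis
    proof (rule t_bigo_cong)
      show "\<forall>\<^sub>F z in near_infinity. emb \<pp> powi k * (R (emb \<pp> * z) + (\<Sum>y\<in>monic_lt D - monic_lt (D - \<delta>). c y * goss_fun n (\<pp> * y) z)) + hecke_sum \<pp> R z - ev * R z =
          (\<Sum>x\<in>monic_lt D. d x * goss_fun n x z)"
        using eventually_Omega
      proof eventually_elim
        case (elim z)
        define A1 where "A1 = (\<Sum>x\<in>monic_lt D. (if \<pp> dvd x then 0 else c x) * goss_fun n x z)"
        define A2 where "A2 = (\<Sum>x\<in>monic_lt D. (if \<pp> dvd x then c (x div \<pp>) else 0) * goss_fun n x z)"
        define B where "B = (\<Sum>y\<in>monic_lt D - monic_lt (D - \<delta>). c y * goss_fun n (\<pp> * y) z)"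
        have dsum: "(\<Sum>x\<in>monic_lt D. d x * goss_fun n x z) = ev * S z - emb \<pp> ^ n * A1 - emb \<pp> powi k * A2"
          unfolding A1_def A2_def S_def d_def
          by (simp only: sum_distrib_left sum_subtractf[symmetric] left_diff_distrib mult.assoc)
        have hs: "hecke_sum \<pp> S z = emb \<pp> ^ n * A1"
          unfolding A1_def S_def by (rule hecke_sum_goss_sum[OF P n elim])
        have hR: "hecke_sum \<pp> R z = hecke_sum \<pp> f z - hecke_sum \<pp> S z"
          by (simp add: hecke_sum_def R_def sum_subtractf)
        have eig: "emb \<pp> powi k * f (emb \<pp> * z) + hecke_sum \<pp> f z = ev * f z"
          using ev[OF elim] by (simp add: hecke_eq[OF P])
        have Rz: "R z = f z - S z" by (simp add: R_def)
        have Rp: "R (emb \<pp> * z) = f (emb \<pp> * z) - (A2 + B)"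
          unfolding R_def S\<pp> A2_def B_def by simp
        have "emb \<pp> powi k * (R (emb \<pp> * z) + B) + hecke_sum \<pp> R z - ev * R z =
            (emb \<pp> powi k * f (emb \<pp> * z) + hecke_sum \<pp> f z) - ev * f z + (ev * S z - emb \<pp> ^ n * A1 - emb \<pp> powi k * A2)"
          unfolding hR Rp hs Rz by (simp add: algebra_simps)
        then show ?case unfolding dsum eig B_def by simp
      qed
    qed
  qed
  then show "\<exists>D0. \<forall>D\<ge>D0. t_bigo M (\<lambda>z. \<Sum>x\<in>monic_lt D. (ev * c x - emb \<pp> ^ n * (if \<pp> dvd x then 0 else c x) -
           emb \<pp> powi k * (if \<pp> dvd x then c (x div \<pp>) else 0)) * goss_fun n x z)"
    unfolding d_def by blast
qed

lemma A_expansion_coeffs_eq: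
  assumes c: "\<exists>b\<in>A_plus. c b \<noteq> 0"
    and ev1: "\<And>\<pp>. \<pp> \<in> monic_primes \<Longrightarrow> ev \<pp> * c 1 = emb \<pp> ^ n * c 1"
    and ev2: "\<And>\<pp> y. \<pp> \<in> monic_primes \<Longrightarrow> y \<in> A_plus \<Longrightarrow> ev \<pp> * c (\<pp> * y) = emb \<pp> powi k * c y"
  shows "c 1 \<noteq> 0" "\<And>\<pp>. \<pp> \<in> monic_primes \<Longrightarrow> ev \<pp> = emb \<pp> ^ n"
    "\<And>a. a \<in> A_plus \<Longrightarrow> c a = c 1 * emb a powi (k - int n)"
proof -
  have factor: "\<exists>\<pp>\<in>monic_primes. \<exists>y\<in>A_plus. a = \<pp> * y \<and> degree y < degree a" if "a \<in> A_plus" "a \<noteq> 1" for a :: "'q poly"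
  proof -
    have "0 < degree a" using A_plus_degree_0[OF that(1)] that(2) by auto
    then obtain \<pp> where p: "\<pp> \<in> monic_primes" "\<pp> dvd a" using monic_prime_divisor_exists[OF \<open>a \<in> A_plus\<close>] by blast
    then obtain y where y: "a = \<pp> * y" by auto
    then have yA: "y \<in> A_plus" using that(1) monic_primesD(1)[OF p(1)] by (auto intro: A_plus_mult_cancel)
    have "degree y < degree a" using monic_primesD[OF p(1)] A_plus_nonzero[OF yA] by (simp add: y degree_mult_eq)
    then show ?thesis using p(1) y yA by blast
  qed
  have nz: "emb \<pp> \<noteq> 0" if "\<pp> \<in> monic_primes" for \<pp> using monic_primesD(4)[OF that] by simp
  \<comment> \<open>If ev \<pp> were 0, then \<pp>^k c_y = 0 for all y, and every coefficient would
    vanish.\<close>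
  have ev0: "ev \<pp> \<noteq> 0" if "\<pp> \<in> monic_primes" for \<pp>
    using c ev2[OF that] nz[OF that] by (auto simp: power_int_eq_0_iff)
  show c1: "c 1 \<noteq> 0"
  proof
    assume c1: "c 1 = 0"
    have "c b = 0" if "b \<in> A_plus" for b
      using that
    proof (induction "degree b" arbitrary: b rule: less_induct)
      case less
      show ?case
      proof (cases "b = 1")
        case False
        then obtain \<pp> y where y: "\<pp> \<in> monic_primes" "y \<in> A_plus" "b = \<pp> * y" "degree y < degree b"
          using factor less.prems by blast
        then show ?thesis using ev2[OF y(1,2)] ev0[OF y(1)] less.hyps[OF y(4,2)] by simp
      qed (simp add: c1)
    qed
    then show False using c by blast
  qed
  show ev: "ev \<pp> = emb \<pp> ^ n" if "\<pp> \<in> monic_primes" for \<pp> using ev1[OF that] c1 by simp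
  show "c a = c 1 * emb a powi (k - int n)" if "a \<in> A_plus" for a
    using that
  proof (induction "degree a" arbitrary: a rule: less_induct)
    case less
    show ?case
    proof (cases "a = 1")
      case False
      then obtain \<pp> y where y: "\<pp> \<in> monic_primes" "y \<in> A_plus" "a = \<pp> * y" "degree y < degree a"
        using factor less.prems by blast
      have "emb \<pp> ^ n * c a = emb \<pp> powi k * c y" using ev2[OF y(1,2)] ev[OF y(1)] y(3) by simp
      then have "c a = emb \<pp> powi (k - int n) * c y"
        using nz[OF y(1)] by (simp add: power_int_diff field_simps)
      then show ?thesis using less.hyps[OF y(4,2)] by (simp add: y(3) emb_mult power_int_mult_distrib mult_ac)
    qed simp
  qed
qed

lemma fps_has_sum_const_mult:
  "(h has_sum (F :: 'c fps)) S \<Longrightarrow> ((\<lambda>x. fps_const b * h x) has_sum fps_const b * F) S"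
  unfolding has_sum_def tendsto_fps_iff sum_distrib_left[symmetric] fps_mult_left_const_nth
  by (auto elim!: eventually_mono)

lemma cusp_form_has_t_expansion:
  "f \<in> cusp_forms \<iota> \<pi> k m \<Longrightarrow> has_t_expansion \<iota> \<pi> f (t_expansion \<iota> \<pi> f)"
  unfolding cusp_forms_def modular_forms_def using t_expansion_eq by auto

lemma cusp_form_rigid_analytic: "f \<in> cusp_forms \<iota> \<pi> k m \<Longrightarrow> rigid_analytic \<iota> f"
  unfolding cusp_forms_def modular_forms_def by auto

text \<open>Proportional expansions give proportional values only near infinity; the identity
  theorem for g - b f extends this to all of \<open>Omega\<close>.\<close>

lemma t_expansion_determines:
  assumes f: "f \<in> cusp_forms \<iota> \<pi> k m" and g: "g \<in> cusp_forms \<iota> \<pi> k' m'"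
    and eq: "t_expansion \<iota> \<pi> g = fps_const b * t_expansion \<iota> \<pi> f" and z: "z \<in> Omega \<iota>"
  shows "g z = b * f z"
proof -
  obtain r where r: "\<And>z. r \<le> im z \<Longrightarrow> (\<lambda>i. fps_nth (t_expansion \<iota> \<pi> f) i * tp z ^ i) sums f z"
    using cusp_form_has_t_expansion[OF f] unfolding has_t_expansion_def by blast
  obtain r' where r': "\<And>z. r' \<le> im z \<Longrightarrow> (\<lambda>i. fps_nth (t_expansion \<iota> \<pi> g) i * tp z ^ i) sums g z"
    using cusp_form_has_t_expansion[OF g] unfolding has_t_expansion_def by blast
  have "g z - b * f z = 0" if "max r r' \<le> im z" for z
  proof -
    have "(\<lambda>n. b * (\<Sum>i<n. fps_nth (t_expansion \<iota> \<pi> f) i * tp z ^ i)) \<longlonglongrightarrow> b * f z"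
      using r[of z] that unfolding sums_def by (intro lim_cmult) auto
    moreover have "(\<lambda>n. b * (\<Sum>i<n. fps_nth (t_expansion \<iota> \<pi> f) i * tp z ^ i)) \<longlonglongrightarrow> g z"
      using r'[of z] that unfolding sums_def by (simp add: eq sum_distrib_left mult.assoc)
    ultimately show ?thesis using LIMSEQ_unique by fastforce
  qed
  from rigid_analytic_identity[OF rigid_analytic_diff_cmult[OF cusp_form_rigid_analytic[OF f] cusp_form_rigid_analytic[OF g], of b], of "max r r'", OF this z]
  show ?thesis by simp
qed

lemma eigenform_A_expansion:
  assumes f: "f \<in> cusp_forms \<iota> \<pi> k m" and eig: "hecke_eigenform \<iota> k ev f"
    and n: "n > 0" and A: "has_A_expansion \<iota> \<pi> n c0 c f"
  shows "c 1 \<noteq> 0" "\<And>\<pp>. \<pp> \<in> monic_primes \<Longrightarrow> ev \<pp> = emb \<pp> ^ n"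
    "((\<lambda>a. fps_const (emb a powi (k - int n)) * goss_t \<iota> \<pi> n a) has_sum fps_const (1 / c 1) * t_expansion \<iota> \<pi> f) A_plus"
proof -
  have as: "t_asymp f (t_expansion \<iota> \<pi> f)"
    by (rule has_t_expansion_imp_t_asymp[OF cusp_form_has_t_expansion[OF f]])
  \<comment> \<open>No G_n(t_a) has a constant term: as 0 < q^0, the coefficient formula applies
    with D = 0, where its sum is empty.\<close>
  have "fps_nth (t_expansion \<iota> \<pi> f - fps_const c0) 0 = 0"
    using A_expansion_coeff[OF n A, of 0 0] by (simp add: monic_lt_def polys_lt_0 A_plus_def)
  then have c0: "c0 = 0" using f by (simp add: cusp_forms_def)
  have A0: "has_A_expansion \<iota> \<pi> n 0 c f" using A c0 by simp
  \<comment> \<open>Otherwise f would vanish to every order at infinity, so its expansion and then f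
    itself would be 0 on \<open>Omega\<close>, which an eigenform is not.\<close>
  have cnz: "\<exists>b\<in>A_plus. c b \<noteq> 0"
  proof (rule ccontr)
    assume "\<not> (\<exists>b\<in>A_plus. c b \<noteq> 0)"
    then have "(\<Sum>a\<in>monic_lt D. c a * goss_fun n a z) = 0" for D z
      by (intro sum.neutral) (auto simp: monic_lt_iff)
    then have bt: "t_bigo (CARD('q) ^ D) f" for D using A_expansion_bigt[OF n A0 as, of D] by simp
    have "fps_nth (t_expansion \<iota> \<pi> f) i = 0" for i
      by (rule t_asymp_coeff_zero[OF as bt[of i]]) (use card_field_ge_2[where 'q='q] in \<open>simp add: power_gt_expt\<close>)
    then have "t_expansion \<iota> \<pi> f = fps_const 0 * t_expansion \<iota> \<pi> f" by (simp add: fps_eq_iff)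
    then have "f z = 0" if "z \<in> Omega \<iota>" for z using t_expansion_determines[OF f f _ that, of 0] by simp
    then show False using eig by (auto simp: hecke_eigenform_def)
  qed
  have rel: "ev \<pp> * c x - emb \<pp> ^ n * (if \<pp> dvd x then 0 else c x) -
           emb \<pp> powi k * (if \<pp> dvd x then c (x div \<pp>) else 0) = 0" if "\<pp> \<in> monic_primes" "x \<in> A_plus" for \<pp> x
  proof -
    have ev: "hecke \<iota> k \<pp> f z = ev \<pp> * f z" if "z \<in> Omega \<iota>" for z
      using eig \<open>\<pp> \<in> monic_primes\<close> that by (simp add: hecke_eigenform_def)
    show ?thesis
      by (rule null_expansion_eq_0[OF hecke_null_expansion[OF n as A0 that(1) ev] n that(2)])
  qed
  have ev1: "ev \<pp> * c 1 = emb \<pp> ^ n * c 1" if "\<pp> \<in> monic_primes" for \<pp>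
    using rel[OF that one_in_A_plus] monic_primesD(2)[OF that] by (simp add: prime_elem_def)
  have ev2: "ev \<pp> * c (\<pp> * y) = emb \<pp> powi k * c y" if "\<pp> \<in> monic_primes" "y \<in> A_plus" for \<pp> y
    using rel[OF that(1) A_plus_mult[OF monic_primesD(1)[OF that(1)] that(2)]] monic_primesD(4)[OF that(1)] by simp
  show c1: "c 1 \<noteq> 0" and "\<And>\<pp>. \<pp> \<in> monic_primes \<Longrightarrow> ev \<pp> = emb \<pp> ^ n" 
    using A_expansion_coeffs_eq(1,2)[of c ev n k, OF cnz ev1 ev2] by auto
  have "((\<lambda>a. fps_const (c a) * goss_t \<iota> \<pi> n a) has_sum t_expansion \<iota> \<pi> f) A_plus"
    using A0 by (simp add: has_A_expansion_def)
  from fps_has_sum_const_mult[OF this, of "1 / c 1"]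
  show "((\<lambda>a. fps_const (emb a powi (k - int n)) * goss_t \<iota> \<pi> n a) has_sum fps_const (1 / c 1) * t_expansion \<iota> \<pi> f) A_plus"
  proof (rule has_sum_cong[THEN iffD1, rotated])
    fix a :: "'q poly" assume "a \<in> A_plus"
    then have "c a = c 1 * emb a powi (k - int n)"
      by (intro A_expansion_coeffs_eq(3)[of c ev n k] cnz ev1 ev2)
    then have "1 / c 1 * c a = emb a powi (k - int n)" using c1 by simp
    then show "fps_const (1 / c 1) * (fps_const (c a) * goss_t \<iota> \<pi> n a) = fps_const (emb a powi (k - int n)) * goss_t \<iota> \<pi> n a"
      by (simp add: mult.assoc[symmetric])
  qed
qed

end

theorem theorem2p6:
  fixes \<iota> :: "'q::{field,finite} fls \<Rightarrow> 'c::{field,complete_space}"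
    and \<pi> :: 'c and k m :: int and n :: nat
    and f :: "'c \<Rightarrow> 'c" and ev :: "'q poly \<Rightarrow> 'c"
    and c0 :: 'c and c :: "'q poly \<Rightarrow> 'c"
  assumes "C_infty \<iota>" and "carlitz_period \<iota> \<pi>"
    and "f \<in> cusp_forms \<iota> \<pi> k m"
    and "hecke_eigenform \<iota> k ev f"
    and "n > 0" and "has_A_expansion \<iota> \<pi> n c0 c f"
  shows
    "((\<lambda>a. fps_const (A_emb \<iota> a powi (k - int n)) * goss_t \<iota> \<pi> n a) summable_on A_plus \<and>
      t_expansion \<iota> \<pi> f =
        fps_const (c 1) *
          (\<Sum>\<^sub>\<infinity>a\<in>A_plus. fps_const (A_emb \<iota> a powi (k - int n)) * goss_t \<iota> \<pi> n a)) \<and>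
     (\<forall>\<pp> \<in> monic_primes. ev \<pp> = A_emb \<iota> \<pp> ^ n) \<and>
     (\<forall>m' n' c0' c' g.
        g \<in> cusp_forms \<iota> \<pi> k m' \<longrightarrow> hecke_eigenform \<iota> k ev g \<longrightarrow>
        n' > 0 \<longrightarrow> has_A_expansion \<iota> \<pi> n' c0' c' g \<longrightarrow>
        (\<exists>C. C \<noteq> 0 \<and> (\<forall>z \<in> Omega \<iota>. g z = C * f z)))"
proof -
  interpret carlitz_setting \<iota> \<pi>
    using assms(1,2) by (simp add: carlitz_setting_def carlitz_setting_axioms_def)
  note F = eigenform_A_expansion[OF assms(3-6)]
  define S where "S = (\<Sum>\<^sub>\<infinity>a\<in>A_plus. fps_const (A_emb \<iota> a powi (k - int n)) * goss_t \<iota> \<pi> n a)"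
  have S: "S = fps_const (1 / c 1) * t_expansion \<iota> \<pi> f"
    unfolding S_def by (rule infsumI[OF F(3)])
  have "fps_const (c 1) * S = fps_const (c 1 * (1 / c 1)) * t_expansion \<iota> \<pi> f"
    unfolding S by (simp only: mult.assoc[symmetric] fps_const_mult)
  then have fS: "t_expansion \<iota> \<pi> f = fps_const (c 1) * S" using F(1) by simp
  have "\<exists>C. C \<noteq> 0 \<and> (\<forall>z \<in> Omega \<iota>. g z = C * f z)"
    if g: "g \<in> cusp_forms \<iota> \<pi> k m'" "hecke_eigenform \<iota> k ev g" "n' > 0" "has_A_expansion \<iota> \<pi> n' c0' c' g"
    for m' n' c0' c' g
  proof -
    note G = eigenform_A_expansion[OF g]
    \<comment> \<open>T supplies some prime \<pp>; as |\<pp>| > 1, the eigenvalue \<pp>^n determines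
      the exponent n.\<close>
    have "[:0, 1:] \<in> (A_plus :: 'q poly set)" by (simp add: A_plus_def)
    then obtain \<pp> :: "'q poly" where p: "\<pp> \<in> monic_primes" using monic_prime_divisor_exists[of "[:0, 1:]"] by auto
    have "1 < absv (A_emb \<iota> \<pp>)"
      using monic_primesD[OF p] card_gt_1 by (simp add: absv_emb one_less_power)
    moreover have "absv (A_emb \<iota> \<pp>) ^ n = absv (A_emb \<iota> \<pp>) ^ n'"
      using F(2)[OF p] G(2)[OF p] by (metis absv_power)
    ultimately have nn: "n' = n" by (simp add: power_inject_exp)
    \<comment> \<open>With equal exponents and weights, both expansions are multiples of the same
      series \<open>S\<close>.\<close>
    have "S = fps_const (1 / c' 1) * t_expansion \<iota> \<pi> g"
      unfolding S_def using G(3) by (intro infsumI) (simp add: nn)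
    then have "fps_const (1 / c' 1) * t_expansion \<iota> \<pi> g = fps_const (1 / c 1) * t_expansion \<iota> \<pi> f"
      using S by simp
    then have "fps_const (c' 1) * (fps_const (1 / c' 1) * t_expansion \<iota> \<pi> g) = fps_const (c' 1) * (fps_const (1 / c 1) * t_expansion \<iota> \<pi> f)"
      by simp
    then have "t_expansion \<iota> \<pi> g = fps_const (c' 1 / c 1) * t_expansion \<iota> \<pi> f"
      using G(1) by (simp add: mult.assoc[symmetric])
    then have "\<forall>z\<in>Omega \<iota>. g z = (c' 1 / c 1) * f z"
      using t_expansion_determines[OF assms(3) g(1)] by blast
    then show ?thesis using F(1) G(1) by (intro exI[of _ "c' 1 / c 1"]) simp
  qed
  then show ?thesis
    using F(2,3) fS unfolding S_def summable_on_def by blast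
qed

end
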